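(* Let $k\ge 1$ and let $G$ be a $2k$-regular graph. Then: (1) If $G$ has an edge cut of size less than $2k$, then $\mathsf{M}(G)=0$. (2) If $G$ has no edge cut of size less than $2k$, then $\mathsf{M}(G)>0$. (3) If $G$ has an edge cut $C$ of size exactly $2k$, let $X\sqcup Y$ be the corresponding bipartition of the vertex set. Let $G_1$ be obtained from $G$ by replacing all vertices of $Y$ (together with all edges having both ends in $Y$) by a single new vertex $y$, so that each edge of $C$ joins its endpoint in $X$ to $y$. Define $G_2$ symmetrically by contracting $X$ to a single new vertex. Then $\mathsf{M}(G)=k!\cdot\mathsf{M}(G_1)\cdot\mathsf{M}(G_2)$.
   Context: Graphs are finite and undirected, and may have multiple edges and self-loops. A graph is $2k$-regular if every vertex has degree $2k$, where a self-loop contributes $2$ to the degree. An edge cut is the set of all edges between $X$ and $Y$, for a partition $X\sqcup Y$ of the vertex set into two non-empty parts. Transitions. Let $v$ be a vertex without self-loops, and let $e_1=vw_1,\dots,e_{2k}=vw_{2k}$ be its incident edges. A transition at $v$ is a partition $\tau$ of $\{e_1,\dots,e_{2k}\}$ into $k$ pairs. Write $\mathcal T(v)$ for the set of all $(2k-1)!!$ transitions at $v$. The graph $G_\tau$ is obtained by deleting $v$ together with its incident edges, and then adding, for each pair $\{e_i,e_j\}\in\tau$, a new edge $w_iw_j$; this new edge is a self-loop if $w_i=w_j$. Martin invariant, recursive form. For a $2k$-regular graph $G$ with at least 3 vertices, $\mathsf M(G)$ is the non-negative integer determined by the following rules: - $\mathsf M(G)=0$ if $G$ has a self-loop; - $\mathsf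 M(G)=1$ if $G$ has exactly 3 vertices and no self-loop; - otherwise $\mathsf M(G)=\sum_{\tau\in\mathcal T(v)}\mathsf M(G_\tau)$ for any vertex $v$; the result does not depend on the choice of $v$. Martin invariant, general form. For arbitrary $2k$-regular graphs with $k\ge 2$, $\mathsf M(G)$ is defined by $$\mathsf M(G)=\frac{4(-1)^k}{(k-2)!\,(2k)!}\,\mathfrak m'(G,4-2k),$$ where $\mathfrak m'$ denotes the derivative in $x$ of the Martin polynomial $\mathfrak m(G,x)=\sum_P (x-2)^{c(P)-1}$. Here: - the sum runs over all transition systems $P$, that is, choices at every vertex of a pairing of the half-edges incident to it (a self-loop contributes two half-edges); - $c(P)$ is the number of closed trails into which the edge set decomposes when one follows these pairings. This general form agrees with the recursive form for graphs with at least 3 vertices. For the graph $K_2^{[2k]}$ consisting of two vertices joined by $2k$ parallel edges, it gives $\mathsf M(K_2^{[2k]})=1/k!$. *)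

theory Defs
  imports Complex_Main "HOL-Library.FuncSet" "HOL-Library.Disjoint_Sets"
    "HOL-Computational_Algebra.Polynomial"
begin

definition pairings :: "'a set \<Rightarrow> 'a set set set" where
  "pairings A = {P. partition_on A P \<and> (\<forall>p\<in>P. card p = 2)}"

text \<open>An edge is the set of its two half-edges, and \<open>att\<close> attaches half-edges to vertices. Thus
  parallel edges are distinct sets, and a self-loop is an edge whose two half-edges are attached
  to the same vertex.\<close>

record ('v, 'h) mgraph =
  verts :: "'v set"
  edges :: "'h set set"
  att :: "'h \<Rightarrow> 'v"

definition halves :: "('v, 'h) mgraph \<Rightarrow> 'h set" where
  "halves G = \<Union>(edges G)"

definition halves_at :: "('v, 'h) mgraph \<Rightarrow> 'v \<Rightarrow> 'h set" where
  "halves_at G v = {h \<in> halves G. att G h = v}"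

locale multigraph =
  fixes G :: "('v, 'h) mgraph"
  assumes finite_verts: "finite (verts G)"
    and verts_nonempty: "verts G \<noteq> {}"
    and finite_edges: "finite (edges G)"
    and edges_pairing: "edges G \<in> pairings (halves G)"
    and att_verts: "h \<in> halves G \<Longrightarrow> att G h \<in> verts G"

definition degree_at :: "('v, 'h) mgraph \<Rightarrow> 'v \<Rightarrow> nat" where
  "degree_at G v = card (halves_at G v)"

definition regular :: "('v, 'h) mgraph \<Rightarrow> nat \<Rightarrow> bool" where
  "regular G d \<longleftrightarrow> (\<forall>v\<in>verts G. degree_at G v = d)"

definition has_loop :: "('v, 'h) mgraph \<Rightarrow> bool" where
  "has_loop G \<longleftrightarrow> (\<exists>e\<in>edges G. \<forall>h\<in>e. \<forall>h'\<in>e. att G h = att G h')"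

definition bipartition :: "('v, 'h) mgraph \<Rightarrow> 'v set \<Rightarrow> 'v set \<Rightarrow> bool" where
  "bipartition G X Y \<longleftrightarrow> X \<noteq> {} \<and> Y \<noteq> {} \<and> X \<inter> Y = {} \<and> X \<union> Y = verts G"

definition edges_between :: "('v, 'h) mgraph \<Rightarrow> 'v set \<Rightarrow> 'v set \<Rightarrow> 'h set set" where
  "edges_between G X Y = {e \<in> edges G. (\<exists>h\<in>e. att G h \<in> X) \<and> (\<exists>h\<in>e. att G h \<in> Y)}"

definition edge_cut :: "('v, 'h) mgraph \<Rightarrow> 'h set set \<Rightarrow> bool" where
  "edge_cut G C \<longleftrightarrow> (\<exists>X Y. bipartition G X Y \<and> C = edges_between G X Y)"

text \<open>Replace all vertices outside \<open>X\<close> by the single vertex \<open>y\<close> (used with \<open>y \<notin> X\<close>), dropping the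
  edges with both ends outside \<open>X\<close>.\<close>

definition contract_outside :: "('v, 'h) mgraph \<Rightarrow> 'v set \<Rightarrow> 'v \<Rightarrow> ('v, 'h) mgraph" where
  "contract_outside G X y =
    \<lparr> verts = insert y X,
      edges = {e \<in> edges G. \<exists>h\<in>e. att G h \<in> X},
      att = (\<lambda>h. if att G h \<in> X then att G h else y) \<rparr>"

text \<open>A transition at \<open>v\<close> is a pairing of the half-edges at \<open>v\<close>; if \<open>v\<close> has no self-loop, these
  correspond bijectively to the edges incident to \<open>v\<close>.\<close>

definition transitions :: "('v, 'h) mgraph \<Rightarrow> 'v \<Rightarrow> 'h set set set" where
  "transitions G v = pairings (halves_at G v)"

definition mate :: "('v, 'h) mgraph \<Rightarrow> 'h \<Rightarrow> 'h" where
  "mate G h = (THE h'. {h, h'} \<in> edges G)"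

text \<open>The graph \<open>G\<^sub>\<tau>\<close>. The new edge for a pair of half-edges at \<open>v\<close> reuses the opposite half-edges
  of the two deleted edges, so it joins the other ends of these.\<close>

definition resolve :: "('v, 'h) mgraph \<Rightarrow> 'v \<Rightarrow> 'h set set \<Rightarrow> ('v, 'h) mgraph" where
  "resolve G v \<tau> =
    \<lparr> verts = verts G - {v},
      edges = {e \<in> edges G. \<forall>h\<in>e. att G h \<noteq> v} \<union> (\<lambda>p. mate G ` p) ` \<tau>,
      att = att G \<rparr>"

text \<open>The recursive form, meant for regular graphs with at least 3 vertices. The value does not
  depend on the vertex at which the recursion is expanded, so an arbitrary one is chosen.\<close>

function martin_rec :: "('v, 'h) mgraph \<Rightarrow> nat" where
  "martin_rec G =
    (if has_loop G then 0
     else if card (verts G) \<le> 3 then 1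
     else let v = (SOME v. v \<in> verts G) in \<Sum>\<tau>\<in>transitions G v. martin_rec (resolve G v \<tau>))"
  by pat_completeness auto

termination
proof (relation "measure (\<lambda>G. card (verts G))")
  fix G :: "('v, 'h) mgraph" and v \<tau>
  assume card: "\<not> card (verts G) \<le> 3" and v: "v = (SOME v. v \<in> verts G)"
  from card have fin: "finite (verts G)" and "verts G \<noteq> {}"
    by (auto intro: card_ge_0_finite)
  then have "v \<in> verts G"
    unfolding v by (simp add: some_in_eq)
  with fin show "(resolve G v \<tau>, G) \<in> measure (\<lambda>G. card (verts G))"
    using card_Diff1_less by (fastforce simp: resolve_def simp del: card_Diff_insert card_Diff_singleton)
qed simp

declare martin_rec.simps [simp del]

definition transition_systems :: "('v, 'h) mgraph \<Rightarrow> ('v \<Rightarrow> 'h set set) set" where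
  "transition_systems G = (\<Pi>\<^sub>E v\<in>verts G. transitions G v)"

text \<open>Two edges are consecutive if some half-edge of the one is paired with a half-edge of the
  other; the closed trails traced out by a transition system are the classes of edges generated
  by this relation.\<close>

definition consecutive :: "('v, 'h) mgraph \<Rightarrow> ('v \<Rightarrow> 'h set set) \<Rightarrow> ('h set \<times> 'h set) set" where
  "consecutive G P =
    {(e, f). e \<in> edges G \<and> f \<in> edges G \<and>
      (\<exists>v\<in>verts G. \<exists>h\<in>e. \<exists>h'\<in>f. {h, h'} \<in> P v)}"

definition num_trails :: "('v, 'h) mgraph \<Rightarrow> ('v \<Rightarrow> 'h set set) \<Rightarrow> nat" where
  "num_trails G P = card (edges G // (consecutive G P)\<^sup>*)"

definition martin_poly :: "('v, 'h) mgraph \<Rightarrow> real poly" where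
  "martin_poly G = (\<Sum>P\<in>transition_systems G. [:-2, 1:] ^ (num_trails G P - 1))"

text \<open>For at least 3 vertices this is the recursive form, otherwise the general form, which needs
  \<open>k \<ge> 2\<close>. For \<open>k = 1\<close> and at most 2 vertices neither form applies literally. For \<open>k \<ge> 2\<close> the Martin
  polynomial \<open>m\<close> of a \<open>2k\<close>-regular graph vanishes at \<open>4 - 2k\<close>, so that the general form equals
  \<open>2 (-1)^(k+1) / ((k-1)! (2k)!)\<close> times the derivative of \<open>(x - 2) m(x)\<close> at \<open>4 - 2k\<close>. At \<open>k = 1\<close>
  the latter is \<open>m(2)\<close>, which is 1 for a single cycle and 0 otherwise. This is taken as the
  value; it gives 1 = 1/k! for two vertices joined by two edges, and it also agrees with the
  recursive form on 2-regular graphs with at least 3 vertices.\<close>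

definition martin :: "nat \<Rightarrow> ('v, 'h) mgraph \<Rightarrow> real" where
  "martin k G =
    (if card (verts G) \<ge> 3 then real (martin_rec G)
     else if k \<ge> 2 then
       4 * (-1) ^ k / (fact (k - 2) * fact (2 * k)) *
         poly (pderiv (martin_poly G)) (4 - 2 * real k)
     else poly (martin_poly G) 2)"

end

theory Submission
  imports Defs
begin

text \<open>Let \<open>Z(G) = \<Sum>\<^sub>P y\<^bsup>c(P)\<^esup>\<close> with \<open>y = x - 2\<close>. Resolving a vertex without self-loops leaves the
  circuits of a transition system intact, so \<open>Z(G) = \<Sum>\<^sub>\<tau> Z(G\<^sub>\<tau>)\<close>, while removing a self-loop at a
  vertex of degree \<open>d\<close> costs a factor \<open>y + d - 2\<close>. Hence a vertex of degree \<open>2k\<close> contributes a root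
  of \<open>Z(G)\<close> at \<open>x = 4 - 2k\<close>, and a self-loop next to another vertex a double root. The suitably
  normalised derivative at \<open>4 - 2k\<close> therefore vanishes on graphs with self-loops and at least two
  vertices, can be expanded at every vertex, and equals the Martin invariant.

  For a cut of size less than \<open>2k\<close>, expand all vertices on one side: the cut never grows, and when
  a single vertex is left on that side it carries a self-loop. Without such cuts, Lovasz's
  splitting-off argument provides at each vertex a transition that creates no such cut. For a cut of
  size exactly \<open>2k\<close>, expand all but one of the vertices of \<open>X\<close>: the transitions that shrink the
  cut contribute zero to both sides of the product formula.\<close>

subsection \<open>Pairings\<close>

text \<open>The recursion \<open>martin_rec\<close> expands at one arbitrary vertex, while the cut
  arguments must expand at a vertex of a prescribed side. Independence of the vertex is not visible
  in the recursion; the circuit sum supplies it, being defined without any choice. One formula must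
  also cover fewer than three vertices, because a contraction can have just two and the positivity
  argument runs down to one. The normalisation is fixed by the one-vertex graph. Its circuit sum is
  the product of \<open>y + 2j\<close> for \<open>j < k\<close>, with a simple root at
  \<open>y = 2 - 2k\<close>, and the constant turns the derivative there into 2^k/(2k)!. The other
  values follow by expansion: two loopless vertices give (2k-1)!! 2^k/(2k)! = 1/k!, and on three
  loopless vertices exactly k! transitions leave no loop, which gives 1. The factor k! of the
  product formula is the inverse of the two-vertex value. Half-edges keep their names under
  resolution and contraction, so transitions of different graphs at a vertex can be literally the
  same sets, and two of the three isomorphisms needed are the identity on half-edges.\<close>

lemma pairingsI:
  assumes "\<Union>P = A" "\<And>p. p \<in> P \<Longrightarrow> card p = 2" "\<And>p q h. p \<in> P \<Longrightarrow> q \<in> P \<Longrightarrow> h \<in> p \<Longrightarrow> h \<in> q \<Longrightarrow> p = q"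
  shows "P \<in> pairings A"
proof -
  have "{} \<notin> P" using assms(2) by fastforce
  then show ?thesis
    using assms unfolding pairings_def partition_on_def disjoint_def by blast
qed

lemma
  assumes "P \<in> pairings A"
  shows pairings_Union: "\<Union>P = A"
    and pairings_card2: "p \<in> P \<Longrightarrow> card p = 2"
    and pairings_eq: "p \<in> P \<Longrightarrow> q \<in> P \<Longrightarrow> h \<in> p \<Longrightarrow> h \<in> q \<Longrightarrow> p = q"
proof -
  show "\<Union>P = A" using assms by (simp add: pairings_def partition_on_def)
  show "p \<in> P \<Longrightarrow> card p = 2" using assms by (simp add: pairings_def)
  show "p \<in> P \<Longrightarrow> q \<in> P \<Longrightarrow> h \<in> p \<Longrightarrow> h \<in> q \<Longrightarrow> p = q"
    using assms unfolding pairings_def partition_on_def disjoint_def by blast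
qed

text \<open>A pairing seen as a fixed-point-free involution of its ground set. \<open>mate\<close>
  is this function for the pairing \<open>edges G\<close>, so the same facts serve edges and
  transitions.\<close>

definition partner :: "'a set set \<Rightarrow> 'a \<Rightarrow> 'a" where
  "partner P h = (THE h'. {h, h'} \<in> P)"

lemma partner_eqI:
  assumes "P \<in> pairings A" "{h, h'} \<in> P"
  shows "partner P h = h'"
  unfolding partner_def
proof (rule the_equality)
  fix g assume "{h, g} \<in> P"
  then have "{h, g} = {h, h'}" "card {h, g} = 2"
    using pairings_eq[OF assms(1)] assms(2) pairings_card2[OF assms(1)] by auto
  then show "g = h'" by (auto simp: doubleton_eq_iff)
qed fact

lemma pairings_distinct:
  assumes "P \<in> pairings A" "{h, h'} \<in> P"
  shows "h \<noteq> h'"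
  using pairings_card2[OF assms] by (auto simp: card_2_iff)

lemma partner_in:
  assumes P: "P \<in> pairings A" and h: "h \<in> A"
  shows "{h, partner P h} \<in> P"
proof -
  obtain p where p: "p \<in> P" "h \<in> p" using pairings_Union[OF P] h by blast
  then obtain h' where "p = {h, h'}"
    using pairings_card2[OF P p(1)] by (auto simp: card_2_iff)
  then show ?thesis using partner_eqI[OF P] p(1) by auto
qed

lemma partner_mem:
  assumes "P \<in> pairings A" "h \<in> A"
  shows "partner P h \<in> A"
  using partner_in[OF assms] pairings_Union[OF assms(1)] by blast

lemma partner_neq:
  assumes "P \<in> pairings A" "h \<in> A"
  shows "partner P h \<noteq> h"
  using pairings_distinct[OF assms(1) partner_in[OF assms]] by auto

lemma partner_partner:
  assumes "P \<in> pairings A" "h \<in> A"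
  shows "partner P (partner P h) = h"
  by (rule partner_eqI[OF assms(1)]) (use partner_in[OF assms] in \<open>simp add: insert_commute\<close>)

lemma pairings_member:
  assumes P: "P \<in> pairings A" and p: "p \<in> P" and h: "h \<in> p"
  shows "p = {h, partner P h}"
proof -
  have "h \<in> A" using pairings_Union[OF P] p h by auto
  from pairings_eq[OF P p partner_in[OF P this] h] show ?thesis by simp
qed

lemma pairings_memberE:
  assumes P: "P \<in> pairings A" and p: "p \<in> P"
  obtains h where "h \<in> A" "p = {h, partner P h}"
proof -
  obtain h where "h \<in> p" using pairings_card2[OF P p] by fastforce
  moreover from this have "h \<in> A" using pairings_Union[OF P] p by auto
  ultimately show ?thesis using that pairings_member[OF P p] by blast
qed

lemma finite_pairings:
  assumes "finite A"
  shows "finite (pairings A)"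
proof (rule finite_subset)
  show "pairings A \<subseteq> Pow (Pow A)" using pairings_Union by blast
qed (use assms in auto)

lemma finite_pairing:
  assumes "P \<in> pairings A" "finite A"
  shows "finite P"
  using pairings_Union[OF assms(1)] assms(2) by (intro finite_UnionD) simp

lemma pairings_empty: "pairings {} = {{}}"
proof -
  have "P = {}" if "P \<in> pairings {}" for P :: "'a set set"
    using pairings_Union[OF that] pairings_card2[OF that] by fastforce
  then show ?thesis by (auto intro: pairingsI)
qed

lemma pairings_union:
  assumes P: "P \<in> pairings A" and Q: "Q \<in> pairings B" and "A \<inter> B = {}"
  shows "P \<union> Q \<in> pairings (A \<union> B)"
proof (rule pairingsI)
  show "\<Union>(P \<union> Q) = A \<union> B" using pairings_Union[OF P] pairings_Union[OF Q] by auto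
  show "card p = 2" if "p \<in> P \<union> Q" for p
    using that pairings_card2[OF P] pairings_card2[OF Q] by auto
  show "p = q" if "p \<in> P \<union> Q" "q \<in> P \<union> Q" "h \<in> p" "h \<in> q" for p q h
    using that assms pairings_eq[OF P, of p q h] pairings_eq[OF Q, of p q h]
      pairings_Union[OF P] pairings_Union[OF Q] by blast
qed

lemma pairings_subset:
  assumes P: "P \<in> pairings A" and "Q \<subseteq> P"
  shows "Q \<in> pairings (\<Union>Q)"
proof (rule pairingsI)
  show "card p = 2" if "p \<in> Q" for p using that assms(2) pairings_card2[OF P] by auto
  show "p = q" if "p \<in> Q" "q \<in> Q" "h \<in> p" "h \<in> q" for p q h
    using that assms(2) pairings_eq[OF P, of p q h] by auto
qed simp

lemma pairings_Diff:
  assumes P: "P \<in> pairings A" and "Q \<subseteq> P"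
  shows "P - Q \<in> pairings (A - \<Union>Q)"
proof -
  have "\<Union>(P - Q) = A - \<Union>Q"
    using pairings_Union[OF P] pairings_eq[OF P] assms(2) by blast
  then show ?thesis using pairings_subset[OF P, of "P - Q"] by auto
qed

lemma pairings_doubleton: "a \<noteq> b \<Longrightarrow> {{a, b}} \<in> pairings {a, b}"
  by (rule pairingsI) auto

lemma pairings_insert_pair:
  assumes "P \<in> pairings A" "a \<noteq> b" "a \<notin> A" "b \<notin> A"
  shows "insert {a, b} P \<in> pairings (insert a (insert b A))"
  using pairings_union[OF pairings_doubleton[OF assms(2)] assms(1)] assms by simp

lemma pairings_remove_pair:
  assumes "P \<in> pairings A" "{a, b} \<in> P"
  shows "P - {{a, b}} \<in> pairings (A - {a, b})"
  using pairings_Diff[OF assms(1), of "{{a, b}}"] assms(2) by simp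

lemma pairings_image:
  assumes P: "P \<in> pairings A" and f: "inj_on f A"
  shows "(`) f ` P \<in> pairings (f ` A)"
proof (rule pairingsI)
  have sub: "p \<subseteq> A" if "p \<in> P" for p using that pairings_Union[OF P] by auto
  show "\<Union>((`) f ` P) = f ` A" using pairings_Union[OF P] by blast
  show "card p = 2" if "p \<in> (`) f ` P" for p
    using that sub pairings_card2[OF P] card_image inj_on_subset[OF f] by (metis (no_types, lifting) imageE)
  show "p = q" if pq: "p \<in> (`) f ` P" "q \<in> (`) f ` P" and h: "h \<in> p" "h \<in> q" for p q h
  proof -
    obtain p' q' where p': "p' \<in> P" "p = f ` p'" and q': "q' \<in> P" "q = f ` q'" using pq by auto
    obtain x x' where x: "x \<in> p'" "h = f x" "x' \<in> q'" "h = f x'" using h p' q' by auto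
    then have "x = x'" using inj_onD[OF f] sub p'(1) q'(1) by auto
    then show ?thesis using pairings_eq[OF P p'(1) q'(1)] x p' q' by auto
  qed
qed

text \<open>A pairing is determined by the partner \<open>b\<close> of \<open>a\<close> and a
  pairing of the rest. With constant or indicator summands this is the recursion behind the counts
  (2k-1)!! and k!.\<close>

lemma sum_pairings_insert:
  fixes g :: "'a set set \<Rightarrow> 'b::comm_monoid_add"
  assumes fin: "finite A" and a: "a \<notin> A"
  shows "(\<Sum>P\<in>pairings (insert a A). g P) = (\<Sum>b\<in>A. \<Sum>Q\<in>pairings (A - {b}). g (insert {a, b} Q))"
proof -
  have "(\<Sum>b\<in>A. \<Sum>Q\<in>pairings (A - {b}). g (insert {a, b} Q))
      = (\<Sum>(b, Q)\<in>(SIGMA b:A. pairings (A - {b})). g (insert {a, b} Q))"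
    using fin by (intro sum.Sigma) (auto intro: finite_pairings)
  also have "\<dots> = (\<Sum>P\<in>pairings (insert a A). g P)"
  proof (rule sum.reindex_bij_witness[where i = "\<lambda>P. (partner P a, P - {{a, partner P a}})"
        and j = "\<lambda>(b, Q). insert {a, b} Q"])
    fix x assume "x \<in> (SIGMA b:A. pairings (A - {b}))"
    then obtain b Q where x: "x = (b, Q)" and b: "b \<in> A" and Q: "Q \<in> pairings (A - {b})" by auto
    have *: "insert {a, b} Q \<in> pairings (insert a A)"
      using pairings_insert_pair[OF Q, of a b] a b by (auto simp: insert_absorb)
    then show "(case x of (b, Q) \<Rightarrow> insert {a, b} Q) \<in> pairings (insert a A)" by (simp add: x)
    have "{a, b} \<notin> Q" using pairings_Union[OF Q] by auto
    moreover have "partner (insert {a, b} Q) a = b" by (rule partner_eqI[OF *]) simp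
    ultimately show "(partner (case x of (b, Q) \<Rightarrow> insert {a, b} Q) a, (case x of (b, Q) \<Rightarrow> insert {a, b} Q) -
      {{a, partner (case x of (b, Q) \<Rightarrow> insert {a, b} Q) a}}) = x" by (auto simp: x)
  next
    fix P assume P: "P \<in> pairings (insert a A)"
    let ?b = "partner P a"
    have ab: "{a, ?b} \<in> P" and b: "?b \<in> A"
      using partner_in[OF P] partner_mem[OF P] partner_neq[OF P] by auto
    have "insert a A - {a, ?b} = A - {?b}" using a by auto
    then have "P - {{a, ?b}} \<in> pairings (A - {?b})"
      using pairings_remove_pair[OF P ab] by simp
    with b show "(?b, P - {{a, ?b}}) \<in> (SIGMA b:A. pairings (A - {b}))" by auto
    show "(case (?b, P - {{a, ?b}}) of (b, Q) \<Rightarrow> insert {a, b} Q) = P" using ab by auto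
  qed auto
  finally show ?thesis by simp
qed

lemma card_pairings:
  assumes "finite A" "card A = 2 * k"
  shows "card (pairings A) = (\<Prod>j<k. 2 * j + 1)"
  using assms
proof (induction k arbitrary: A)
  case 0
  then show ?case by (simp add: pairings_empty)
next
  case (Suc k)
  then obtain a B where A: "A = insert a B" "a \<notin> B" by (metis card_Suc_eq mult_Suc_right add_Suc add_2_eq_Suc)
  with Suc.prems have B: "finite B" "card B = 2 * k + 1" by auto
  have "card (pairings A) = (\<Sum>b\<in>B. card (pairings (B - {b})))"
    using sum_pairings_insert[OF B(1) A(2), of "\<lambda>_. 1::nat"] A(1) by simp
  also have "\<dots> = (\<Sum>b\<in>B. \<Prod>j<k. 2 * j + 1)"
    using B by (intro sum.cong Suc.IH) auto
  finally show ?case using B by (simp add: mult.commute)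
qed

text \<open>Pairs inside neither \<open>A\<close> nor \<open>B\<close> join the two sets, so these
  pairings are the bijections from \<open>A\<close> to \<open>B\<close>.\<close>

lemma card_cross_pairings:
  assumes "finite A" "finite B" "A \<inter> B = {}" "card A = k" "card B = k"
  shows "card {P \<in> pairings (A \<union> B). \<forall>p\<in>P. \<not> p \<subseteq> A \<and> \<not> p \<subseteq> B} = fact k"
  using assms
proof (induction k arbitrary: A B)
  case 0
  then have "{P \<in> pairings (A \<union> B). \<forall>p\<in>P. \<not> p \<subseteq> A \<and> \<not> p \<subseteq> B} = {{}}"
    by (auto simp: pairings_empty)
  then show ?case by simp
next
  case (Suc k)
  let ?c = "\<lambda>A B P. if \<forall>p\<in>P. \<not> p \<subseteq> A \<and> \<not> p \<subseteq> B then 1 else 0 :: nat"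
  have card_eq: "card {P \<in> pairings (A \<union> B). \<forall>p\<in>P. \<not> p \<subseteq> A \<and> \<not> p \<subseteq> B} = (\<Sum>P\<in>pairings (A \<union> B). ?c A B P)"
    if "finite A" "finite B" for A B :: "'a set"
    using that finite_pairings[of "A \<union> B"] by (simp flip: sum.inter_filter)
  from Suc.prems(4) obtain a A' where A: "A = insert a A'" "a \<notin> A'" by (metis card_Suc_eq)
  with Suc.prems have fin: "finite A'" "card A' = k" "a \<notin> A' \<union> B" by auto
  have in_A: "?c A B (insert {a, b} Q) = 0" if "b \<in> A'" for b Q
    using that A(1) by auto
  have in_B: "(\<Sum>Q\<in>pairings (A' \<union> B - {b}). ?c A B (insert {a, b} Q)) = fact k" if b: "b \<in> B" for b
  proof -
    have eq: "A' \<union> B - {b} = A' \<union> (B - {b})" using b Suc.prems(3) A by auto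
    have "?c A B (insert {a, b} Q) = ?c A' (B - {b}) Q" if Q: "Q \<in> pairings (A' \<union> (B - {b}))" for Q
    proof -
      have "p \<subseteq> A' \<union> (B - {b})" if "p \<in> Q" for p using that pairings_Union[OF Q] by auto
      then have "p \<subseteq> A \<longleftrightarrow> p \<subseteq> A'" "p \<subseteq> B \<longleftrightarrow> p \<subseteq> B - {b}" if "p \<in> Q" for p
        using that A fin Suc.prems(3) b by blast+
      moreover have "\<not> {a, b} \<subseteq> A" "\<not> {a, b} \<subseteq> B" using A fin(3) Suc.prems(3) b by auto
      ultimately show ?thesis by auto
    qed
    then have "(\<Sum>Q\<in>pairings (A' \<union> B - {b}). ?c A B (insert {a, b} Q))
        = (\<Sum>Q\<in>pairings (A' \<union> (B - {b})). ?c A' (B - {b}) Q)"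
      unfolding eq by (rule sum.cong[OF refl])
    also have "\<dots> = fact k"
    proof -
      have "A' \<inter> (B - {b}) = {}" using Suc.prems(3) A(1) by auto
      then show ?thesis
        using card_eq[of A' "B - {b}"] Suc.IH[of A' "B - {b}"] fin Suc.prems(2,5) b by simp
    qed
    finally show ?thesis .
  qed
  have "card {P \<in> pairings (A \<union> B). \<forall>p\<in>P. \<not> p \<subseteq> A \<and> \<not> p \<subseteq> B} = (\<Sum>P\<in>pairings (insert a (A' \<union> B)). ?c A B P)"
    using card_eq[OF Suc.prems(1,2)] A(1) by simp
  also have "\<dots> = (\<Sum>b\<in>A' \<union> B. \<Sum>Q\<in>pairings (A' \<union> B - {b}). ?c A B (insert {a, b} Q))"
    using fin Suc.prems by (intro sum_pairings_insert) auto
  also have "\<dots> = (\<Sum>b\<in>A'. \<Sum>Q\<in>pairings (A' \<union> B - {b}). ?c A B (insert {a, b} Q)) +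
      (\<Sum>b\<in>B. \<Sum>Q\<in>pairings (A' \<union> B - {b}). ?c A B (insert {a, b} Q))"
    using fin Suc.prems A by (intro sum.union_disjoint) auto
  also have "\<dots> = (\<Sum>b\<in>B. fact k)"
    using in_A in_B by simp
  finally show ?case using Suc.prems by simp
qed

text \<open>A mixed pair contributes one element and a pure pair two. This count yields the size of
  a cut from degrees, its loss under a resolution, and the degree of a contracted vertex.\<close>

lemma card_pairing_split:
  assumes P: "P \<in> pairings A" and fin: "finite A"
  shows "card {h \<in> A. Q h} = card {p \<in> P. (\<exists>h\<in>p. Q h) \<and> (\<exists>h\<in>p. \<not> Q h)} + 2 * card {p \<in> P. \<forall>h\<in>p. Q h}"
proof -
  have finP: "finite P" by (rule finite_pairing[OF P fin])
  have "{h \<in> A. Q h} = (\<Union>p\<in>P. {h \<in> p. Q h})" using pairings_Union[OF P] by auto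
  also have "card \<dots> = (\<Sum>p\<in>P. card {h \<in> p. Q h})"
  proof (rule card_UN_disjoint)
    show "\<forall>p\<in>P. finite {h \<in> p. Q h}"
      using pairings_Union[OF P] fin by (auto intro: finite_subset)
    show "\<forall>p\<in>P. \<forall>q\<in>P. p \<noteq> q \<longrightarrow> {h \<in> p. Q h} \<inter> {h \<in> q. Q h} = {}"
      using pairings_eq[OF P] by blast
  qed fact
  also have "\<dots> = (\<Sum>p\<in>P. (if (\<exists>h\<in>p. Q h) \<and> (\<exists>h\<in>p. \<not> Q h) then 1 else 0) + 2 * (if \<forall>h\<in>p. Q h then 1 else 0))"
  proof (rule sum.cong[OF refl])
    fix p assume "p \<in> P"
    then obtain h h' where p: "p = {h, h'}" "h \<noteq> h'"
      using pairings_card2[OF P] by (metis card_2_iff)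
    have "{g \<in> p. Q g} = (if Q h then {h} else {}) \<union> (if Q h' then {h'} else {})" using p by auto
    then show "card {h \<in> p. Q h} = (if (\<exists>h\<in>p. Q h) \<and> (\<exists>h\<in>p. \<not> Q h) then 1 else 0) + 2 * (if \<forall>h\<in>p. Q h then 1 else 0)"
      using p by auto
  qed
  also have "\<dots> = card {p \<in> P. (\<exists>h\<in>p. Q h) \<and> (\<exists>h\<in>p. \<not> Q h)} + 2 * card {p \<in> P. \<forall>h\<in>p. Q h}"
    using finP by (simp add: sum.distrib flip: sum_distrib_left sum.inter_filter)
  finally show ?thesis .
qed

subsection \<open>Splitting off\<close>

text \<open>Here \<open>d\<close> stands for the cut function of the graph without \<open>v\<close>,
  \<open>H\<close> for the half-edges at \<open>v\<close> and \<open>f\<close> for their far ends,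
  so \<open>d X + card {h \<in> H. f h \<in> X}\<close> is the size of the cut around
  \<open>X\<close>. Keeping \<open>d\<close> abstract lets the induction absorb a pair already split
  off as a further summand of \<open>d\<close>.\<close>

lemma splitting_off:
  fixes d :: "'v set \<Rightarrow> nat" and f :: "'h \<Rightarrow> 'v"
  assumes "finite H" "finite W" "f ` H \<subseteq> W"
    and "\<And>X. X \<subseteq> W \<Longrightarrow> d (W - X) = d X"
    and "\<And>X Y. X \<subseteq> W \<Longrightarrow> Y \<subseteq> W \<Longrightarrow> d (X \<inter> Y) + d (X \<union> Y) \<le> d X + d Y"
    and "\<And>X. X \<subseteq> W \<Longrightarrow> even (d X + card {h \<in> H. f h \<in> X})"
    and "\<And>X. X \<subseteq> W \<Longrightarrow> X \<noteq> {} \<Longrightarrow> X \<noteq> W \<Longrightarrow> 2 * k \<le> d X + card {h \<in> H. f h \<in> X}"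
  shows "\<exists>\<tau>\<in>pairings H. \<forall>X. X \<subseteq> W \<and> X \<noteq> {} \<and> X \<noteq> W \<longrightarrow>
    2 * k \<le> d X + card {p \<in> \<tau>. (\<exists>h\<in>p. f h \<in> X) \<and> (\<exists>h\<in>p. f h \<notin> X)}"
  using assms
proof (induction "card H" arbitrary: H d rule: less_induct)
  case less
  note fin = less.prems(1) and finW = less.prems(2) and img = less.prems(3)
    and sym = less.prems(4) and sub = less.prems(5) and par = less.prems(6) and conn = less.prems(7)
  define c where "c X = card {h \<in> H. f h \<in> X}" for X
  show ?case
  proof (cases "H = {}")
    case True
    then show ?thesis using conn by (auto simp: pairings_empty)
  next
    case False
    then obtain a where a: "a \<in> H" by auto
    \<comment> \<open>The pair \<open>a\<close>, \<open>b\<close> must not lie inside a tight set. The tight sets containing the end of \<open>a\<close> are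
      closed under union, so it suffices to choose \<open>b\<close> outside the largest one.\<close>
    define T where "T = {X. X \<subseteq> W \<and> X \<noteq> W \<and> f a \<in> X \<and> d X + c X = 2 * k}"
    have c_mod: "c X + c Y = c (X \<inter> Y) + c (X \<union> Y)" for X Y
    proof -
      have "{h \<in> H. f h \<in> X \<union> Y} = {h \<in> H. f h \<in> X} \<union> {h \<in> H. f h \<in> Y}"
        "{h \<in> H. f h \<in> X \<inter> Y} = {h \<in> H. f h \<in> X} \<inter> {h \<in> H. f h \<in> Y}" by auto
      then show ?thesis unfolding c_def using card_Un_Int[of "{h \<in> H. f h \<in> X}" "{h \<in> H. f h \<in> Y}"] fin by simp
    qed
    have c_pos: "c X \<ge> 1" if "f a \<in> X" for X
    proof -
      have "{h \<in> H. f h \<in> X} \<noteq> {}" using a that by auto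
      then show ?thesis unfolding c_def using fin by (simp add: Suc_leI card_gt_0_iff)
    qed
    have union: "X \<union> Y \<in> T" if X: "X \<in> T" and Y: "Y \<in> T" for X Y
    proof (cases "X \<union> Y = W")
      \<comment> \<open>\<open>X \<inter> Y\<close> contains \<open>f a\<close>, so its cut is at
        least \<open>2k\<close>; submodularity of \<open>d\<close> and modularity of
        \<open>c\<close> then leave no slack for the union.\<close>
      case False
      have "d (X \<inter> Y) + d (X \<union> Y) \<le> d X + d Y" using sub X Y by (auto simp: T_def)
      moreover have "2 * k \<le> d (X \<inter> Y) + c (X \<inter> Y)" "2 * k \<le> d (X \<union> Y) + c (X \<union> Y)"
        unfolding c_def using X Y False by (intro conn; force simp: T_def)+
      ultimately have "d (X \<union> Y) + c (X \<union> Y) = 2 * k"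
        using c_mod[of X Y] X Y by (simp add: T_def)
      then show ?thesis using X Y False by (auto simp: T_def)
    next
      case True
      \<comment> \<open>If two tight sets cover \<open>W\<close>, uncrossing \<open>X\<close> with
        the complement of \<open>Y\<close> bounds \<open>d\<close> on both differences. The
        half-edges ending in \<open>X \<inter> Y\<close> are then missing twice, against
        \<open>c_pos\<close>.\<close>
      have "d (X \<inter> (W - Y)) + d (X \<union> (W - Y)) \<le> d X + d (W - Y)"
        using sub X by (auto simp: T_def)
      moreover have "X \<inter> (W - Y) = X - Y" "X \<union> (W - Y) = W - (Y - X)"
        using X Y by (auto simp: T_def)
      moreover have "d (W - Y) = d Y" "d (W - (Y - X)) = d (Y - X)"
        using X Y by (intro sym; auto simp: T_def)+
      ultimately have "d (X - Y) + d (Y - X) \<le> d X + d Y" by simp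
      moreover have "X - Y \<noteq> {}" "Y - X \<noteq> {}" using X Y True by (auto simp: T_def)
      then have "2 * k \<le> d (X - Y) + c (X - Y)" "2 * k \<le> d (Y - X) + c (Y - X)"
        unfolding c_def using X Y by (intro conn; auto simp: T_def)+
      moreover have "c X = c (X - Y) + c (X \<inter> Y)" "c Y = c (Y - X) + c (X \<inter> Y)"
      proof -
        have "(X - Y) \<inter> (X \<inter> Y) = {}" "(X - Y) \<union> (X \<inter> Y) = X"
          "(Y - X) \<inter> (X \<inter> Y) = {}" "(Y - X) \<union> (X \<inter> Y) = Y" by auto
        then show "c X = c (X - Y) + c (X \<inter> Y)" "c Y = c (Y - X) + c (X \<inter> Y)"
          using c_mod[of "X - Y" "X \<inter> Y"] c_mod[of "Y - X" "X \<inter> Y"]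
          by (simp_all add: c_def)
      qed
      ultimately have False using c_pos[of "X \<inter> Y"] X Y by (auto simp: T_def)
      then show ?thesis ..
    qed
    have "\<exists>b\<in>H. b \<noteq> a \<and> (\<forall>X\<in>T. f b \<notin> X)"
    proof (cases "T = {}")
      case True
      \<comment> \<open>Without tight sets any second half-edge will do; it exists because parity on
        the empty set and on \<open>W\<close> makes \<open>card H\<close> even.\<close>
      have "even (d {} + c {})" "even (d W + c W)" "d W = d {}"
        using par[of "{}"] par[of W] sym[of W] by (auto simp: c_def)
      moreover have "c {} = 0" "c W = card H" using img by (auto simp: c_def intro!: arg_cong[of _ _ card])
      ultimately have "even (card H)" by simp
      then have "H \<noteq> {a}" by auto
      then show ?thesis using True a by auto
    next
      case False
      have "finite T" unfolding T_def using finW by (auto intro: finite_subset[of _ "Pow W"])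
      then obtain M where M: "M \<in> T" "\<And>X. X \<in> T \<Longrightarrow> card X \<le> card M"
        using False obtains_MAX[of T card] by (metis Max_ge finite_imageI imageI)
      have finT: "finite X" if "X \<in> T" for X using that finW by (auto simp: T_def intro: finite_subset)
      have sub_M: "X \<subseteq> M" if "X \<in> T" for X
      proof -
        have "M = X \<union> M"
          using card_seteq[of "X \<union> M" M] M union[OF that M(1)] finT by auto
        then show ?thesis by auto
      qed
      \<comment> \<open>If all half-edges ended in \<open>M\<close>, its complement would have the
        same \<open>d\<close> and \<open>c\<close> equal to 0, so \<open>d M\<close> alone would
        reach \<open>2k\<close>, although \<open>c M\<close> is positive.\<close>
      have "\<exists>b\<in>H. f b \<notin> M"
      proof (rule ccontr)
        assume "\<not> ?thesis"
        then have "{h \<in> H. f h \<in> W - M} = {}" by auto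
        then have "c (W - M) = 0" by (simp only: c_def card.empty)
        moreover have "d (W - M) = d M" using sym M(1) by (auto simp: T_def)
        moreover have "2 * k \<le> d (W - M) + c (W - M)"
          unfolding c_def using M(1) by (intro conn) (auto simp: T_def)
        ultimately show False using M(1) c_pos[of M] by (auto simp: T_def)
      qed
      then obtain b where "b \<in> H" "f b \<notin> M" by auto
      moreover have "f a \<in> M" using M(1) by (simp add: T_def)
      ultimately show ?thesis using sub_M by (intro bexI[of _ b]) auto
    qed
    then obtain b where b: "b \<in> H" "b \<noteq> a" "\<And>X. X \<in> T \<Longrightarrow> f b \<notin> X" by auto
    \<comment> \<open>\<open>s\<close> is the cut function of the single new edge from
      \<open>f a\<close> to \<open>f b\<close>; \<open>d + s\<close> and \<open>c'\<close> describe
      the situation after splitting off.\<close>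
    define s where "s X = (if (f a \<in> X) = (f b \<in> X) then 0 else 1 :: nat)" for X
    define c' where "c' X = card {h \<in> H - {a, b}. f h \<in> X}" for X
    have c_eq: "c X = c' X + (if f a \<in> X then 1 else 0) + (if f b \<in> X then 1 else 0)" for X
    proof -
      have "{h \<in> H. f h \<in> X} = {h \<in> H - {a, b}. f h \<in> X} \<union> ((if f a \<in> X then {a} else {}) \<union> (if f b \<in> X then {b} else {}))"
        using a b by auto
      also have "card \<dots> = c' X + card ((if f a \<in> X then {a} else {}) \<union> (if f b \<in> X then {b} else {}))"
        unfolding c'_def using fin by (intro card_Un_disjoint) auto
      finally show ?thesis using b(2) unfolding c_def by auto
    qed
    have "\<exists>\<tau>\<in>pairings (H - {a, b}). \<forall>X. X \<subseteq> W \<and> X \<noteq> {} \<and> X \<noteq> W \<longrightarrow>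
      2 * k \<le> d X + s X + card {p \<in> \<tau>. (\<exists>h\<in>p. f h \<in> X) \<and> (\<exists>h\<in>p. f h \<notin> X)}"
    proof (rule less.hyps)
      show "card (H - {a, b}) < card H" using a fin by (intro psubset_card_mono) auto
      show "f ` (H - {a, b}) \<subseteq> W" using img by auto
      show "d (W - X) + s (W - X) = d X + s X" if "X \<subseteq> W" for X
      proof -
        have "f a \<in> W" "f b \<in> W" using img a b by auto
        then show ?thesis using sym[OF that] by (auto simp: s_def)
      qed
      show "d (X \<inter> Y) + s (X \<inter> Y) + (d (X \<union> Y) + s (X \<union> Y)) \<le> d X + s X + (d Y + s Y)"
        if "X \<subseteq> W" "Y \<subseteq> W" for X Y
      proof -
        have "s (X \<inter> Y) + s (X \<union> Y) \<le> s X + s Y" by (auto simp: s_def)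
        then show ?thesis using sub[OF that] by simp
      qed
      have s: "d X + s X + c' X = (if f a \<in> X \<and> f b \<in> X then d X + c X - 2 else d X + c X)" for X
        using c_eq[of X] by (auto simp: s_def)
      show "even (d X + s X + card {h \<in> H - {a, b}. f h \<in> X})" if "X \<subseteq> W" for X
        using s[of X] par[OF that] by (auto simp: c'_def c_def)
      show "2 * k \<le> d X + s X + card {h \<in> H - {a, b}. f h \<in> X}" if X: "X \<subseteq> W" "X \<noteq> {}" "X \<noteq> W" for X
      proof (cases "f a \<in> X \<and> f b \<in> X")
        case True
        \<comment> \<open>Cuts drop only for sets containing both ends, and there by two. Such a set
          is not tight, so by parity its cut was at least \<open>2k + 2\<close>.\<close>
        then have "X \<notin> T" using b(3) by auto
        then have "d X + c X \<noteq> 2 * k" using True X by (auto simp: T_def)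
        moreover have "even (d X + c X)" "2 * k \<le> d X + c X" using par conn X by (auto simp: c_def)
        ultimately have "2 * k + 2 \<le> d X + c X" by presburger
        then show ?thesis using s[of X] True by (simp add: c'_def)
      next
        case False
        then show ?thesis using s[of X] conn[OF X] by (auto simp: c'_def c_def)
      qed
    qed (use fin finW in auto)
    then obtain \<tau> where \<tau>: "\<tau> \<in> pairings (H - {a, b})"
      and ge: "\<And>X. X \<subseteq> W \<Longrightarrow> X \<noteq> {} \<Longrightarrow> X \<noteq> W \<Longrightarrow>
        2 * k \<le> d X + s X + card {p \<in> \<tau>. (\<exists>h\<in>p. f h \<in> X) \<and> (\<exists>h\<in>p. f h \<notin> X)}" by blast
    have fin\<tau>: "finite \<tau>" using finite_pairing[OF \<tau>] fin by auto
    have new: "{a, b} \<notin> \<tau>" using pairings_Union[OF \<tau>] by auto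
    have "insert a (insert b (H - {a, b})) = H" using a b by auto
    then have "insert {a, b} \<tau> \<in> pairings H"
      using pairings_insert_pair[OF \<tau>, of a b] a b by auto
    moreover have "card {p \<in> insert {a, b} \<tau>. (\<exists>h\<in>p. f h \<in> X) \<and> (\<exists>h\<in>p. f h \<notin> X)}
      = s X + card {p \<in> \<tau>. (\<exists>h\<in>p. f h \<in> X) \<and> (\<exists>h\<in>p. f h \<notin> X)}" for X
    proof -
      have "{p \<in> insert {a, b} \<tau>. (\<exists>h\<in>p. f h \<in> X) \<and> (\<exists>h\<in>p. f h \<notin> X)} =
        (if (f a \<in> X) = (f b \<in> X) then {} else {{a, b}}) \<union> {p \<in> \<tau>. (\<exists>h\<in>p. f h \<in> X) \<and> (\<exists>h\<in>p. f h \<notin> X)}"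
        by auto
      then show ?thesis using fin\<tau> new by (simp add: s_def)
    qed
    ultimately show ?thesis using ge by (intro bexI[of _ "insert {a, b} \<tau>"]) (auto simp: add.assoc)
  qed
qed

subsection \<open>Circuits of two pairings\<close>

text \<open>\<open>f\<close> induces a bijection of classes: \<open>fwd\<close> carries paths along
  \<open>f\<close>, while \<open>lift\<close> and \<open>fibre\<close> carry them back, adjusting
  within fibres. Members of the quotients are forward images; by reflexivity, equal forward images
  give reachability in both directions.\<close>

lemma card_quotient_eq:
  assumes surj: "f ` A = B"
    and fwd: "\<And>x y. (x, y) \<in> R \<Longrightarrow> (f x, f y) \<in> S\<^sup>*"
    and fibre: "\<And>x y. x \<in> A \<Longrightarrow> y \<in> A \<Longrightarrow> f x = f y \<Longrightarrow> (x, y) \<in> R\<^sup>*"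
    and lift: "\<And>b c. (b, c) \<in> S \<Longrightarrow> \<exists>x\<in>A. \<exists>y\<in>A. f x = b \<and> f y = c \<and> (x, y) \<in> R\<^sup>*"
  shows "card (A // R\<^sup>*) = card (B // S\<^sup>*)"
proof -
  have fwds: "(f x, f y) \<in> S\<^sup>*" if "(x, y) \<in> R\<^sup>*" for x y
    using that by induction (auto intro: rtrancl_trans fwd)
  have bwd: "\<forall>y\<in>A. f y = c \<longrightarrow> (x, y) \<in> R\<^sup>*" if "(f x, c) \<in> S\<^sup>*" "x \<in> A" for x c
    using that(1)
  proof (induction rule: rtrancl_induct)
    case base
    then show ?case using fibre[OF that(2)] by simp
  next
    case (step c d)
    from lift[OF step.hyps(2)] obtain x' y'
      where *: "x' \<in> A" "y' \<in> A" "f x' = c" "f y' = d" "(x', y') \<in> R\<^sup>*" by auto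
    have "(x, y') \<in> R\<^sup>*" using step.IH * rtrancl_trans[of x x' R y'] by auto
    then show ?case using fibre[OF *(2)] *(4) rtrancl_trans[of x y' R] by auto
  qed
  let ?g = "\<lambda>C. S\<^sup>* `` (f ` C)"
  have g: "?g (R\<^sup>* `` {x}) = S\<^sup>* `` {f x}" for x
    using fwds by (auto intro: rtrancl_trans)
  have "inj_on ?g (A // R\<^sup>*)"
  proof (rule inj_onI)
    fix C D assume "C \<in> A // R\<^sup>*" "D \<in> A // R\<^sup>*" "?g C = ?g D"
    then obtain x y where xy: "x \<in> A" "y \<in> A" "C = R\<^sup>* `` {x}" "D = R\<^sup>* `` {y}"
      and "S\<^sup>* `` {f x} = S\<^sup>* `` {f y}" by (auto simp: g elim!: quotientE)
    then have "(f x, f y) \<in> S\<^sup>*" "(f y, f x) \<in> S\<^sup>*" by auto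
    then have "(x, y) \<in> R\<^sup>*" "(y, x) \<in> R\<^sup>*" using bwd xy by auto
    then show "C = D" using xy by (auto intro: rtrancl_trans)
  qed
  moreover have "?g ` (A // R\<^sup>*) = B // S\<^sup>*"
    using surj by (auto simp: quotient_def g image_iff)
  ultimately show ?thesis using card_image by fastforce
qed

text \<open>\<open>consecutive\<close> with the vertex pairings merged into one pairing
  \<open>F\<close> of all half-edges. Circuits then become the alternating cycles of two pairings,
  without reference to vertices.\<close>

definition consec :: "'h set set \<Rightarrow> 'h set set \<Rightarrow> ('h set \<times> 'h set) set" where
  "consec E F = {(e, f). e \<in> E \<and> f \<in> E \<and> (\<exists>h\<in>e. \<exists>h'\<in>f. {h, h'} \<in> F)}"

definition circuits :: "'h set set \<Rightarrow> 'h set set \<Rightarrow> nat" where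
  "circuits E F = card (E // (consec E F)\<^sup>*)"

lemma consecI:
  "e \<in> E \<Longrightarrow> f \<in> E \<Longrightarrow> h \<in> e \<Longrightarrow> h' \<in> f \<Longrightarrow> {h, h'} \<in> F \<Longrightarrow> (e, f) \<in> consec E F"
  unfolding consec_def by blast

lemma consecE:
  assumes "(e, f) \<in> consec E F"
  obtains h h' where "e \<in> E" "f \<in> E" "h \<in> e" "h' \<in> f" "{h, h'} \<in> F"
  using assms unfolding consec_def by blast

lemma consec_step:
  "e \<in> E \<Longrightarrow> f \<in> E \<Longrightarrow> h \<in> e \<Longrightarrow> h' \<in> f \<Longrightarrow> {h, h'} \<in> F \<Longrightarrow> (e, f) \<in> (consec E F)\<^sup>*"
  by (rule r_into_rtrancl) (rule consecI)

lemma circuits_image: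
  assumes E: "E \<in> pairings H" and F: "F \<in> pairings H" and inj: "inj_on \<phi> H"
  shows "circuits ((`) \<phi> ` E) ((`) \<phi> ` F) = circuits E F"
proof -
  have sub: "e \<subseteq> H" if "e \<in> E" for e using that pairings_Union[OF E] by auto
  have subF: "p \<subseteq> H" if "p \<in> F" for p using that pairings_Union[OF F] by auto
  have "card (E // (consec E F)\<^sup>*) = card ((`) \<phi> ` E // (consec ((`) \<phi> ` E) ((`) \<phi> ` F))\<^sup>*)"
  proof (rule card_quotient_eq[where f = "(`) \<phi>"])
    fix e f assume "(e, f) \<in> consec E F"
    then obtain h h' where "e \<in> E" "f \<in> E" "h \<in> e" "h' \<in> f" "{h, h'} \<in> F" by (rule consecE)
    moreover from this(5) have "{\<phi> h, \<phi> h'} \<in> (`) \<phi> ` F" by (intro image_eqI[of _ _ "{h, h'}"]) auto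
    ultimately show "(\<phi> ` e, \<phi> ` f) \<in> (consec ((`) \<phi> ` E) ((`) \<phi> ` F))\<^sup>*"
      by (intro consec_step[where h = "\<phi> h" and h' = "\<phi> h'"]) auto
  next
    fix e f assume "e \<in> E" "f \<in> E" "\<phi> ` e = \<phi> ` f"
    then have "e = f" using inj_on_image_eq_iff[OF inj] sub by auto
    then show "(e, f) \<in> (consec E F)\<^sup>*" by simp
  next
    fix c d assume "(c, d) \<in> consec ((`) \<phi> ` E) ((`) \<phi> ` F)"
    then obtain g g' where cd: "c \<in> (`) \<phi> ` E" "d \<in> (`) \<phi> ` E" "g \<in> c" "g' \<in> d" "{g, g'} \<in> (`) \<phi> ` F"
      by (rule consecE)
    then obtain e f h h' p where *: "e \<in> E" "f \<in> E" "c = \<phi> ` e" "d = \<phi> ` f" "h \<in> e" "h' \<in> f"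
      "g = \<phi> h" "g' = \<phi> h'" "p \<in> F" "{\<phi> h, \<phi> h'} = \<phi> ` p" by auto
    then have "\<phi> ` {h, h'} = \<phi> ` p" by auto
    moreover have "{h, h'} \<subseteq> H" "p \<subseteq> H" using sub subF * by auto
    ultimately have "{h, h'} = p" using inj_on_image_eq_iff[OF inj] by blast
    then have "(e, f) \<in> (consec E F)\<^sup>*" using * by (intro consec_step[where h = h and h' = h']) auto
    then show "\<exists>e\<in>E. \<exists>f\<in>E. \<phi> ` e = c \<and> \<phi> ` f = d \<and> (e, f) \<in> (consec E F)\<^sup>*" using * by blast
  qed simp
  then show ?thesis by (simp add: circuits_def)
qed

text \<open>\<open>F\<close> does not touch \<open>a\<close> or \<open>a'\<close>, so the edge
  paired with itself is a circuit of its own.\<close>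

lemma circuits_insert_closed:
  assumes E: "E \<in> pairings H" and e: "{a, a'} \<in> E" and fin: "finite E"
    and F: "F \<in> pairings (H - {a, a'})"
  shows "circuits E (insert {a, a'} F) = Suc (circuits (E - {{a, a'}}) F)"
proof -
  let ?e = "{a, a'}" and ?E = "E - {{a, a'}}"
  let ?R = "consec E (insert {a, a'} F)" and ?S = "consec (E - {{a, a'}}) F"
  have FU: "\<Union>F = H - {a, a'}" by (rule pairings_Union[OF F])
  have R: "?R = insert (?e, ?e) ?S"
  proof (intro equalityI subsetI)
    fix x assume "x \<in> ?R"
    then obtain c d where x: "x = (c, d)" and "(c, d) \<in> ?R" by (cases x) auto
    then obtain h h' where *: "c \<in> E" "d \<in> E" "h \<in> c" "h' \<in> d" "{h, h'} \<in> insert ?e F" using consecE by metis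
    show "x \<in> insert (?e, ?e) ?S"
    proof (cases "{h, h'} = ?e")
      case True
      then have "h \<in> ?e" "h' \<in> ?e" by blast+
      then have "c = ?e" "d = ?e"
        using pairings_eq[OF E *(1) e *(3)] pairings_eq[OF E *(2) e *(4)] by simp_all
      then show ?thesis using x by simp
    next
      case False
      then have "{h, h'} \<in> F" using * by simp
      moreover from this have "h \<notin> ?e" "h' \<notin> ?e" using FU by auto
      ultimately show ?thesis using * x by (auto intro!: consecI[where h = h and h' = h'])
    qed
  next
    fix x assume "x \<in> insert (?e, ?e) ?S"
    then show "x \<in> ?R" using e unfolding consec_def by blast
  qed
  have Id: "insert (?e, ?e) ?S \<subseteq> ?S\<^sup>*" by auto
  \<comment> \<open>The relations differ only by the reflexive pair of \<open>?e\<close>, so the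
    closures agree and the counts can differ only by the class of \<open>?e\<close>.\<close>
  have RS: "?R\<^sup>* = ?S\<^sup>*"
    unfolding R using Id by (metis insert_subset rtrancl_subset subset_insertI)
  have cls: "?S\<^sup>* `` {?e} = {?e}"
  proof -
    have "d = ?e" if "(?e, d) \<in> ?S\<^sup>*" for d
      using that by (induction rule: rtrancl_induct) (auto elim: consecE)
    then show ?thesis by auto
  qed
  have closed_pred: "c = ?e" if "(c, ?e) \<in> ?S\<^sup>*" for c
    using that by (induction rule: converse_rtrancl_induct) (auto elim: consecE)
  have "{?e} \<notin> ?E // ?S\<^sup>*" using closed_pred by (auto simp: quotient_def)
  moreover have "E // ?S\<^sup>* = insert {?e} (?E // ?S\<^sup>*)"
    using e cls by (auto simp: quotient_def)
  moreover have "finite (?E // ?S\<^sup>*)" using fin by (simp add: quotient_def)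
  ultimately show ?thesis by (simp add: circuits_def RS)
qed

text \<open>The edge \<open>{a, a'}\<close> is spliced into a circuit between \<open>b\<close> and
  \<open>b'\<close>, which lengthens that circuit but neither splits nor joins any.\<close>

lemma circuits_bypass:
  assumes E: "E \<in> pairings H" and e: "{a, a'} \<in> E"
    and F: "F \<in> pairings (H - {a, a'})" and b: "{b, b'} \<in> F"
  shows "circuits E (insert {a, b} (insert {a', b'} (F - {{b, b'}}))) = circuits (E - {{a, a'}}) F"
proof -
  let ?e = "{a, a'}" and ?E = "E - {{a, a'}}" and ?F = "insert {a, b} (insert {a', b'} (F - {{b, b'}}))"
  let ?R = "consec E ?F" and ?S = "consec (E - {{a, a'}}) F"
  have FU: "\<Union>F = H - {a, a'}" by (rule pairings_Union[OF F])
  have bH: "b \<in> H" "b' \<in> H" "b \<notin> ?e" "b' \<notin> ?e" using FU b by auto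
  define eb eb' where "eb = {b, partner E b}" and "eb' = {b', partner E b'}"
  have eb: "eb \<in> E" "b \<in> eb" "eb' \<in> E" "b' \<in> eb'" "eb \<noteq> ?e" "eb' \<noteq> ?e"
    using partner_in[OF E] bH by (auto simp: eb_def eb'_def)
  \<comment> \<open>\<open>f\<close> merges the spliced edge into the edge at \<open>b\<close>, its
    neighbour on the circuit.\<close>
  define f where "f c = (if c = ?e then eb else c)" for c
  have Ra: "(?e, eb) \<in> ?R\<^sup>*" "(eb, ?e) \<in> ?R\<^sup>*" "(?e, eb') \<in> ?R\<^sup>*" "(eb', ?e) \<in> ?R\<^sup>*"
    using eb e by (auto intro: consec_step[where h = a and h' = b] consec_step[where h = b and h' = a]
      consec_step[where h = a' and h' = b'] consec_step[where h = b' and h' = a'] simp: insert_commute)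
  have Sb: "(eb, eb') \<in> ?S\<^sup>*" "(eb', eb) \<in> ?S\<^sup>*"
    using eb b by (auto intro: consec_step[where h = b and h' = b'] consec_step[where h = b' and h' = b] simp: insert_commute)
  have mem: "c = ?e" if "c \<in> E" "h \<in> c" "h = a \<or> h = a'" for c h
    using pairings_eq[OF E that(1) e that(2)] that(3) by auto
  have memb: "c = eb" if "c \<in> E" "b \<in> c" for c using pairings_eq[OF E that(1) eb(1) that(2) eb(2)] .
  have memb': "c = eb'" if "c \<in> E" "b' \<in> c" for c using pairings_eq[OF E that(1) eb(3) that(2) eb(4)] .
  have "card (E // ?R\<^sup>*) = card (?E // ?S\<^sup>*)"
  proof (rule card_quotient_eq[where f = f])
    show "f ` E = ?E" using e eb by (auto simp: f_def image_iff)
  next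
    fix c d assume "(c, d) \<in> ?R"
    then obtain h h' where *: "c \<in> E" "d \<in> E" "h \<in> c" "h' \<in> d" "{h, h'} \<in> ?F" by (rule consecE)
    consider "{h, h'} = {a, b}" | "{h, h'} = {a', b'}" | "{h, h'} \<in> F" using *(5) by auto
    then show "(f c, f d) \<in> ?S\<^sup>*"
    proof cases
      case 1
      then have "h = a \<and> h' = b \<or> h = b \<and> h' = a" by (auto simp: doubleton_eq_iff)
      then have "f c = eb" "f d = eb"
        using mem[OF *(1,3)] mem[OF *(2,4)] memb[OF *(1)] memb[OF *(2)] *(3,4) by (auto simp: f_def)
      then show ?thesis by simp
    next
      case 2
      then have "h = a' \<and> h' = b' \<or> h = b' \<and> h' = a'" by (auto simp: doubleton_eq_iff)
      then have "f c \<in> {eb, eb'}" "f d \<in> {eb, eb'}"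
        using mem[OF *(1,3)] mem[OF *(2,4)] memb'[OF *(1)] memb'[OF *(2)] *(3,4) by (auto simp: f_def)
      then show ?thesis using Sb by auto
    next
      case 3
      then have "h \<notin> ?e" "h' \<notin> ?e" using FU by auto
      then have "c \<noteq> ?e" "d \<noteq> ?e" using * by auto
      then show ?thesis using * 3 by (auto simp: f_def intro: consec_step[where h = h and h' = h'])
    qed
  next
    fix c d assume "c \<in> E" "d \<in> E" "f c = f d"
    then show "(c, d) \<in> ?R\<^sup>*" using Ra by (auto simp: f_def split: if_splits)
  next
    fix c d assume "(c, d) \<in> ?S"
    then obtain h h' where *: "c \<in> ?E" "d \<in> ?E" "h \<in> c" "h' \<in> d" "{h, h'} \<in> F" by (rule consecE)
    have "(c, d) \<in> ?R\<^sup>*"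
    proof (cases "{h, h'} = {b, b'}")
      case True
      then have "h = b \<and> h' = b' \<or> h = b' \<and> h' = b" by (auto simp: doubleton_eq_iff)
      then show ?thesis
      proof (elim disjE conjE)
        assume h: "h = b" "h' = b'"
        have "c = eb" by (rule memb) (use *(1,3) h in simp_all)
        moreover have "d = eb'" by (rule memb') (use *(2,4) h in simp_all)
        ultimately show ?thesis using rtrancl_trans[OF Ra(2) Ra(3)] by simp
      next
        assume h: "h = b'" "h' = b"
        have "c = eb'" by (rule memb') (use *(1,3) h in simp_all)
        moreover have "d = eb" by (rule memb) (use *(2,4) h in simp_all)
        ultimately show ?thesis using rtrancl_trans[OF Ra(4) Ra(1)] by simp
      qed
    next
      case False
      then have "{h, h'} \<in> ?F" using *(5) by blast
      then show ?thesis using *(1-4) by (intro consec_step[of c E d h h']) blast+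
    qed
    then show "\<exists>x\<in>E. \<exists>y\<in>E. f x = c \<and> f y = d \<and> (x, y) \<in> ?R\<^sup>*"
      using * by (intro bexI[of _ c] bexI[of _ d]) (auto simp: f_def)
  qed
  then show ?thesis by (simp add: circuits_def)
qed

subsection \<open>Resolving a vertex\<close>

text \<open>The part of \<open>multigraph\<close> that concerns half-edges only. Removing a loop
  destroys regularity, and the circuit sum sees vertices only through \<open>att\<close>, so its
  lemmas are stated at this level.\<close>

definition pregraph :: "('v, 'h) mgraph \<Rightarrow> bool" where
  "pregraph G \<longleftrightarrow> finite (edges G) \<and> edges G \<in> pairings (halves G)"

lemma finite_halves: "pregraph G \<Longrightarrow> finite (halves G)"
proof -
  assume G: "pregraph G"
  have "finite e" if "e \<in> edges G" for e
    using pairings_card2[OF _ that] G by (metis pregraph_def card.infinite zero_neq_numeral)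
  then show ?thesis using G by (auto simp: pregraph_def halves_def)
qed

lemma finite_halves_at: "pregraph G \<Longrightarrow> finite (halves_at G v)"
  by (simp add: finite_halves halves_at_def)

lemma halves_at_subset: "halves_at G v \<subseteq> halves G"
  by (auto simp: halves_at_def)

lemma mate_eq_partner: "mate G = partner (edges G)"
  by (auto simp: mate_def partner_def)

lemma
  assumes "pregraph G" "h \<in> halves G"
  shows mate_edge: "{h, mate G h} \<in> edges G"
    and mate_halves: "mate G h \<in> halves G"
    and mate_neq: "mate G h \<noteq> h"
    and mate_mate: "mate G (mate G h) = h"
    and edge_mate: "e \<in> edges G \<Longrightarrow> h \<in> e \<Longrightarrow> e = {h, mate G h}"
  unfolding mate_eq_partner
  using assms partner_in partner_mem partner_neq partner_partner pairings_member
  unfolding pregraph_def by metis+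

lemma edgeE:
  assumes "pregraph G" "e \<in> edges G"
  obtains h where "h \<in> halves G" "e = {h, mate G h}"
  unfolding mate_eq_partner using assms pairings_memberE unfolding pregraph_def by metis

lemma inj_on_mate: "pregraph G \<Longrightarrow> inj_on (mate G) (halves G)"
  by (rule inj_onI) (metis mate_mate)

text \<open>Local version of \<open>has_loop\<close>: a vertex without loops can be expanded even if
  other vertices carry loops, which resolutions do create.\<close>

definition loopless_at :: "('v, 'h) mgraph \<Rightarrow> 'v \<Rightarrow> bool" where
  "loopless_at G v \<longleftrightarrow> (\<forall>h\<in>halves_at G v. att G (mate G h) \<noteq> v)"

text \<open>Maps the edges of \<open>G\<close> onto those of its resolution: a half-edge at \<open>v\<close> is replaced by the far
  end of the edge with which its own edge is merged.\<close>

definition reroute :: "('v, 'h) mgraph \<Rightarrow> 'v \<Rightarrow> 'h set set \<Rightarrow> 'h \<Rightarrow> 'h" where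
  "reroute G v \<tau> h = (if att G h = v then mate G (partner \<tau> h) else h)"

lemma resolve_simps [simp]:
  "verts (resolve G v \<tau>) = verts G - {v}"
  "att (resolve G v \<tau>) = att G"
  by (simp_all add: resolve_def)

locale resolution =
  fixes G :: "('v, 'h) mgraph" and v \<tau>
  assumes G: "pregraph G" and v: "loopless_at G v" and \<tau>: "\<tau> \<in> pairings (halves_at G v)"
begin

lemma edges_halves: "edges G \<in> pairings (halves G)" using G by (simp add: pregraph_def)

lemma mate_not_at: "h \<in> halves_at G v \<Longrightarrow> att G (mate G h) \<noteq> v"
  using v by (simp add: loopless_at_def)

lemma mate_in: "h \<in> halves_at G v \<Longrightarrow> mate G h \<in> halves G - halves_at G v"
  using mate_not_at mate_halves[OF G] halves_at_subset[of G v] by (auto simp: halves_at_def)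

lemma partner_at:
  assumes "h \<in> halves_at G v"
  shows "partner \<tau> h \<in> halves_at G v" "partner \<tau> (partner \<tau> h) = h" "partner \<tau> h \<noteq> h" "{h, partner \<tau> h} \<in> \<tau>"
  using partner_mem[OF \<tau> assms] partner_partner[OF \<tau> assms] partner_neq[OF \<tau> assms] partner_in[OF \<tau> assms] by auto

lemma reroute_edge:
  assumes "h \<in> halves_at G v"
  shows "reroute G v \<tau> ` {h, mate G h} = mate G ` {h, partner \<tau> h}"
  using assms mate_not_at[OF assms] by (auto simp: reroute_def halves_at_def)

lemma reroute_untouched: "(\<And>h. h \<in> e \<Longrightarrow> att G h \<noteq> v) \<Longrightarrow> reroute G v \<tau> ` e = e"
  by (simp add: reroute_def)

lemma edge_cases:
  assumes "e \<in> edges G"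
  obtains (untouched) "\<forall>h\<in>e. att G h \<noteq> v" | (touched) h where "h \<in> halves_at G v" "e = {h, mate G h}"
proof (cases "\<forall>h\<in>e. att G h \<noteq> v")
  case False
  then obtain h where h: "h \<in> e" "att G h = v" by auto
  moreover from this assms have "h \<in> halves G" by (auto simp: halves_def)
  ultimately show ?thesis using touched[of h] edge_mate[OF G _ assms h(1)] by (simp add: halves_at_def)
qed

lemma edges_resolve: "edges (resolve G v \<tau>) = (`) (reroute G v \<tau>) ` edges G"
proof (intro equalityI subsetI)
  fix e assume "e \<in> edges (resolve G v \<tau>)"
  then consider "e \<in> edges G" "\<forall>h\<in>e. att G h \<noteq> v" | p where "p \<in> \<tau>" "e = mate G ` p"
    by (auto simp: resolve_def)
  then show "e \<in> (`) (reroute G v \<tau>) ` edges G"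
  proof cases
    case 1
    then show ?thesis using reroute_untouched[of e] by (metis imageI)
  next
    case 2
    obtain h where h: "h \<in> halves_at G v" "p = {h, partner \<tau> h}" using pairings_memberE[OF \<tau> 2(1)] .
    then have "e = reroute G v \<tau> ` {h, mate G h}" using 2 reroute_edge by simp
    moreover have "{h, mate G h} \<in> edges G" using mate_edge[OF G] h halves_at_subset by fast
    ultimately show ?thesis by blast
  qed
next
  fix e assume "e \<in> (`) (reroute G v \<tau>) ` edges G"
  then obtain e' where e': "e' \<in> edges G" "e = reroute G v \<tau> ` e'" by auto
  from e'(1) show "e \<in> edges (resolve G v \<tau>)"
  proof (cases rule: edge_cases)
    case untouched
    then show ?thesis using e' reroute_untouched[of e'] by (simp add: resolve_def)
  next
    case (touched h)
    then have "e = mate G ` {h, partner \<tau> h}" using e'(2) reroute_edge[OF touched(1)] by (simp only:)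
    then show ?thesis using partner_at(4)[OF touched(1)] by (auto simp only: resolve_def mgraph.simps)
  qed
qed

text \<open>Removing the edges at \<open>v\<close> frees their far ends, and transporting \<tau> by
  \<open>mate\<close> pairs exactly these again. Without loops at \<open>v\<close> they are disjoint
  from the half-edges at \<open>v\<close>.\<close>

lemma resolve_pairings: "edges (resolve G v \<tau>) \<in> pairings (halves G - halves_at G v)"
proof -
  let ?U = "{e \<in> edges G. \<forall>h\<in>e. att G h \<noteq> v}" and ?H = "halves_at G v"
  have touched: "\<Union>(edges G - ?U) = ?H \<union> mate G ` ?H"
  proof (intro equalityI subsetI)
    fix g assume "g \<in> \<Union>(edges G - ?U)"
    then obtain e where e: "e \<in> edges G" "g \<in> e" "\<not> (\<forall>h\<in>e. att G h \<noteq> v)" by auto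
    from e(1) show "g \<in> ?H \<union> mate G ` ?H" by (cases rule: edge_cases) (use e in auto)
  next
    fix g assume "g \<in> ?H \<union> mate G ` ?H"
    then obtain h where h: "h \<in> ?H" "g \<in> {h, mate G h}" by auto
    then have "{h, mate G h} \<in> edges G" using mate_edge[OF G] halves_at_subset by fast
    then show "g \<in> \<Union>(edges G - ?U)" using h by (auto simp: halves_at_def)
  qed
  have "edges G - (edges G - ?U) \<in> pairings (halves G - (?H \<union> mate G ` ?H))"
    using pairings_Diff[OF edges_halves, of "edges G - ?U"] touched by auto
  moreover have "edges G - (edges G - ?U) = ?U" by auto
  moreover have "(`) (mate G) ` \<tau> \<in> pairings (mate G ` ?H)"
    by (rule pairings_image[OF \<tau> inj_on_subset[OF inj_on_mate[OF G] halves_at_subset]])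
  ultimately have "?U \<union> (`) (mate G) ` \<tau> \<in> pairings ((halves G - (?H \<union> mate G ` ?H)) \<union> mate G ` ?H)"
    using pairings_union[of ?U _ "(`) (mate G) ` \<tau>" "mate G ` ?H"] by auto
  moreover have "(halves G - (?H \<union> mate G ` ?H)) \<union> mate G ` ?H = halves G - ?H"
    using mate_in by auto
  ultimately show ?thesis by (simp add: resolve_def)
qed

lemma halves_resolve: "halves (resolve G v \<tau>) = halves G - halves_at G v"
  using pairings_Union[OF resolve_pairings] by (simp add: halves_def)

lemma pregraph_resolve: "pregraph (resolve G v \<tau>)"
  using resolve_pairings edges_resolve G by (simp add: pregraph_def halves_resolve)

lemma halves_at_resolve: "u \<noteq> v \<Longrightarrow> halves_at (resolve G v \<tau>) u = halves_at G u"
  by (auto simp: halves_at_def halves_resolve)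

text \<open>Each pair of \<tau> makes the two edges that it merges consecutive, so replacing them by
  one edge preserves circuits. Distinct edges with a common image under \<open>reroute\<close> are
  exactly such pairs.\<close>

lemma circuits_resolve:
  assumes F: "F \<in> pairings (halves G - halves_at G v)"
  shows "circuits (edges G) (\<tau> \<union> F) = circuits (edges (resolve G v \<tau>)) F"
proof -
  let ?r = "reroute G v \<tau>" and ?E = "edges G" and ?E' = "edges (resolve G v \<tau>)"
  let ?R = "consec ?E (\<tau> \<union> F)" and ?S = "consec ?E' F"
  have in_image: "g \<in> ?r ` e" if "g \<in> e" "att G g \<noteq> v" for e g
    using that by (metis imageI reroute_def)
  have F_at: "att G h \<noteq> v" "h \<in> halves G" if "{h, h'} \<in> F" for h h'
    using pairings_Union[OF F] that by (auto simp: halves_at_def)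
  have E_halves: "h \<in> halves G" if "e \<in> ?E" "h \<in> e" for h e
    using that by (auto simp: halves_def)
  have "card (?E // ?R\<^sup>*) = card (?E' // ?S\<^sup>*)"
  proof (rule card_quotient_eq[where f = "(`) ?r"])
    show "(`) ?r ` ?E = ?E'" by (simp add: edges_resolve)
  next
    fix e f assume "(e, f) \<in> ?R"
    then obtain a b where *: "e \<in> ?E" "f \<in> ?E" "a \<in> e" "b \<in> f" "{a, b} \<in> \<tau> \<union> F" by (rule consecE)
    show "(?r ` e, ?r ` f) \<in> ?S\<^sup>*"
    proof (cases "{a, b} \<in> \<tau>")
      case True
      then have a: "a \<in> halves_at G v" and b: "b \<in> halves_at G v" "b = partner \<tau> a" "a = partner \<tau> b"
      proof -
        have "{b, a} \<in> \<tau>" using True by (simp add: insert_commute)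
        then show "b = partner \<tau> a" "a = partner \<tau> b"
          using partner_eqI[OF \<tau> True] partner_eqI[OF \<tau>, of b a] by simp_all
        show "a \<in> halves_at G v" "b \<in> halves_at G v"
          using True pairings_Union[OF \<tau>] by auto
      qed
      have "e = {a, mate G a}" "f = {b, mate G b}"
        using edge_mate[OF G E_halves[OF *(1,3)] *(1,3)] edge_mate[OF G E_halves[OF *(2,4)] *(2,4)] .
      then have "?r ` e = ?r ` f"
        using reroute_edge[OF a, folded b(2)] reroute_edge[OF b(1), folded b(3)] by (simp only: insert_commute)
      then show ?thesis by simp
    next
      case False
      then have F: "{a, b} \<in> F" "{b, a} \<in> F" using *(5) by (auto simp: insert_commute)
      show ?thesis
        by (rule consec_step[where h = a and h' = b])
          (use * F F_at(1)[OF F(1)] F_at(1)[OF F(2)] in \<open>auto simp: edges_resolve intro: in_image\<close>)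
    qed
  next
    \<comment> \<open>Injectivity of \<open>mate\<close> recovers the pair of \<tau> from the merged
      edge, so two touched edges with the same image are equal or linked by \<tau>.\<close>
    have fib: "(e, f) \<in> ?R\<^sup>*" if h: "h \<in> halves_at G v" "e = {h, mate G h}"
      and g: "g \<in> halves_at G v" "f = {g, mate G g}" and eq: "?r ` e = ?r ` f" for e f h g
    proof -
      have E: "e \<in> ?E" "f \<in> ?E" using mate_edge[OF G] h g halves_at_subset[of G v] by auto
      have "mate G ` {h, partner \<tau> h} = mate G ` {g, partner \<tau> g}"
        using eq h g reroute_edge by simp
      then have "{h, partner \<tau> h} = {g, partner \<tau> g}"
        using inj_on_image_eq_iff[OF inj_on_mate[OF G], of "{h, partner \<tau> h}" "{g, partner \<tau> g}"]
          h(1) g(1) partner_at(1) halves_at_subset by (metis empty_subsetI insert_subset subsetD)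
      then consider "h = g" | "g = partner \<tau> h" by (auto simp: doubleton_eq_iff)
      then show ?thesis
      proof cases
        case 2
        show ?thesis
          by (rule consec_step[where h = h and h' = g]) (use E h g 2 partner_at(4) in auto)
      qed (use h g in simp)
    qed
    \<comment> \<open>A merged edge is never an old one: it contains \<open>mate G h\<close>, whose
      edge in \<open>G\<close> touches \<open>v\<close>.\<close>
    have nofib: False if h: "h \<in> halves_at G v" "e = {h, mate G h}" and e: "e \<in> ?E"
      and f: "f \<in> ?E" "\<forall>g\<in>f. att G g \<noteq> v" and eq: "?r ` e = ?r ` f" for e f h
    proof -
      have "?r ` f = f" using f(2) by (intro reroute_untouched) auto
      then have "mate G h \<in> f" using eq in_image[of "mate G h" e] mate_not_at[OF h(1)] h(2) by auto
      then have "e = f" using pairings_eq[OF edges_halves e f(1), of "mate G h"] h(2) by auto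
      then show False using f(2) h by (auto simp: halves_at_def)
    qed
    fix e f assume e: "e \<in> ?E" and f: "f \<in> ?E" and eq: "?r ` e = ?r ` f"
    from e show "(e, f) \<in> ?R\<^sup>*"
    proof (cases rule: edge_cases)
      case untouched
      note e' = this
      from f show ?thesis
      proof (cases rule: edge_cases)
        case untouched
        then have "e = f" using eq reroute_untouched[of e] reroute_untouched[of f] e' by auto
        then show ?thesis by simp
      next
        case (touched h)
        then show ?thesis using nofib[OF touched f e e'] eq by simp
      qed
    next
      case (touched h)
      note e' = this
      from f show ?thesis
      proof (cases rule: edge_cases)
        case untouched
        then show ?thesis using nofib[OF e' e f _ eq] by auto
      next
        case (touched g)
        then show ?thesis using fib[OF e' touched eq] by simp
      qed
    qed
  next
    fix c d assume "(c, d) \<in> ?S"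
    then obtain a b where *: "c \<in> ?E'" "d \<in> ?E'" "a \<in> c" "b \<in> d" "{a, b} \<in> F" by (rule consecE)
    then have ba: "{b, a} \<in> F" by (simp add: insert_commute)
    \<comment> \<open>A half-edge away from \<open>v\<close> lies in the image of its own edge;
      disjointness of the resolved edges makes this image the given \<open>c\<close>.\<close>
    have lift: "?r ` {x, mate G x} = c" if "c \<in> ?E'" "x \<in> c" "x \<in> halves G" "att G x \<noteq> v" for x c
    proof (rule pairings_eq[OF resolve_pairings _ that(1) _ that(2)])
      show "?r ` {x, mate G x} \<in> ?E'" unfolding edges_resolve by (rule imageI) (rule mate_edge[OF G that(3)])
      show "x \<in> ?r ` {x, mate G x}" using that(4) by (intro in_image) auto
    qed
    have "?r ` {a, mate G a} = c" by (rule lift) (use * F_at[OF *(5)] in auto)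
    moreover have "?r ` {b, mate G b} = d" by (rule lift) (use * F_at[OF ba] in auto)
    moreover have E: "{a, mate G a} \<in> ?E" "{b, mate G b} \<in> ?E"
      using mate_edge[OF G] F_at[OF *(5)] F_at[OF ba] by auto
    moreover have "({a, mate G a}, {b, mate G b}) \<in> ?R\<^sup>*"
      by (rule consec_step[where h = a and h' = b]) (use * E in auto)
    ultimately show "\<exists>e\<in>?E. \<exists>f\<in>?E. ?r ` e = c \<and> ?r ` f = d \<and> (e, f) \<in> ?R\<^sup>*" by blast
  qed
  then show ?thesis by (simp add: circuits_def)
qed

end

subsection \<open>The circuit sum\<close>

text \<open>A transition system as one pairing of all half-edges in which every pair stays at one
  vertex. The correspondence is \<open>sum_transition_systems\<close>.\<close>

definition fibre_pairings :: "('h \<Rightarrow> 'v) \<Rightarrow> 'h set \<Rightarrow> 'h set set set" where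
  "fibre_pairings a H = {F \<in> pairings H. \<forall>p\<in>F. \<exists>v. p \<subseteq> a -` {v}}"

lemma fibre_pairingsI:
  "F \<in> pairings H \<Longrightarrow> (\<And>p. p \<in> F \<Longrightarrow> \<exists>v. p \<subseteq> a -` {v}) \<Longrightarrow> F \<in> fibre_pairings a H"
  by (simp add: fibre_pairings_def)

lemma fibre_pairingsD:
  "F \<in> fibre_pairings a H \<Longrightarrow> p \<in> F \<Longrightarrow> \<exists>v. p \<subseteq> a -` {v}"
  by (simp add: fibre_pairings_def)

lemma fibre_pairings_pairings: "F \<in> fibre_pairings a H \<Longrightarrow> F \<in> pairings H"
  by (simp add: fibre_pairings_def)

lemma constant_fibre:
  assumes "\<And>h h'. h \<in> p \<Longrightarrow> h' \<in> p \<Longrightarrow> a h = a h'"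
  shows "\<exists>v. p \<subseteq> a -` {v}"
proof (cases "p = {}")
  case False
  then obtain h where "h \<in> p" by auto
  have "x \<in> a -` {a h}" if "x \<in> p" for x using assms[OF that \<open>h \<in> p\<close>] by simp
  then show ?thesis by blast
qed simp

lemma finite_fibre_pairings: "finite H \<Longrightarrow> finite (fibre_pairings a H)"
  by (rule finite_subset[OF _ finite_pairings]) (auto simp: fibre_pairings_def)

lemma fibre_pairings_att:
  assumes "F \<in> fibre_pairings a H" "h \<in> H"
  shows "a (partner F h) = a h"
  using fibre_pairingsD[OF assms(1) partner_in[OF fibre_pairings_pairings[OF assms(1)] assms(2)]]
  by auto

text \<open>The pairing at \<open>v\<close> and the pairings elsewhere are chosen independently;
  with \<open>circuits_resolve\<close> this becomes the expansion at \<open>v\<close>.\<close>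

lemma sum_fibre_pairings_split:
  fixes a :: "'h \<Rightarrow> 'v" and v
  assumes fin: "finite H"
  defines "V \<equiv> {h \<in> H. a h = v}"
  shows "(\<Sum>F\<in>fibre_pairings a H. g F) = (\<Sum>\<tau>\<in>pairings V. \<Sum>F\<in>fibre_pairings a (H - V). g (\<tau> \<union> F))"
proof -
  have "(\<Sum>\<tau>\<in>pairings V. \<Sum>F\<in>fibre_pairings a (H - V). g (\<tau> \<union> F)) =
      (\<Sum>(\<tau>, F)\<in>pairings V \<times> fibre_pairings a (H - V). g (\<tau> \<union> F))"
    by (rule sum.cartesian_product)
  also have "\<dots> = (\<Sum>F\<in>fibre_pairings a H. g F)"
  proof (rule sum.reindex_bij_witness[where i = "\<lambda>F. ({p \<in> F. p \<subseteq> V}, {p \<in> F. \<not> p \<subseteq> V})"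
        and j = "\<lambda>(\<tau>, F). \<tau> \<union> F"])
    fix x assume "x \<in> pairings V \<times> fibre_pairings a (H - V)"
    then obtain \<tau> F where x: "x = (\<tau>, F)" and \<tau>: "\<tau> \<in> pairings V" and F: "F \<in> fibre_pairings a (H - V)" by auto
    have tV: "p \<subseteq> V" if "p \<in> \<tau>" for p using that pairings_Union[OF \<tau>] by auto
    have FV: "\<not> p \<subseteq> V" if "p \<in> F" for p
    proof -
      have "p \<noteq> {}" using pairings_card2[OF fibre_pairings_pairings[OF F] that] by auto
      moreover have "p \<subseteq> H - V" using pairings_Union[OF fibre_pairings_pairings[OF F]] that by auto
      ultimately show ?thesis by auto
    qed
    have "\<tau> \<union> F \<in> pairings (V \<union> (H - V))"
      by (rule pairings_union[OF \<tau> fibre_pairings_pairings[OF F]]) auto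
    moreover have "V \<union> (H - V) = H" by (auto simp: V_def)
    moreover have "\<exists>v. p \<subseteq> a -` {v}" if "p \<in> \<tau> \<union> F" for p
    proof (cases "p \<in> F")
      case False
      then have "p \<subseteq> a -` {v}" using tV that by (auto simp: V_def)
      then show ?thesis ..
    qed (rule fibre_pairingsD[OF F])
    ultimately show "(case x of (\<tau>, F) \<Rightarrow> \<tau> \<union> F) \<in> fibre_pairings a H"
      unfolding x case_prod_conv by (intro fibre_pairingsI) simp_all
    have "{p \<in> \<tau> \<union> F. p \<subseteq> V} = \<tau>" "{p \<in> \<tau> \<union> F. \<not> p \<subseteq> V} = F" using tV FV by auto
    then show "({p \<in> case x of (\<tau>, F) \<Rightarrow> \<tau> \<union> F. p \<subseteq> V}, {p \<in> case x of (\<tau>, F) \<Rightarrow> \<tau> \<union> F. \<not> p \<subseteq> V}) = x"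
      by (simp add: x)
  next
    fix F assume F: "F \<in> fibre_pairings a H"
    have P: "F \<in> pairings H" by (rule fibre_pairings_pairings[OF F])
    have dich: "p \<subseteq> V \<or> p \<subseteq> H - V" if "p \<in> F" for p
    proof -
      have "p \<subseteq> H" using pairings_Union[OF P] that by auto
      moreover from fibre_pairingsD[OF F that] obtain u where "p \<subseteq> a -` {u}" by auto
      ultimately show ?thesis unfolding V_def by (cases "u = v") auto
    qed
    have ne: "p \<noteq> {}" if "p \<in> F" for p using pairings_card2[OF P that] by auto
    have UV: "\<Union>{p \<in> F. p \<subseteq> V} = V"
    proof -
      have "h \<in> \<Union>{p \<in> F. p \<subseteq> V}" if h: "h \<in> V" for h
      proof -
        have "h \<in> \<Union>F" using pairings_Union[OF P] h by (auto simp: V_def)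
        then show ?thesis using dich h by blast
      qed
      then show ?thesis by blast
    qed
    then have "{p \<in> F. p \<subseteq> V} \<in> pairings V"
      using pairings_subset[OF P, of "{p \<in> F. p \<subseteq> V}"] by auto
    moreover have "{p \<in> F. \<not> p \<subseteq> V} \<in> pairings (H - V)"
    proof -
      have "F - {p \<in> F. p \<subseteq> V} = {p \<in> F. \<not> p \<subseteq> V}" by auto
      then show ?thesis using pairings_Diff[OF P, of "{p \<in> F. p \<subseteq> V}"] UV by auto
    qed
    ultimately show "({p \<in> F. p \<subseteq> V}, {p \<in> F. \<not> p \<subseteq> V}) \<in> pairings V \<times> fibre_pairings a (H - V)"
      using F by (auto simp: fibre_pairings_def)
    show "(case ({p \<in> F. p \<subseteq> V}, {p \<in> F. \<not> p \<subseteq> V}) of (\<tau>, F) \<Rightarrow> \<tau> \<union> F) = F" by auto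
  qed (auto simp: V_def)
  finally show ?thesis by simp
qed

text \<open>Inserting a self-loop \<open>{a, a'}\<close> into the circuit through the pair of \<open>b\<close>, next to \<open>b\<close>: the choices
  of \<open>b\<close> account for the factor \<open>d - 2\<close>.\<close>

definition bypass :: "'h \<Rightarrow> 'h \<Rightarrow> 'h set set \<Rightarrow> 'h \<Rightarrow> 'h set set" where
  "bypass a a' F b = insert {a, b} (insert {a', partner F b} (F - {{b, partner F b}}))"

text \<open>Either the loop closes on itself, or \<open>a\<close> and \<open>a'\<close> have
  partners \<open>b\<close> and \<open>b'\<close> elsewhere at \<open>v\<close>. In the second case
  pairing \<open>b\<close> with \<open>b'\<close> gives a pairing on \<open>K\<close>, from which
  the original is recovered once the partner \<open>b\<close> of \<open>a\<close> is known.\<close>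

lemma sum_fibre_pairings_loop:
  fixes g :: "'h set set \<Rightarrow> 'b::comm_monoid_add" and f :: "'h \<Rightarrow> 'v" and a a' v
  assumes fin: "finite H" and aH: "a \<in> H" "a' \<in> H" "a \<noteq> a'" and att: "f a = v" "f a' = v"
  defines "K \<equiv> H - {a, a'}"
  shows "(\<Sum>F\<in>fibre_pairings f H. g F) = (\<Sum>F\<in>fibre_pairings f K. g (insert {a, a'} F)) +
    (\<Sum>F\<in>fibre_pairings f K. \<Sum>b\<in>{b \<in> K. f b = v}. g (bypass a a' F b))"
proof -
  let ?P = "fibre_pairings f H" and ?V = "{b \<in> K. f b = v}"
  have HK: "insert a (insert a' K) = H" using aH by (auto simp: K_def)
  have aK: "a \<notin> K" "a' \<notin> K" by (auto simp: K_def)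
  have "(\<Sum>F\<in>?P. g F) = (\<Sum>F\<in>{F \<in> ?P. {a, a'} \<in> F}. g F) + (\<Sum>F\<in>{F \<in> ?P. {a, a'} \<notin> F}. g F)"
  proof -
    have "?P = {F \<in> ?P. {a, a'} \<in> F} \<union> {F \<in> ?P. {a, a'} \<notin> F}" by auto
    also have "(\<Sum>F\<in>\<dots>. g F) = (\<Sum>F\<in>{F \<in> ?P. {a, a'} \<in> F}. g F) + (\<Sum>F\<in>{F \<in> ?P. {a, a'} \<notin> F}. g F)"
      using finite_fibre_pairings[OF fin, of f] by (intro sum.union_disjoint) auto
    finally show ?thesis .
  qed
  also have "(\<Sum>F\<in>{F \<in> ?P. {a, a'} \<in> F}. g F) = (\<Sum>F\<in>fibre_pairings f K. g (insert {a, a'} F))"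
  proof (rule sum.reindex_bij_witness[where i = "insert {a, a'}" and j = "\<lambda>F. F - {{a, a'}}"])
    fix F assume F: "F \<in> {F \<in> ?P. {a, a'} \<in> F}"
    then have "F - {{a, a'}} \<in> pairings K"
      unfolding K_def using fibre_pairings_pairings by (intro pairings_remove_pair) auto
    then show "F - {{a, a'}} \<in> fibre_pairings f K" using F by (auto simp: fibre_pairings_def)
    show "insert {a, a'} (F - {{a, a'}}) = F" "g (insert {a, a'} (F - {{a, a'}})) = g F"
      using F by (auto simp: insert_absorb)
  next
    fix F assume F: "F \<in> fibre_pairings f K"
    have "insert {a, a'} F \<in> pairings H"
      using pairings_insert_pair[OF fibre_pairings_pairings[OF F] aH(3) aK] HK by simp
    then show "insert {a, a'} F \<in> {F \<in> ?P. {a, a'} \<in> F}" using F att by (auto simp: fibre_pairings_def)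
    have "{a, a'} \<notin> F" using pairings_Union[OF fibre_pairings_pairings[OF F]] aK by auto
    then show "insert {a, a'} F - {{a, a'}} = F" by auto
  qed
  also have "(\<Sum>F\<in>{F \<in> ?P. {a, a'} \<notin> F}. g F) = (\<Sum>(F, b)\<in>fibre_pairings f K \<times> ?V. g (bypass a a' F b))"
  proof (rule sum.reindex_bij_witness[where i = "\<lambda>(F, b). bypass a a' F b" and
        j = "\<lambda>F. (insert {partner F a, partner F a'} (F - {{a, partner F a}} - {{a', partner F a'}}), partner F a)"])
    fix F assume "F \<in> {F \<in> ?P. {a, a'} \<notin> F}"
    then have F: "F \<in> ?P" and new: "{a, a'} \<notin> F" by auto
    have P: "F \<in> pairings H" by (rule fibre_pairings_pairings[OF F])
    define b b' where "b = partner F a" and "b' = partner F a'"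
    have ab: "{a, b} \<in> F" "{a', b'} \<in> F" using partner_in[OF P] aH by (auto simp: b_def b'_def)
    have ba: "partner F b = a" "partner F b' = a'" using partner_partner[OF P] aH by (auto simp: b_def b'_def)
    have "b \<noteq> a'" "b' \<noteq> a" using ab new by (auto simp: insert_commute)
    moreover have "b \<in> H" "b' \<in> H" "b \<noteq> a" "b' \<noteq> a'"
      using partner_mem[OF P] partner_neq[OF P] aH by (auto simp: b_def b'_def)
    moreover have "b \<noteq> b'" using ba aH(3) by auto
    ultimately have b: "b \<in> K" "b' \<in> K" "b \<noteq> b'" "b \<noteq> a'" "b' \<noteq> a" by (auto simp: K_def)
    have fb: "f b = v" "f b' = v" using fibre_pairings_att[OF F] aH att by (auto simp: b_def b'_def)
    have nF: "{b, b'} \<notin> F - {{a, b}} - {{a', b'}}"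
    proof
      assume "{b, b'} \<in> F - {{a, b}} - {{a', b'}}"
      then have "partner F b = b'" using partner_eqI[OF P, of b b'] by auto
      then show False using ba(1) b by auto
    qed
    let ?F = "insert {b, b'} (F - {{a, b}} - {{a', b'}})"
    have "F - {{a, b}} \<in> pairings (H - {a, b})" by (rule pairings_remove_pair[OF P ab(1)])
    then have "F - {{a, b}} - {{a', b'}} \<in> pairings (H - {a, b} - {a', b'})"
      by (rule pairings_remove_pair) (use ab(2) b aH(3) in \<open>auto simp: doubleton_eq_iff\<close>)
    then have "?F \<in> pairings (insert b (insert b' (H - {a, b} - {a', b'})))"
      by (rule pairings_insert_pair) (use b in auto)
    moreover have "insert b (insert b' (H - {a, b} - {a', b'})) = K" using b by (auto simp: K_def)
    ultimately have FK: "?F \<in> pairings K" by simp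
    then show "(insert {partner F a, partner F a'} (F - {{a, partner F a}} - {{a', partner F a'}}), partner F a)
        \<in> fibre_pairings f K \<times> ?V"
      using F fb b by (auto simp: fibre_pairings_def simp flip: b_def b'_def)
    have "partner ?F b = b'" by (rule partner_eqI[OF FK]) simp
    then have "bypass a a' ?F b = insert {a, b} (insert {a', b'} (?F - {{b, b'}}))" by (simp add: bypass_def)
    also have "?F - {{b, b'}} = F - {{a, b}} - {{a', b'}}" using nF by auto
    finally have eq: "bypass a a' ?F b = F" using ab by auto
    show "(case (insert {partner F a, partner F a'} (F - {{a, partner F a}} - {{a', partner F a'}}), partner F a) of
        (F, b) \<Rightarrow> bypass a a' F b) = F"
      using eq by (simp flip: b_def b'_def)
    show "(case (insert {partner F a, partner F a'} (F - {{a, partner F a}} - {{a', partner F a'}}), partner F a) of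
        (F, b) \<Rightarrow> g (bypass a a' F b)) = g F"
      using eq by (simp flip: b_def b'_def)
  next
    fix x assume "x \<in> fibre_pairings f K \<times> ?V"
    then obtain F b where x: "x = (F, b)" and F: "F \<in> fibre_pairings f K" and b: "b \<in> K" "f b = v" by auto
    have P: "F \<in> pairings K" by (rule fibre_pairings_pairings[OF F])
    define b' where "b' = partner F b"
    have b': "b' \<in> K" "b' \<noteq> b" "{b, b'} \<in> F" "f b' = v"
      using partner_mem[OF P b(1)] partner_neq[OF P b(1)] partner_in[OF P b(1)] fibre_pairings_att[OF F b(1)] b(2)
      by (auto simp: b'_def)
    let ?F = "insert {a, b} (insert {a', b'} (F - {{b, b'}}))"
    have by_eq: "bypass a a' F b = ?F" by (simp add: bypass_def b'_def)
    have "F - {{b, b'}} \<in> pairings (K - {b, b'})" by (rule pairings_remove_pair[OF P b'(3)])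
    then have "insert {a', b'} (F - {{b, b'}}) \<in> pairings (insert a' (insert b' (K - {b, b'})))"
      by (rule pairings_insert_pair) (use b' aK in auto)
    then have "?F \<in> pairings (insert a (insert b (insert a' (insert b' (K - {b, b'})))))"
      by (rule pairings_insert_pair) (use b b' aK aH in auto)
    moreover have "insert a (insert b (insert a' (insert b' (K - {b, b'})))) = H" using HK b b' by auto
    ultimately have FP: "?F \<in> pairings H" by simp
    have pa: "partner ?F a = b" by (rule partner_eqI[OF FP]) simp
    have pa': "partner ?F a' = b'" by (rule partner_eqI[OF FP]) simp
    have "{a, a'} \<notin> ?F"
    proof
      assume "{a, a'} \<in> ?F"
      then have "b = a'" using partner_eqI[OF FP] pa by auto
      then show False using b aK by auto
    qed
    then show "(case x of (F, b) \<Rightarrow> bypass a a' F b) \<in> {F \<in> ?P. {a, a'} \<notin> F}"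
      using FP F att b b' by (auto simp: x by_eq fibre_pairings_def)
    have "?F - {{a, b}} - {{a', b'}} = F - {{b, b'}}"
      using pairings_Union[OF P] aK by auto
    then have "insert {b, b'} (?F - {{a, b}} - {{a', b'}}) = F" using b'(3) by auto
    then show "(insert {partner (case x of (F, b) \<Rightarrow> bypass a a' F b) a, partner (case x of (F, b) \<Rightarrow> bypass a a' F b) a'}
       ((case x of (F, b) \<Rightarrow> bypass a a' F b) - {{a, partner (case x of (F, b) \<Rightarrow> bypass a a' F b) a}} -
        {{a', partner (case x of (F, b) \<Rightarrow> bypass a a' F b) a'}}),
       partner (case x of (F, b) \<Rightarrow> bypass a a' F b) a) = x"
      by (simp add: x by_eq pa pa')
  qed
  also have "\<dots> = (\<Sum>F\<in>fibre_pairings f K. \<Sum>b\<in>?V. g (bypass a a' F b))"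
    by (rule sum.cartesian_product[symmetric])
  finally show ?thesis .
qed

text \<open>The Martin polynomial multiplied by \<open>x - 2\<close>, when \<open>y\<close> is
  \<open>x - 2\<close>. The exponent c(P) in place of c(P) - 1 makes loop removal multiplicative
  down to the graph without edges.\<close>

definition circuit_sum :: "'a::comm_semiring_1 \<Rightarrow> ('v, 'h) mgraph \<Rightarrow> 'a" where
  "circuit_sum y G = (\<Sum>F\<in>fibre_pairings (att G) (halves G). y ^ circuits (edges G) F)"

lemma circuit_sum_resolve:
  assumes G: "pregraph G" and v: "loopless_at G v"
  shows "circuit_sum y G = (\<Sum>\<tau>\<in>transitions G v. circuit_sum y (resolve G v \<tau>))"
proof -
  have "circuit_sum y G = (\<Sum>\<tau>\<in>pairings (halves_at G v).
      \<Sum>F\<in>fibre_pairings (att G) (halves G - halves_at G v). y ^ circuits (edges G) (\<tau> \<union> F))"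
    unfolding circuit_sum_def halves_at_def by (rule sum_fibre_pairings_split[OF finite_halves[OF G]])
  also have "\<dots> = (\<Sum>\<tau>\<in>transitions G v. circuit_sum y (resolve G v \<tau>))"
    unfolding transitions_def
  proof (rule sum.cong[OF refl])
    fix \<tau> assume "\<tau> \<in> pairings (halves_at G v)"
    then interpret resolution G v \<tau> using G v by unfold_locales
    show "(\<Sum>F\<in>fibre_pairings (att G) (halves G - halves_at G v). y ^ circuits (edges G) (\<tau> \<union> F)) =
        circuit_sum y (resolve G v \<tau>)"
      unfolding circuit_sum_def halves_resolve resolve_simps
      by (rule sum.cong[OF refl]) (simp add: circuits_resolve fibre_pairings_pairings)
  qed
  finally show ?thesis .
qed

abbreviation remove_edge :: "('v, 'h) mgraph \<Rightarrow> 'h set \<Rightarrow> ('v, 'h) mgraph" where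
  "remove_edge G e \<equiv> G\<lparr>edges := edges G - {e}\<rparr>"

lemma
  assumes "pregraph G" "e \<in> edges G"
  shows halves_remove_edge: "halves (remove_edge G e) = halves G - e"
    and pregraph_remove_edge: "pregraph (remove_edge G e)"
proof -
  have *: "edges G - {e} \<in> pairings (halves G - e)"
    using pairings_Diff[of "edges G" _ "{e}"] assms by (auto simp: pregraph_def)
  then show "halves (remove_edge G e) = halves G - e"
    using pairings_Union by (auto simp: halves_def)
  then show "pregraph (remove_edge G e)" using * assms by (simp add: pregraph_def)
qed

text \<open>A loop paired with itself is a new circuit and contributes \<open>y\<close>; spliced in
  next to any of the other half-edges at \<open>v\<close>, it leaves the number of circuits
  unchanged.\<close>

lemma circuit_sum_loop:
  fixes y :: "'a::comm_semiring_1"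
  assumes G: "pregraph G" and e: "{a, a'} \<in> edges G" and att: "att G a = v" "att G a' = v"
  shows "circuit_sum y G = (y + of_nat (card (halves_at G v) - 2)) * circuit_sum y (remove_edge G {a, a'})"
proof -
  have E: "edges G \<in> pairings (halves G)" using G by (simp add: pregraph_def)
  have a: "a \<in> halves G" "a' \<in> halves G" "a \<noteq> a'"
    using e pairings_distinct[OF E e] by (auto simp: halves_def)
  let ?K = "halves G - {a, a'}" and ?E = "edges G - {{a, a'}}"
  let ?V = "{b \<in> ?K. att G b = v}" and ?P = "fibre_pairings (att G) (halves G - {a, a'})"
  have "?V = halves_at G v - {a, a'}" by (auto simp: halves_at_def)
  moreover have "{a, a'} \<subseteq> halves_at G v" using a att by (auto simp: halves_at_def)
  ultimately have V: "card ?V = card (halves_at G v) - 2"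
    using a(3) finite_halves_at[OF G] by (simp add: card_Diff_subset)
  have "circuit_sum y G = (\<Sum>F\<in>?P. y ^ circuits (edges G) (insert {a, a'} F)) +
      (\<Sum>F\<in>?P. \<Sum>b\<in>?V. y ^ circuits (edges G) (bypass a a' F b))"
    unfolding circuit_sum_def
    by (rule sum_fibre_pairings_loop[OF finite_halves[OF G] a att])
  also have "(\<Sum>F\<in>?P. y ^ circuits (edges G) (insert {a, a'} F)) = (\<Sum>F\<in>?P. y * y ^ circuits ?E F)"
    using circuits_insert_closed[OF E e] G
    by (intro sum.cong) (simp_all add: pregraph_def fibre_pairings_pairings)
  also have "(\<Sum>F\<in>?P. \<Sum>b\<in>?V. y ^ circuits (edges G) (bypass a a' F b)) = (\<Sum>F\<in>?P. \<Sum>b\<in>?V. y ^ circuits ?E F)"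
  proof (intro sum.cong refl)
    fix F b assume F: "F \<in> ?P" and b: "b \<in> ?V"
    have P: "F \<in> pairings ?K" by (rule fibre_pairings_pairings[OF F])
    have "{b, partner F b} \<in> F" by (rule partner_in[OF P]) (use b in simp)
    from circuits_bypass[OF E e P this]
    show "y ^ circuits (edges G) (bypass a a' F b) = y ^ circuits ?E F" by (simp add: bypass_def)
  qed
  finally have "circuit_sum y G = y * (\<Sum>F\<in>?P. y ^ circuits ?E F) +
      of_nat (card (halves_at G v) - 2) * (\<Sum>F\<in>?P. y ^ circuits ?E F)"
    by (simp only: sum_constant V sum_distrib_left)
  then show ?thesis by (simp add: circuit_sum_def halves_remove_edge[OF G e] distrib_right)
qed

text \<open>Isomorphism invariance in terms of half-edges. Only coincidence of attachments matters,
  so names of vertices, such as that of a contracted vertex, may change freely.\<close>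

lemma circuit_sum_image:
  assumes G: "pregraph G" and inj: "inj_on \<phi> (halves G)" and E: "edges G' = (`) \<phi> ` edges G"
    and att: "\<And>h h'. h \<in> halves G \<Longrightarrow> h' \<in> halves G \<Longrightarrow> att G' (\<phi> h) = att G' (\<phi> h') \<longleftrightarrow> att G h = att G h'"
  shows "circuit_sum y G' = circuit_sum y G"
proof -
  have EP: "edges G \<in> pairings (halves G)" using G by (simp add: pregraph_def)
  have H: "halves G' = \<phi> ` halves G" using E by (auto simp: halves_def)
  have "(\<Sum>F\<in>fibre_pairings (att G') (halves G'). y ^ circuits (edges G') F) =
    (\<Sum>F\<in>fibre_pairings (att G) (halves G). y ^ circuits (edges G) F)"
  proof (rule sum.reindex_bij_witness[where j = "(`) ((`) (inv_into (halves G) \<phi>))" and i = "(`) ((`) \<phi>)"])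
    let ?\<psi> = "inv_into (halves G) \<phi>"
    fix F assume F: "F \<in> fibre_pairings (att G') (halves G')"
    have P: "F \<in> pairings (\<phi> ` halves G)" using fibre_pairings_pairings[OF F] H by simp
    have sub: "p \<subseteq> \<phi> ` halves G" if "p \<in> F" for p using pairings_Union[OF P] that by auto
    have inv: "\<phi> ` ?\<psi> ` p = p" if "p \<in> F" for p
      using image_inv_into_cancel[OF refl sub[OF that]] .
    have inv': "?\<psi> ` \<phi> ` halves G = halves G" using inj by (simp add: image_inv_into_cancel)
    have "(`) \<phi> ` (`) ?\<psi> ` F = (\<lambda>p. \<phi> ` ?\<psi> ` p) ` F" by (rule image_image)
    also have "\<dots> = (\<lambda>p. p) ` F" using inv by (intro image_cong refl)
    finally show eq: "(`) \<phi> ` (`) ?\<psi> ` F = F" by (simp only: image_ident)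
    have PF: "(`) ?\<psi> ` F \<in> pairings (halves G)"
      using pairings_image[OF P, of ?\<psi>] inj_on_inv_into[of "\<phi> ` halves G" \<phi> "halves G"] inv' by simp
    show "(`) ?\<psi> ` F \<in> fibre_pairings (att G) (halves G)"
    proof -
      have "\<exists>v. ?\<psi> ` p \<subseteq> att G -` {v}" if p: "p \<in> F" for p
      proof -
        have sub': "?\<psi> ` p \<subseteq> halves G" using p pairings_Union[OF PF] by auto
        obtain u where u: "p \<subseteq> att G' -` {u}" using fibre_pairingsD[OF F p] by auto
        have "att G h = att G h'" if h: "h \<in> ?\<psi> ` p" "h' \<in> ?\<psi> ` p" for h h'
        proof -
          have "\<phi> h \<in> p" "\<phi> h' \<in> p" using inv[OF p] h by blast+
          then have "att G' (\<phi> h) = att G' (\<phi> h')" using u by auto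
          then show ?thesis using att[of h h'] sub' h by auto
        qed
        then show ?thesis by (rule constant_fibre)
      qed
      then show ?thesis using PF by (intro fibre_pairingsI) auto
    qed
    show "y ^ circuits (edges G) ((`) ?\<psi> ` F) = y ^ circuits (edges G') F"
      using circuits_image[OF EP PF inj] eq E by simp
  next
    let ?\<psi> = "inv_into (halves G) \<phi>"
    fix F assume F: "F \<in> fibre_pairings (att G) (halves G)"
    have P: "F \<in> pairings (halves G)" by (rule fibre_pairings_pairings[OF F])
    have sub: "p \<subseteq> halves G" if "p \<in> F" for p using pairings_Union[OF P] that by auto
    have "(`) ?\<psi> ` (`) \<phi> ` F = (\<lambda>p. ?\<psi> ` \<phi> ` p) ` F" by (rule image_image)
    also have "\<dots> = (\<lambda>p. p) ` F" using inj sub by (intro image_cong refl inv_into_image_cancel)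
    finally show "(`) ?\<psi> ` (`) \<phi> ` F = F" by (simp only: image_ident)
    have "(`) \<phi> ` F \<in> pairings (halves G')" using pairings_image[OF P inj] H by simp
    moreover have "\<exists>v. \<phi> ` p \<subseteq> att G' -` {v}" if p: "p \<in> F" for p
    proof -
      obtain u where u: "p \<subseteq> att G -` {u}" using fibre_pairingsD[OF F p] by auto
      have "att G' (\<phi> h) = att G' (\<phi> h')" if "h \<in> p" "h' \<in> p" for h h'
        using that sub[OF p] u att[of h h'] by auto
      then show ?thesis by (intro constant_fibre) blast
    qed
    ultimately show "(`) \<phi> ` F \<in> fibre_pairings (att G') (halves G')" by (intro fibre_pairingsI) auto
  qed
  then show ?thesis by (simp add: circuit_sum_def)
qed

section \<open>Roots of the circuit sum and its relation to the Martin polynomial\<close>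

lemma loopE:
  assumes "pregraph G" "\<not> loopless_at G v"
  obtains a a' where "{a, a'} \<in> edges G" "a \<noteq> a'" "att G a = v" "att G a' = v"
proof -
  obtain h where h: "h \<in> halves_at G v" "att G (mate G h) = v"
    using assms(2) by (auto simp: loopless_at_def)
  then have "h \<in> halves G" "att G h = v" by (auto simp: halves_at_def)
  then show ?thesis using that[of h "mate G h"] mate_edge[OF assms(1)] mate_neq[OF assms(1)] h(2) by metis
qed

text \<open>A loop at \<open>u\<close> yields the factor directly. Otherwise other vertices are
  simplified away without changing the degree of \<open>u\<close>, and positive degree ensures that
  this ends with a loop at \<open>u\<close>.\<close>

lemma circuit_sum_dvd:
  fixes y :: "'a::comm_semiring_1"
  assumes "pregraph G" "card (halves_at G u) = d" "d > 0"
  shows "(y + of_nat (d - 2)) dvd circuit_sum y G"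
  using assms
proof (induction "card (halves G)" arbitrary: G rule: less_induct)
  case less
  note G = less.prems(1)
  have fin: "finite (halves G)" by (rule finite_halves[OF G])
  show ?case
  proof (cases "loopless_at G u")
    case False
    from G this obtain a a' where "{a, a'} \<in> edges G" "a \<noteq> a'" "att G a = u" "att G a' = u" by (rule loopE)
    then show ?thesis using circuit_sum_loop[OF G, of a a' u y] less.prems by simp
  next
    case True
    obtain h where h: "h \<in> halves_at G u" using less.prems(2,3) by fastforce
    \<comment> \<open>\<open>w\<close> is a neighbour of \<open>u\<close>. Removing a loop at
      \<open>w\<close> or resolving \<open>w\<close> strictly lowers the number of half-edges and
      keeps those at \<open>u\<close>.\<close>
    define w where "w = att G (mate G h)"
    have "mate G h \<in> halves G" using mate_halves[OF G] h halves_at_subset by fast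
    then have mw: "mate G h \<in> halves_at G w" by (simp add: halves_at_def w_def)
    have wu: "w \<noteq> u" using True h by (auto simp: loopless_at_def w_def)
    show ?thesis
    proof (cases "loopless_at G w")
      case False
      from G this obtain a a' where a: "{a, a'} \<in> edges G" "a \<noteq> a'" "att G a = w" "att G a' = w" by (rule loopE)
      have aH: "a \<in> halves G" "a' \<in> halves G" using a by (auto simp: halves_def)
      have H: "halves (remove_edge G {a, a'}) = halves G - {a, a'}"
        and pre: "pregraph (remove_edge G {a, a'})"
        using halves_remove_edge[OF G a(1)] pregraph_remove_edge[OF G a(1)] .
      have "halves_at (remove_edge G {a, a'}) u = halves_at G u"
        unfolding halves_at_def H using a(3,4) wu by auto
      moreover have "card (halves (remove_edge G {a, a'})) < card (halves G)"
        unfolding H by (rule psubset_card_mono[OF fin]) (use aH in auto)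
      ultimately have "(y + of_nat (d - 2)) dvd circuit_sum y (remove_edge G {a, a'})"
        using less.hyps[OF _ pre] less.prems(2,3) by simp
      then show ?thesis using circuit_sum_loop[OF G a(1,3,4), of y] by (simp add: dvd_mult)
    next
      case w: True
      show ?thesis
        unfolding circuit_sum_resolve[OF G w] transitions_def
      proof (rule dvd_sum)
        fix \<tau> assume "\<tau> \<in> pairings (halves_at G w)"
        then interpret resolution G w \<tau> using G w by unfold_locales
        have "card (halves (resolve G w \<tau>)) < card (halves G)"
          unfolding halves_resolve by (rule psubset_card_mono[OF fin]) (use mw halves_at_subset in fast)
        then show "(y + of_nat (d - 2)) dvd circuit_sum y (resolve G w \<tau>)"
          using less.hyps[OF _ pregraph_resolve] less.prems(2,3) halves_at_resolve[of u] wu by simp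
      qed
    qed
  qed
qed

lemma circuits_pos:
  assumes "finite E" "E \<noteq> {}"
  shows "circuits E F > 0"
proof -
  have "E // (consec E F)\<^sup>* \<noteq> {}" using assms by (auto simp: quotient_def)
  moreover have "finite (E // (consec E F)\<^sup>*)" using assms by (simp add: quotient_def)
  ultimately show ?thesis by (simp add: circuits_def card_gt_0_iff)
qed

text \<open>Every edge is a loop, and removing one at degree \<open>2j + 2\<close> gives the factor
  \<open>y + 2j\<close>.\<close>

lemma circuit_sum_bouquet:
  fixes y :: "'a::comm_semiring_1"
  assumes "pregraph G" "\<And>h. h \<in> halves G \<Longrightarrow> att G h = v" "card (halves G) = 2 * k"
  shows "circuit_sum y G = (\<Prod>j<k. y + of_nat (2 * j))"
  using assms
proof (induction k arbitrary: G)
  case 0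
  then have "halves G = {}" using finite_halves[OF 0(1)] by simp
  moreover from this 0 have E: "edges G = {}" by (auto simp: pregraph_def pairings_empty)
  moreover have "fibre_pairings (att G) {} = {{}}" by (auto simp: fibre_pairings_def pairings_empty)
  moreover have "circuits (edges G) {} = 0" by (simp add: E circuits_def quotient_def)
  ultimately show ?case by (simp add: circuit_sum_def)
next
  case (Suc k)
  note G = Suc.prems(1)
  obtain a where a: "a \<in> halves G" using Suc.prems(3) by fastforce
  define a' where "a' = mate G a"
  have a': "a' \<in> halves G" "a' \<noteq> a" and e: "{a, a'} \<in> edges G"
    using mate_halves[OF G a] mate_neq[OF G a] mate_edge[OF G a] by (simp_all add: a'_def)
  have "halves_at G v = halves G" using Suc.prems(2) by (auto simp: halves_at_def)
  then have "circuit_sum y G = (y + of_nat (2 * k)) * circuit_sum y (remove_edge G {a, a'})"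
    using circuit_sum_loop[OF G e Suc.prems(2)[OF a] Suc.prems(2)[OF a'(1)], of y] Suc.prems(3) by simp
  also have "circuit_sum y (remove_edge G {a, a'}) = (\<Prod>j<k. y + of_nat (2 * j))"
  proof (rule Suc.IH)
    show "pregraph (remove_edge G {a, a'})" by (rule pregraph_remove_edge[OF G e])
    have H: "halves (remove_edge G {a, a'}) = halves G - {a, a'}" by (rule halves_remove_edge[OF G e])
    then show "att (remove_edge G {a, a'}) h = v" if "h \<in> halves (remove_edge G {a, a'})" for h
      using that Suc.prems(2) by simp
    show "card (halves (remove_edge G {a, a'})) = 2 * k"
      unfolding H using a a' Suc.prems(3) finite_halves[OF G] by (simp add: card_Diff_subset)
  qed
  finally show ?case by (simp add: mult.commute)
qed

text \<open>Taking the union of the vertex pairings loses nothing, since a nonempty pair determines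
  its vertex; the inverse sorts the pairs by vertex. Restricting it to \<open>verts G\<close>
  matches the extensional functions in \<open>transition_systems\<close>.\<close>

lemma sum_transition_systems:
  assumes "multigraph G"
  shows "(\<Sum>P\<in>transition_systems G. g (\<Union>v\<in>verts G. P v)) = (\<Sum>F\<in>fibre_pairings (att G) (halves G). g F)"
proof (rule sum.reindex_bij_witness[where j = "\<lambda>P. \<Union>v\<in>verts G. P v"
      and i = "\<lambda>F. \<lambda>v\<in>verts G. {p \<in> F. p \<subseteq> halves_at G v}"])
  interpret multigraph G by fact
  fix P assume P: "P \<in> transition_systems G"
  have Pv: "P v \<in> pairings (halves_at G v)" if "v \<in> verts G" for v
    using P that by (auto simp: transition_systems_def transitions_def)
  have at: "p \<subseteq> halves_at G v" if "v \<in> verts G" "p \<in> P v" for v p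
    using pairings_Union[OF Pv[OF that(1)]] that(2) by auto
  have ne: "\<exists>h. h \<in> p" if "v \<in> verts G" "p \<in> P v" for v p
    using pairings_card2[OF Pv[OF that(1)] that(2)] by (metis card.empty ex_in_conv zero_neq_numeral)
  have same: "u = v" if "u \<in> verts G" "v \<in> verts G" "p \<in> P u" "h \<in> p" "h \<in> halves_at G v" for u v p h
    using at[OF that(1,3)] that(4,5) by (auto simp: halves_at_def)
  have "(\<Union>v\<in>verts G. P v) \<in> pairings (halves G)"
  proof (rule pairingsI)
    have "h \<in> \<Union> (P (att G h))" if "h \<in> halves G" for h
      using pairings_Union[OF Pv[OF att_verts[OF that]]] that by (simp add: halves_at_def)
    then have "halves G \<subseteq> \<Union> (\<Union>v\<in>verts G. P v)" using att_verts by fast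
    moreover have "p \<subseteq> halves G" if "v \<in> verts G" "p \<in> P v" for v p
      using at[OF that] halves_at_subset by (rule subset_trans)
    ultimately show "\<Union> (\<Union>v\<in>verts G. P v) = halves G" by (intro subset_antisym Union_least) auto
    show "card p = 2" if "p \<in> (\<Union>v\<in>verts G. P v)" for p
      using that pairings_card2[OF Pv] by auto
    fix p q h assume "p \<in> (\<Union>v\<in>verts G. P v)" "q \<in> (\<Union>v\<in>verts G. P v)" "h \<in> p" "h \<in> q"
    then obtain u v where uv: "u \<in> verts G" "v \<in> verts G" "p \<in> P u" "q \<in> P v" "h \<in> p" "h \<in> q" by auto
    have "h \<in> halves_at G v" using at[OF uv(2,4)] uv(6) by auto
    then have "u = v" by (rule same[OF uv(1,2,3,5)])
    then show "p = q" using pairings_eq[OF Pv[OF uv(2)] _ uv(4,5,6)] uv(3) by simp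
  qed
  moreover have "\<exists>v. p \<subseteq> att G -` {v}" if p: "p \<in> (\<Union>v\<in>verts G. P v)" for p
  proof -
    obtain v where "v \<in> verts G" "p \<in> P v" using p by auto
    then have "p \<subseteq> halves_at G v" by (rule at)
    then show ?thesis by (intro exI[of _ v]) (auto simp: halves_at_def)
  qed
  ultimately show "(\<Union>v\<in>verts G. P v) \<in> fibre_pairings (att G) (halves G)" by (rule fibre_pairingsI)
  show "(\<lambda>v\<in>verts G. {p \<in> (\<Union>v\<in>verts G. P v). p \<subseteq> halves_at G v}) = P"
  proof
    fix v show "(\<lambda>v\<in>verts G. {p \<in> (\<Union>v\<in>verts G. P v). p \<subseteq> halves_at G v}) v = P v"
    proof (cases "v \<in> verts G")
      case True
      have "p \<in> P v" if p: "u \<in> verts G" "p \<in> P u" "p \<subseteq> halves_at G v" for u p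
      proof -
        obtain h where h: "h \<in> p" using ne[OF p(1,2)] by auto
        then have "u = v" using same[OF p(1) True p(2) h] p(3) by auto
        then show ?thesis using p(2) by simp
      qed
      then have "{p \<in> (\<Union>v\<in>verts G. P v). p \<subseteq> halves_at G v} = P v"
        using True at[OF True] by blast
      then show ?thesis using True by simp
    next
      case False
      then show ?thesis using P by (auto simp: transition_systems_def PiE_def extensional_def)
    qed
  qed
next
  interpret multigraph G by fact
  fix F assume F: "F \<in> fibre_pairings (att G) (halves G)"
  have P: "F \<in> pairings (halves G)" by (rule fibre_pairings_pairings[OF F])
  have in_at: "\<exists>v\<in>verts G. p \<subseteq> halves_at G v" if p: "p \<in> F" for p
  proof -
    from fibre_pairingsD[OF F p] obtain v where "p \<subseteq> att G -` {v}" by auto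
    moreover have "p \<subseteq> halves G" using pairings_Union[OF P] p by auto
    moreover have "p \<noteq> {}" using pairings_card2[OF P p] by auto
    ultimately show ?thesis using att_verts by (intro bexI[of _ v]) (auto simp: halves_at_def)
  qed
  have "{p \<in> F. p \<subseteq> halves_at G v} \<in> pairings (halves_at G v)" for v
  proof -
    have "h \<in> \<Union> {p \<in> F. p \<subseteq> halves_at G v}" if h: "h \<in> halves_at G v" for h
    proof -
      have "h \<in> halves G" using h by (simp add: halves_at_def)
      then obtain p where p: "p \<in> F" "h \<in> p" using pairings_Union[OF P] by blast
      then obtain u where "p \<subseteq> halves_at G u" using in_at by auto
      moreover from this p h have "u = v" by (auto simp: halves_at_def)
      ultimately show ?thesis using p by auto
    qed
    then have "\<Union> {p \<in> F. p \<subseteq> halves_at G v} = halves_at G v" by blast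
    then show ?thesis using pairings_subset[OF P, of "{p \<in> F. p \<subseteq> halves_at G v}"] by auto
  qed
  then show "(\<lambda>v\<in>verts G. {p \<in> F. p \<subseteq> halves_at G v}) \<in> transition_systems G"
    by (simp add: transition_systems_def transitions_def)
  show "(\<Union>v\<in>verts G. (\<lambda>v\<in>verts G. {p \<in> F. p \<subseteq> halves_at G v}) v) = F" using in_at by auto
qed simp

lemma num_trails_eq: "num_trails G P = circuits (edges G) (\<Union>v\<in>verts G. P v)"
  by (simp add: num_trails_def circuits_def consec_def consecutive_def) 
    (rule arg_cong[of _ _ "\<lambda>R. card (edges G // R\<^sup>*)"], auto)

lemma multigraph_pregraph: "multigraph G \<Longrightarrow> pregraph G"
  by (simp add: multigraph_def pregraph_def)

text \<open>With an edge present every transition system has a circuit, so the natural subtraction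
  in c(P) - 1 is exact.\<close>

lemma circuit_sum_martin_poly:
  assumes "multigraph G" "edges G \<noteq> {}"
  shows "circuit_sum [:-2, 1:] G = [:-2, 1:] * martin_poly G"
proof -
  have "circuits (edges G) F > 0" for F
    using assms(2) multigraph_pregraph[OF assms(1)] by (intro circuits_pos) (auto simp: pregraph_def)
  then have "[:-2, 1:] ^ circuits (edges G) F = [:-2, 1:] * [:-2, 1::real:] ^ (circuits (edges G) F - 1)" for F
    by (metis power_eq_if bot_nat_0.not_eq_extremum)
  then have "circuit_sum [:-2, 1:] G =
      (\<Sum>F\<in>fibre_pairings (att G) (halves G). [:-2, 1:] * [:-2, 1::real:] ^ (circuits (edges G) F - 1))"
    unfolding circuit_sum_def by (intro sum.cong refl)
  also have "\<dots> = [:-2, 1:] * martin_poly G"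
    unfolding martin_poly_def num_trails_eq
      sum_transition_systems[OF assms(1), of "\<lambda>F. [:-2, 1:] ^ (circuits (edges G) F - 1)"]
    by (rule sum_distrib_left[symmetric])
  finally show ?thesis .
qed

subsection \<open>The Martin invariant as a derivative\<close>

definition even_regular :: "nat \<Rightarrow> ('v, 'h) mgraph \<Rightarrow> bool" where
  "even_regular k G \<longleftrightarrow> k \<ge> 1 \<and> multigraph G \<and> regular G (2 * k)"

lemma
  assumes "even_regular k G"
  shows even_regular_pregraph: "pregraph G"
    and even_regular_k: "k \<ge> 1"
    and even_regular_finite: "finite (verts G)"
    and even_regular_nonempty: "verts G \<noteq> {}"
    and even_regular_att: "h \<in> halves G \<Longrightarrow> att G h \<in> verts G"
    and even_regular_card: "v \<in> verts G \<Longrightarrow> card (halves_at G v) = 2 * k"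
  using assms multigraph_pregraph
  by (auto simp: even_regular_def regular_def degree_at_def multigraph_def)

lemma even_regularI:
  assumes "pregraph G" "k \<ge> 1" "finite (verts G)" "verts G \<noteq> {}"
    "\<And>h. h \<in> halves G \<Longrightarrow> att G h \<in> verts G" "\<And>v. v \<in> verts G \<Longrightarrow> card (halves_at G v) = 2 * k"
  shows "even_regular k G"
  using assms by (simp add: even_regular_def regular_def degree_at_def multigraph_def pregraph_def)

lemma even_regular_resolve:
  assumes R: "even_regular k G" and l: "loopless_at G v" and card: "card (verts G) \<ge> 2"
    and \<tau>: "\<tau> \<in> transitions G v"
  shows "even_regular k (resolve G v \<tau>)"
proof -
  interpret resolution G v \<tau>
    using assms even_regular_pregraph[OF R] by unfold_locales (simp_all add: transitions_def)
  show ?thesis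
  proof (rule even_regularI)
    have "\<not> verts G \<subseteq> {v}"
      using card card_mono[of "{v}" "verts G"] by auto
    then show "verts (resolve G v \<tau>) \<noteq> {}" by auto
    show "att (resolve G v \<tau>) h \<in> verts (resolve G v \<tau>)" if "h \<in> halves (resolve G v \<tau>)" for h
      using that even_regular_att[OF R] by (auto simp: halves_resolve halves_at_def)
    show "card (halves_at (resolve G v \<tau>) u) = 2 * k" if "u \<in> verts (resolve G v \<tau>)" for u
      using that even_regular_card[OF R] halves_at_resolve[of u] by simp
  qed (use pregraph_resolve even_regular_k[OF R] even_regular_finite[OF R] in simp_all)
qed

lemma has_loopE:
  assumes "even_regular k G" "has_loop G"
  obtains v where "v \<in> verts G" "\<not> loopless_at G v"
proof -
  note G = even_regular_pregraph[OF assms(1)]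
  obtain e where e: "e \<in> edges G" "\<forall>h\<in>e. \<forall>h'\<in>e. att G h = att G h'" using assms(2) by (auto simp: has_loop_def)
  obtain h where h: "h \<in> halves G" "e = {h, mate G h}" using edgeE[OF G e(1)] .
  have "att G (mate G h) = att G h" using e(2) h(2) by blast
  then show ?thesis using that[of "att G h"] h even_regular_att[OF assms(1) h(1)]
    by (auto simp: loopless_at_def halves_at_def)
qed

lemma loopless_atI:
  assumes "pregraph G" "\<not> has_loop G"
  shows "loopless_at G v"
proof (rule ccontr)
  assume "\<not> loopless_at G v"
  with assms(1) obtain a a' where "{a, a'} \<in> edges G" "att G a = v" "att G a' = v" by (rule loopE)
  then have "has_loop G" unfolding has_loop_def by (intro bexI[of _ "{a, a'}"]) simp_all
  then show False using assms(2) by contradiction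
qed

text \<open>The normalisation turns the derivative of \<open>(x - 2) m(x)\<close> at \<open>4 - 2k\<close> into the Martin
  invariant, for every number of vertices and including \<open>k = 1\<close>.\<close>

definition closed_martin :: "nat \<Rightarrow> ('v, 'h) mgraph \<Rightarrow> real" where
  "closed_martin k G = 2 * (-1) ^ (k + 1) / (fact (k - 1) * fact (2 * k)) *
    poly (pderiv (circuit_sum [:-2, 1:] G)) (4 - 2 * real k)"

lemma pderiv_sum: "pderiv (\<Sum>x\<in>A. p x) = (\<Sum>x\<in>A. pderiv (p x))"
  by (induction A rule: infinite_finite_induct) (simp_all add: pderiv_add)

lemma closed_martin_resolve:
  assumes "pregraph G" "loopless_at G v"
  shows "closed_martin k G = (\<Sum>\<tau>\<in>transitions G v. closed_martin k (resolve G v \<tau>))"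
  by (simp only: closed_martin_def circuit_sum_resolve[OF assms] pderiv_sum poly_sum sum_distrib_left)

lemma closed_martin_image:
  assumes "pregraph G" "inj_on \<phi> (halves G)" "edges G' = (`) \<phi> ` edges G"
    and "\<And>h h'. h \<in> halves G \<Longrightarrow> h' \<in> halves G \<Longrightarrow> att G' (\<phi> h) = att G' (\<phi> h') \<longleftrightarrow> att G h = att G h'"
  shows "closed_martin k G' = closed_martin k G"
  by (simp only: closed_martin_def circuit_sum_image[OF assms])

lemma poly_pderiv_double_root:
  fixes p q :: "real poly"
  assumes "p ^ 2 dvd q" "poly p x = 0"
  shows "poly (pderiv q) x = 0"
proof -
  obtain r where "q = p ^ 2 * r" using assms(1) by (auto elim: dvdE)
  then show ?thesis using assms(2) by (simp add: pderiv_mult power2_eq_square)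
qed

text \<open>With \<open>y = x - 2\<close>, the degree factor \<open>y + 2k - 2\<close> is
  \<open>x - (4 - 2k)\<close>; this is the origin of the point of evaluation.\<close>

lemma root_factor:
  assumes "k \<ge> 1"
  shows "poly ([:-2, 1:] + of_nat (2 * k - 2)) (4 - 2 * real k) = 0"
  using assms by (simp add: of_nat_poly of_nat_diff)

text \<open>Removing the loop gives one factor, and another vertex \<open>u\<close>, whose degree is
  unaffected, gives the same factor again. On a single vertex the root is only simple.\<close>

lemma closed_martin_loop:
  assumes G: "even_regular k G" and v: "v \<in> verts G" "\<not> loopless_at G v" and card: "card (verts G) \<ge> 2"
  shows "closed_martin k G = 0"
proof -
  note P = even_regular_pregraph[OF G]
  have "verts G - {v} \<noteq> {}"
  proof
    assume "verts G - {v} = {}"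
    then have "card (verts G) \<le> card {v}" by (intro card_mono) auto
    then show False using card by simp
  qed
  then obtain u where u: "u \<in> verts G" "u \<noteq> v" by auto
  from P v(2) obtain a a' where a: "{a, a'} \<in> edges G" "att G a = v" "att G a' = v" by (rule loopE)
  let ?G = "remove_edge G {a, a'}" and ?f = "[:-2, 1:] + of_nat (2 * k - 2) :: real poly"
  have "halves_at ?G u = halves_at G u"
    unfolding halves_at_def halves_remove_edge[OF P a(1)] using a(2,3) u(2) by auto
  then have "card (halves_at ?G u) = 2 * k" using even_regular_card[OF G u(1)] by simp
  then have "?f dvd circuit_sum [:-2, 1:] ?G"
    using pregraph_remove_edge[OF P a(1)] even_regular_k[OF G] by (intro circuit_sum_dvd) auto
  moreover have "circuit_sum [:-2, 1:] G = ?f * circuit_sum [:-2, 1:] ?G"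
    using circuit_sum_loop[OF P a, of "[:-2, 1:] :: real poly"] even_regular_card[OF G v(1)] by simp
  ultimately have "?f ^ 2 dvd circuit_sum [:-2, 1:] G"
    by (simp only: power2_eq_square mult_dvd_mono dvd_refl)
  then show ?thesis
    using poly_pderiv_double_root root_factor[OF even_regular_k[OF G]] by (simp only: closed_martin_def mult_zero_right)
qed

text \<open>The bouquet factors other than the last, evaluated at \<open>y = -2m\<close> with
  \<open>m = k - 1\<close>.\<close>

lemma prod_evens: "(\<Prod>j<m. - 2 * real m + 2 * real j) = (- 2) ^ m * fact m"
proof -
  have "(\<Prod>j<m. - 2 * real m + 2 * real j) = (\<Prod>j<m. - 2 * (real (m - j)))"
    by (intro prod.cong) (auto simp: of_nat_diff)
  also have "\<dots> = (\<Prod>j<m. - 2) * (\<Prod>j<m. real (m - j))" by (rule prod.distrib)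
  also have "(\<Prod>j<m. - 2 :: real) = (- 2) ^ m" by simp
  also have "(\<Prod>j<m. real (m - j)) = fact m"
    by (simp add: fact_prod_rev atLeast0LessThan)
  finally show ?thesis .
qed

text \<open>Only the last factor vanishes at the point, so the derivative is the product of the
  others; its sign and factorial cancel against the normalisation.\<close>

lemma closed_martin_bouquet:
  assumes "even_regular k G" "card (verts G) = 1"
  shows "closed_martin k G = 2 ^ k / fact (2 * k)"
proof -
  note P = even_regular_pregraph[OF assms(1)]
  obtain v where v: "verts G = {v}" using assms(2) by (auto simp: card_1_singleton_iff)
  have at: "att G h = v" if "h \<in> halves G" for h using even_regular_att[OF assms(1) that] v by auto
  then have "halves_at G v = halves G" by (auto simp: halves_at_def)
  then have "card (halves G) = 2 * k" using even_regular_card[OF assms(1), of v] v by simp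
  obtain m where k: "k = Suc m" using even_regular_k[OF assms(1)] by (cases k) auto
  let ?A = "\<Prod>j<m. [:-2, 1::real:] + of_nat (2 * j)"
  have "circuit_sum [:-2, 1:] G = ?A * ([:-2, 1:] + of_nat (2 * m))"
    using circuit_sum_bouquet[OF P at \<open>card (halves G) = 2 * k\<close>, of "[:-2, 1::real:]"] k by simp
  also have "[:-2, 1:] + of_nat (2 * m) = [:2 * real m - 2, 1:]" by (simp add: of_nat_poly)
  finally have "circuit_sum [:-2, 1:] G = ?A * [:2 * real m - 2, 1:]" .
  then have "poly (pderiv (circuit_sum [:-2, 1:] G)) (2 - 2 * real m) =
      poly ?A (2 - 2 * real m) * poly (pderiv [:2 * real m - 2, 1:]) (2 - 2 * real m) +
      poly [:2 * real m - 2, 1:] (2 - 2 * real m) * poly (pderiv ?A) (2 - 2 * real m)"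
    by (simp only: pderiv_mult poly_add poly_mult)
  also have "\<dots> = poly ?A (2 - 2 * real m)" by (simp add: pderiv_pCons)
  also have "\<dots> = (\<Prod>j<m. - 2 * real m + 2 * real j)"
    by (simp add: poly_prod of_nat_poly)
  also have "\<dots> = (- 2) ^ m * fact m" by (rule prod_evens)
  finally have "closed_martin k G = 2 * (-1) ^ m * ((- 2) ^ m * fact m) / (fact m * fact (2 * k))"
    by (simp add: closed_martin_def k)
  also have "\<dots> = 2 * ((-1) * (- 2)) ^ m / fact (2 * k)" unfolding power_mult_distrib by simp
  finally show ?thesis by (simp add: k)
qed

text \<open>(2k)! separated into its odd and its even factors, the latter giving
  \<open>2 ^ k * fact k\<close>.\<close>

lemma prod_odds: "(\<Prod>j<k. 2 * real j + 1) * 2 ^ k * fact k = fact (2 * k)"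
proof (induction k)
  case (Suc k)
  have "(\<Prod>j<Suc k. 2 * real j + 1) * 2 ^ Suc k * fact (Suc k) =
      ((\<Prod>j<k. 2 * real j + 1) * 2 ^ k * fact k) * ((2 * real k + 1) * (2 * real k + 2))"
    by (simp add: algebra_simps)
  also have "\<dots> = fact (2 * Suc k)" unfolding Suc.IH by (simp add: algebra_simps)
  finally show ?case .
qed simp

text \<open>Each of the (2k-1)!! transitions at one vertex leaves a bouquet, always with the same
  value.\<close>

lemma closed_martin_two_vertices:
  assumes G: "even_regular k G" and card: "card (verts G) = 2" and loop: "\<not> has_loop G"
  shows "closed_martin k G = 1 / fact k"
proof -
  note P = even_regular_pregraph[OF G]
  obtain v where v: "v \<in> verts G" using even_regular_nonempty[OF G] by auto
  have l: "loopless_at G v" by (rule loopless_atI[OF P loop])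
  have "closed_martin k (resolve G v \<tau>) = 2 ^ k / fact (2 * k)" if "\<tau> \<in> transitions G v" for \<tau>
    using even_regular_resolve[OF G l _ that] card v even_regular_finite[OF G]
    by (intro closed_martin_bouquet) simp_all
  then have "closed_martin k G = card (transitions G v) * (2 ^ k / fact (2 * k))"
    unfolding closed_martin_resolve[OF P l] by simp
  also have "real (card (transitions G v)) = (\<Prod>j<k. 2 * real j + 1)"
    unfolding transitions_def
    using card_pairings[OF finite_halves_at[OF P] even_regular_card[OF G v]] by (simp add: add.commute)
  also have "\<dots> * (2 ^ k / fact (2 * k)) = 1 / fact k"
    using prod_odds[of k] by (simp add: field_simps)
  finally show ?thesis .
qed

section \<open>Three vertices and agreement with the recursion\<close>

lemma card_adjacent_sym:
  assumes "pregraph G"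
  shows "card {h \<in> halves_at G u. att G (mate G h) = v} = card {h \<in> halves_at G v. att G (mate G h) = u}"
proof (rule bij_betw_same_card[where f = "mate G"], rule bij_betw_byWitness[where f' = "mate G"])
  show "mate G ` {h \<in> halves_at G u. att G (mate G h) = v} \<subseteq> {h \<in> halves_at G v. att G (mate G h) = u}"
    using mate_halves[OF assms] mate_mate[OF assms] by (auto simp: halves_at_def)
  show "mate G ` {h \<in> halves_at G v. att G (mate G h) = u} \<subseteq> {h \<in> halves_at G u. att G (mate G h) = v}"
    using mate_halves[OF assms] mate_mate[OF assms] by (auto simp: halves_at_def)
qed (use mate_mate[OF assms] in \<open>auto simp: halves_at_def\<close>)

text \<open>Resolving \<open>v\<close> creates no loop exactly for the transitions that pair each
  half-edge towards \<open>u\<close> with one towards \<open>w\<close>. There are k! of them, each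
  worth 1/k!.\<close>

lemma closed_martin_three_vertices:
  assumes G: "even_regular k G" and card: "card (verts G) = 3" and loop: "\<not> has_loop G"
  shows "closed_martin k G = 1"
proof -
  note P = even_regular_pregraph[OF G]
  obtain u v w where V: "verts G = {u, v, w}" "u \<noteq> v" "u \<noteq> w" "v \<noteq> w"
    using card by (metis card_3_iff)
  define n where "n x y = card {h \<in> halves_at G x. att G (mate G h) = y}" for x y
  have n_sym: "n x y = n y x" for x y unfolding n_def by (rule card_adjacent_sym[OF P])
  have l: "loopless_at G x" for x by (rule loopless_atI[OF P loop])
  have split: "halves_at G x = {h \<in> halves_at G x. att G (mate G h) = y} \<union> {h \<in> halves_at G x. att G (mate G h) = z}"
    if "verts G = {x, y, z}" for x y z
  proof -
    have "att G (mate G h) \<in> {y, z}" if h: "h \<in> halves_at G x" for h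
    proof -
      have "mate G h \<in> halves G" using mate_halves[OF P] h halves_at_subset by fast
      then have "att G (mate G h) \<in> {x, y, z}" using even_regular_att[OF G] \<open>verts G = {x, y, z}\<close> by auto
      moreover have "att G (mate G h) \<noteq> x" using l[of x] h by (simp add: loopless_at_def)
      ultimately show ?thesis by auto
    qed
    then show ?thesis by auto
  qed
  have n_sum: "n x y + n x z = 2 * k" if "verts G = {x, y, z}" "y \<noteq> z" for x y z
  proof -
    have "n x y + n x z = card ({h \<in> halves_at G x. att G (mate G h) = y} \<union> {h \<in> halves_at G x. att G (mate G h) = z})"
      unfolding n_def using finite_halves_at[OF P] that(2) by (intro card_Un_disjoint[symmetric]) auto
    also have "\<dots> = card (halves_at G x)" using split[OF that(1)] by simp
    finally show ?thesis using even_regular_card[OF G] that(1) by simp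
  qed
  \<comment> \<open>The three degree equations force exactly \<open>k\<close> edges between any two
    of the vertices.\<close>
  have "n u v + n u w = 2 * k" "n v u + n v w = 2 * k" "n w u + n w v = 2 * k"
    using V by (intro n_sum; auto)+
  then have n: "n v u = k" "n v w = k" using n_sym[of u v] n_sym[of u w] n_sym[of v w] by simp_all
  let ?A = "{h \<in> halves_at G v. att G (mate G h) = u}" and ?B = "{h \<in> halves_at G v. att G (mate G h) = w}"
  have AB: "halves_at G v = ?A \<union> ?B" using V by (intro split) auto
  have fin: "finite (transitions G v)"
    unfolding transitions_def by (rule finite_pairings[OF finite_halves_at[OF P]])
  have val: "closed_martin k (resolve G v \<tau>) = (if \<forall>p\<in>\<tau>. \<not> p \<subseteq> ?A \<and> \<not> p \<subseteq> ?B then 1 / fact k else 0)"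
    if \<tau>: "\<tau> \<in> transitions G v" for \<tau>
  proof -
    have R: "even_regular k (resolve G v \<tau>)" using card by (intro even_regular_resolve[OF G l _ \<tau>]) simp
    have C: "card (verts (resolve G v \<tau>)) = 2" using V card by auto
    have \<tau>P: "\<tau> \<in> pairings (halves_at G v)" using \<tau> by (simp add: transitions_def)
    \<comment> \<open>The old edges are not loops, and a merged edge is one exactly if the far ends
      of its pair coincide.\<close>
    have loop_iff: "has_loop (resolve G v \<tau>) \<longleftrightarrow> (\<exists>p\<in>\<tau>. p \<subseteq> ?A \<or> p \<subseteq> ?B)"
    proof
      assume "has_loop (resolve G v \<tau>)"
      then obtain e where e: "e \<in> edges (resolve G v \<tau>)" "\<forall>h\<in>e. \<forall>h'\<in>e. att G h = att G h'"
        by (auto simp: has_loop_def)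
      then have "e \<notin> edges G" using loop unfolding has_loop_def by metis
      then obtain p where p: "p \<in> \<tau>" "e = mate G ` p" using e(1) by (auto simp: resolve_def)
      have "p \<subseteq> ?A \<union> ?B" using pairings_Union[OF \<tau>P] p(1) AB by blast
      moreover have "\<forall>h\<in>p. \<forall>h'\<in>p. att G (mate G h) = att G (mate G h')" using e(2) p(2) by blast
      ultimately have "p \<subseteq> ?A \<or> p \<subseteq> ?B" by blast
      then show "\<exists>p\<in>\<tau>. p \<subseteq> ?A \<or> p \<subseteq> ?B" using p(1) by auto
    next
      assume "\<exists>p\<in>\<tau>. p \<subseteq> ?A \<or> p \<subseteq> ?B"
      then obtain p where p: "p \<in> \<tau>" "p \<subseteq> ?A \<or> p \<subseteq> ?B" by auto
      then have const: "\<forall>h\<in>mate G ` p. \<forall>h'\<in>mate G ` p. att (resolve G v \<tau>) h = att (resolve G v \<tau>) h'" by auto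
      have "mate G ` p \<in> edges (resolve G v \<tau>)" using p(1) by (simp add: resolve_def)
      with const show "has_loop (resolve G v \<tau>)" unfolding has_loop_def by (rule bexI)
    qed
    show ?thesis
    proof (cases "has_loop (resolve G v \<tau>)")
      case True
      from R this obtain x where "x \<in> verts (resolve G v \<tau>)" "\<not> loopless_at (resolve G v \<tau>) x" by (rule has_loopE)
      then have "closed_martin k (resolve G v \<tau>) = 0" using closed_martin_loop[OF R] C by simp
      then show ?thesis using True loop_iff by auto
    next
      case False
      then show ?thesis using closed_martin_two_vertices[OF R C] loop_iff by auto
    qed
  qed
  have "closed_martin k G = (\<Sum>\<tau>\<in>transitions G v. if \<forall>p\<in>\<tau>. \<not> p \<subseteq> ?A \<and> \<not> p \<subseteq> ?B then 1 / fact k else 0)"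
    unfolding closed_martin_resolve[OF P l[of v]] by (rule sum.cong[OF refl val])
  also have "\<dots> = real (card {\<tau> \<in> transitions G v. \<forall>p\<in>\<tau>. \<not> p \<subseteq> ?A \<and> \<not> p \<subseteq> ?B}) * (1 / fact k)"
    using fin by (simp flip: sum.inter_filter)
  also have "{\<tau> \<in> transitions G v. \<forall>p\<in>\<tau>. \<not> p \<subseteq> ?A \<and> \<not> p \<subseteq> ?B} =
      {\<tau> \<in> pairings (?A \<union> ?B). \<forall>p\<in>\<tau>. \<not> p \<subseteq> ?A \<and> \<not> p \<subseteq> ?B}"
    unfolding transitions_def using AB by simp
  also have "card \<dots> = fact k"
    using finite_halves_at[OF P] n V by (intro card_cross_pairings) (auto simp: n_def)
  finally show ?thesis by simp
qed

text \<open>\<open>closed_martin\<close> expands at every loopless vertex, in particular at the one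
  picked by \<open>SOME\<close>. From four vertices on, each resolution still has at least
  three.\<close>

lemma martin_rec_eq_closed_martin:
  assumes "even_regular k G" "card (verts G) \<ge> 3"
  shows "real (martin_rec G) = closed_martin k G"
  using assms
proof (induction "card (verts G)" arbitrary: G rule: less_induct)
  case less
  note G = less.prems(1) and P = even_regular_pregraph[OF less.prems(1)]
  show ?case
  proof (cases "has_loop G")
    case True
    from G True obtain v where "v \<in> verts G" "\<not> loopless_at G v" by (rule has_loopE)
    then show ?thesis using closed_martin_loop[OF G] less.prems(2) True by (simp add: martin_rec.simps[of G])
  next
    case False
    show ?thesis
    proof (cases "card (verts G) = 3")
      case True
      then show ?thesis using False closed_martin_three_vertices[OF G] by (simp add: martin_rec.simps[of G])
    next
      case card: False
      define v where "v = (SOME v. v \<in> verts G)"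
      have v: "v \<in> verts G" unfolding v_def using even_regular_nonempty[OF G] by (simp add: some_in_eq)
      have l: "loopless_at G v" by (rule loopless_atI[OF P False])
      have "martin_rec G = (\<Sum>\<tau>\<in>transitions G v. martin_rec (resolve G v \<tau>))"
        using False card less.prems(2) by (simp add: martin_rec.simps[of G] v_def Let_def)
      then have "real (martin_rec G) = (\<Sum>\<tau>\<in>transitions G v. real (martin_rec (resolve G v \<tau>)))" by simp
      also have "\<dots> = (\<Sum>\<tau>\<in>transitions G v. closed_martin k (resolve G v \<tau>))"
        using v card less.prems(2) even_regular_finite[OF G]
        by (intro sum.cong refl less.hyps even_regular_resolve[OF G l]) (auto simp: card_Diff_singleton)
      finally show ?thesis by (simp add: closed_martin_resolve[OF P l])
    qed
  qed
qed

lemma martin_eq_closed_martin: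
  assumes G: "even_regular k G"
  shows "martin k G = closed_martin k G"
proof (cases "card (verts G) \<ge> 3")
  case True
  then show ?thesis using martin_rec_eq_closed_martin[OF G] by (simp add: martin_def)
next
  case False
  note P = even_regular_pregraph[OF G]
  obtain v where v: "v \<in> verts G" using even_regular_nonempty[OF G] by auto
  have "halves_at G v \<noteq> {}" using even_regular_card[OF G v] even_regular_k[OF G] by auto
  then have ne: "edges G \<noteq> {}" by (auto simp: halves_at_def halves_def)
  have Z: "circuit_sum [:-2, 1:] G = [:-2, 1:] * martin_poly G"
    using G ne by (intro circuit_sum_martin_poly) (auto simp: even_regular_def)
  let ?x = "4 - 2 * real k" and ?m = "martin_poly G"
  have D: "poly (pderiv (circuit_sum [:-2, 1:] G)) ?x = (2 - 2 * real k) * poly (pderiv ?m) ?x + poly ?m ?x"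
    unfolding Z pderiv_mult by (simp add: pderiv_pCons algebra_simps)
  show ?thesis
  proof (cases "k \<ge> 2")
    case True
    \<comment> \<open>The circuit sum vanishes at \<open>4 - 2k\<close> while \<open>x - 2\<close>
      does not, so \<open>m\<close> vanishes there and only \<open>(2 - 2k) m'\<close> survives. The
      factor \<open>2 - 2k\<close> turns (k-1)! into (k-2)!.\<close>
    have "([:-2, 1:] + of_nat (2 * k - 2)) dvd circuit_sum [:-2, 1::real:] G"
      using even_regular_card[OF G v] True by (intro circuit_sum_dvd[OF P]) auto
    then obtain r where "circuit_sum [:-2, 1::real:] G = ([:-2, 1:] + of_nat (2 * k - 2)) * r" by (auto elim: dvdE)
    then have "poly (circuit_sum [:-2, 1:] G) ?x = 0" using root_factor[of k] True by simp
    then have m0: "poly ?m ?x = 0" using True by (simp add: Z)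
    obtain j where k: "k = Suc (Suc j)" using True by (metis Suc_le_D numeral_2_eq_2 Suc_le_mono)
    have "closed_martin k G = 2 * (-1) ^ (k + 1) / (fact (k - 1) * fact (2 * k)) * (2 - 2 * real k) * poly (pderiv ?m) ?x"
      unfolding closed_martin_def D m0 by simp
    also have "2 * (-1) ^ (k + 1) / (fact (k - 1) * fact (2 * k)) * (2 - 2 * real k) = 4 * (-1) ^ k / (fact (k - 2) * fact (2 * k))"
      unfolding k by (simp add: field_simps del: fact_Suc) (simp add: field_simps)
    finally show ?thesis using False True by (simp add: martin_def)
  next
    case k: False
    \<comment> \<open>Now the term with \<open>m'\<close> has coefficient \<open>2 - 2k = 0\<close>
      instead, the normalising constant is 1, and \<open>m(2)\<close> remains.\<close>
    then have "k = 1" using even_regular_k[OF G] by simp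
    then show ?thesis using False D by (simp add: martin_def closed_martin_def numeral_2_eq_2)
  qed
qed

subsection \<open>Edge cuts\<close>

text \<open>One-sided form of \<open>edges_between\<close>: a set \<open>Z\<close> that avoids
  \<open>v\<close> keeps its meaning in every resolution at \<open>v\<close>.\<close>

definition cut_edges :: "('v, 'h) mgraph \<Rightarrow> 'v set \<Rightarrow> 'h set set" where
  "cut_edges G Z = {e \<in> edges G. (\<exists>h\<in>e. att G h \<in> Z) \<and> (\<exists>h\<in>e. att G h \<notin> Z)}"

lemma
  assumes "even_regular k G" "bipartition G X Y"
  shows edges_between_left: "edges_between G X Y = cut_edges G X"
    and edges_between_right: "edges_between G X Y = cut_edges G Y"
proof -
  have "att G h \<in> X \<longleftrightarrow> att G h \<notin> Y" if "e \<in> edges G" "h \<in> e" for e h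
  proof -
    have "h \<in> halves G" using that by (auto simp: halves_def)
    then have "att G h \<in> X \<union> Y" using even_regular_att[OF assms(1)] assms(2) by (auto simp: bipartition_def)
    then show ?thesis using assms(2) by (auto simp: bipartition_def)
  qed
  then show "edges_between G X Y = cut_edges G X" "edges_between G X Y = cut_edges G Y"
    unfolding edges_between_def cut_edges_def by blast+
qed

text \<open>Degree sum over \<open>Z\<close>: cut edges count once, inner edges twice. Hence every
  cut is even, and for a single vertex the defect from \<open>2k\<close> is twice its number of
  loops.\<close>

lemma card_cut_edges:
  assumes G: "even_regular k G" and Z: "Z \<subseteq> verts G"
  shows "card (cut_edges G Z) + 2 * card {e \<in> edges G. \<forall>h\<in>e. att G h \<in> Z} = 2 * k * card Z"
proof -
  note P = even_regular_pregraph[OF G]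
  have "card (\<Union>v\<in>Z. halves_at G v) = (\<Sum>v\<in>Z. card (halves_at G v))"
    using finite_subset[OF Z even_regular_finite[OF G]] finite_halves_at[OF P]
    by (intro card_UN_disjoint) (auto simp: halves_at_def)
  also have "\<dots> = (\<Sum>v\<in>Z. 2 * k)"
    by (rule sum.cong[OF refl]) (rule even_regular_card[OF G], use Z in auto)
  also have "(\<Union>v\<in>Z. halves_at G v) = {h \<in> halves G. att G h \<in> Z}" by (auto simp: halves_at_def)
  finally show ?thesis
    using card_pairing_split[of "edges G" "halves G" "\<lambda>h. att G h \<in> Z"] P finite_halves[OF P]
    by (simp add: pregraph_def cut_edges_def mult.commute)
qed

lemma loopless_at_iff:
  assumes "pregraph G"
  shows "loopless_at G v \<longleftrightarrow> {e \<in> edges G. \<forall>h\<in>e. att G h \<in> {v}} = {}"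
proof
  assume l: "loopless_at G v"
  show "{e \<in> edges G. \<forall>h\<in>e. att G h \<in> {v}} = {}"
  proof (rule ccontr)
    assume "\<not> ?thesis"
    then obtain e where e: "e \<in> edges G" "\<forall>h\<in>e. att G h = v" by auto
    obtain h where h: "h \<in> halves G" "e = {h, mate G h}" using edgeE[OF assms e(1)] .
    then have "h \<in> halves_at G v" "att G (mate G h) = v" using e(2) by (auto simp: halves_at_def)
    then show False using l by (auto simp: loopless_at_def)
  qed
next
  assume none: "{e \<in> edges G. \<forall>h\<in>e. att G h \<in> {v}} = {}"
  show "loopless_at G v"
  proof (rule ccontr)
    assume "\<not> loopless_at G v"
    with assms obtain a a' where "{a, a'} \<in> edges G" "att G a = v" "att G a' = v" by (rule loopE)
    then have "{a, a'} \<in> {e \<in> edges G. \<forall>h\<in>e. att G h \<in> {v}}" by simp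
    then show False using none by blast
  qed
qed

lemma card_cut_vertex:
  assumes G: "even_regular k G" and v: "v \<in> verts G"
  shows "loopless_at G v \<longleftrightarrow> card (cut_edges G {v}) = 2 * k"
    and "\<not> loopless_at G v \<Longrightarrow> card (cut_edges G {v}) < 2 * k"
proof -
  define n where "n = card {e \<in> edges G. \<forall>h\<in>e. att G h \<in> {v}}"
  have "finite {e \<in> edges G. \<forall>h\<in>e. att G h \<in> {v}}"
    using even_regular_pregraph[OF G] by (simp add: pregraph_def)
  then have l: "loopless_at G v \<longleftrightarrow> n = 0"
    unfolding loopless_at_iff[OF even_regular_pregraph[OF G]] n_def by (rule card_0_eq[symmetric])
  have "card (cut_edges G {v}) + 2 * n = 2 * k"
    using card_cut_edges[OF G, of "{v}"] v unfolding n_def by simp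
  then show "loopless_at G v \<longleftrightarrow> card (cut_edges G {v}) = 2 * k"
    and "\<not> loopless_at G v \<Longrightarrow> card (cut_edges G {v}) < 2 * k"
    unfolding l by arith+
qed

text \<open>The cut edges that no resolution at \<open>v\<close> changes; as a function of
  \<open>Z\<close> this is the \<open>d\<close> of \<open>splitting_off\<close>.\<close>

definition cut_avoiding :: "('v, 'h) mgraph \<Rightarrow> 'v \<Rightarrow> 'v set \<Rightarrow> 'h set set" where
  "cut_avoiding G v Z = {e \<in> cut_edges G Z. \<forall>h\<in>e. att G h \<noteq> v}"

lemma finite_cut_avoiding: "pregraph G \<Longrightarrow> finite (cut_avoiding G v Z)"
  by (simp add: cut_avoiding_def cut_edges_def pregraph_def)

lemma card_cut_edges_avoiding:
  assumes P: "pregraph G" and l: "loopless_at G v" and v: "v \<notin> Z"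
  shows "card (cut_edges G Z) = card (cut_avoiding G v Z) + card {h \<in> halves_at G v. att G (mate G h) \<in> Z}"
proof -
  let ?K = "{h \<in> halves_at G v. att G (mate G h) \<in> Z}" and ?f = "\<lambda>h. {h, mate G h}"
  have "cut_edges G Z = cut_avoiding G v Z \<union> ?f ` ?K"
  proof (intro equalityI subsetI)
    fix e assume e: "e \<in> cut_edges G Z"
    show "e \<in> cut_avoiding G v Z \<union> ?f ` ?K"
    proof (cases "\<forall>h\<in>e. att G h \<noteq> v")
      case False
      then obtain h where h: "h \<in> e" "att G h = v" by auto
      have eG: "e \<in> edges G" using e by (simp add: cut_edges_def)
      then have hH: "h \<in> halves G" using h by (auto simp: halves_def)
      have "e = {h, mate G h}" by (rule edge_mate[OF P hH eG h(1)])
      then have "h \<in> ?K" using e h hH v by (auto simp: cut_edges_def halves_at_def)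
      then show ?thesis using \<open>e = {h, mate G h}\<close> by blast
    qed (use e in \<open>simp add: cut_avoiding_def\<close>)
  next
    fix e assume "e \<in> cut_avoiding G v Z \<union> ?f ` ?K"
    then show "e \<in> cut_edges G Z"
    proof
      assume "e \<in> ?f ` ?K"
      then obtain h where h: "h \<in> halves_at G v" "att G (mate G h) \<in> Z" "e = {h, mate G h}" by auto
      then have "e \<in> edges G" using mate_edge[OF P] halves_at_subset by fast
      then show ?thesis using h v by (auto simp: cut_edges_def halves_at_def)
    qed (simp add: cut_avoiding_def)
  qed
  moreover have "cut_avoiding G v Z \<inter> ?f ` ?K = {}"
    by (auto simp: cut_avoiding_def halves_at_def)
  moreover have "finite (cut_avoiding G v Z)" "finite ?K"
    using finite_cut_avoiding[OF P] finite_halves_at[OF P] by simp_all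
  moreover have "inj_on ?f ?K"
  proof (rule inj_onI)
    fix h g assume "h \<in> ?K" "g \<in> ?K" "?f h = ?f g"
    then show "h = g" using l by (auto simp: doubleton_eq_iff loopless_at_def halves_at_def)
  qed
  ultimately show ?thesis by (simp add: card_Un_disjoint card_image)
qed

section \<open>Cuts under a resolution\<close>

context resolution
begin

lemma card_cut_edges_resolve:
  assumes "v \<notin> Z"
  shows "card (cut_edges (resolve G v \<tau>) Z) = card (cut_avoiding G v Z) +
    card {p \<in> \<tau>. (\<exists>h\<in>p. att G (mate G h) \<in> Z) \<and> (\<exists>h\<in>p. att G (mate G h) \<notin> Z)}"
proof -
  let ?K = "{p \<in> \<tau>. (\<exists>h\<in>p. att G (mate G h) \<in> Z) \<and> (\<exists>h\<in>p. att G (mate G h) \<notin> Z)}"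
  have "cut_edges (resolve G v \<tau>) Z = cut_avoiding G v Z \<union> (`) (mate G) ` ?K"
    unfolding cut_edges_def cut_avoiding_def resolve_def mgraph.simps by blast
  moreover have "cut_avoiding G v Z \<inter> (`) (mate G) ` ?K = {}"
  proof -
    \<comment> \<open>A merged edge contains \<open>mate G h\<close>; were it an edge of
      \<open>G\<close>, it would also contain \<open>h\<close>, which sits at
      \<open>v\<close>.\<close>
    have False if e: "mate G ` p \<in> cut_avoiding G v Z" and p: "p \<in> \<tau>" for p
    proof -
      obtain h where h: "h \<in> halves_at G v" "p = {h, partner \<tau> h}" using pairings_memberE[OF \<tau> p] .
      have "mate G ` p \<in> edges G" "mate G h \<in> mate G ` p"
        using e h by (auto simp: cut_avoiding_def cut_edges_def)
      then have "mate G ` p = {mate G h, mate G (mate G h)}"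
        using mate_in[OF h(1)] by (intro edge_mate[OF G]) auto
      moreover have "mate G (mate G h) = h" using mate_mate[OF G] h(1) halves_at_subset by fast
      ultimately have "h \<in> mate G ` p" by simp
      then show False using e h(1) by (auto simp: cut_avoiding_def halves_at_def)
    qed
    then show ?thesis by auto
  qed
  moreover have "finite (cut_avoiding G v Z)" "finite ?K"
    using finite_cut_avoiding[OF G] finite_pairing[OF \<tau> finite_halves_at[OF G]] by simp_all
  moreover have "inj_on ((`) (mate G)) ?K"
  proof (rule inj_on_subset[OF inj_on_image_Pow[OF inj_on_mate[OF G]]])
    have "p \<subseteq> halves G" if "p \<in> \<tau>" for p
      using Union_upper[OF that] halves_at_subset[of G v] unfolding pairings_Union[OF \<tau>] by (rule subset_trans)
    then show "?K \<subseteq> Pow (halves G)" by blast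
  qed
  ultimately show ?thesis by (simp add: card_Un_disjoint card_image)
qed

text \<open>Two cut edges disappear for each pair whose far ends both lie in \<open>Z\<close>, as
  their merged edge stays inside \<open>Z\<close>. Cuts therefore never grow.\<close>

lemma card_cut_edges_eq_resolve:
  assumes "v \<notin> Z"
  shows "card (cut_edges G Z) = card (cut_edges (resolve G v \<tau>) Z) + 2 * card {p \<in> \<tau>. \<forall>h\<in>p. att G (mate G h) \<in> Z}"
  using card_cut_edges_avoiding[OF G v assms] card_cut_edges_resolve[OF assms]
    card_pairing_split[OF \<tau> finite_halves_at[OF G], of "\<lambda>h. att G (mate G h) \<in> Z"] by simp

end

section \<open>Vanishing and positivity\<close>

lemma bipartition_cut_edges:
  assumes "even_regular k G" "bipartition G X Y"
  shows "cut_edges G X = cut_edges G Y"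
  using edges_between_left[OF assms] edges_between_right[OF assms] by simp

lemma bipartition_card:
  assumes "even_regular k G" "bipartition G X Y"
  shows "finite X" "finite Y" "card (verts G) = card X + card Y" "card X \<ge> 1" "card Y \<ge> 1"
proof -
  show fin: "finite X" "finite Y"
    using assms(2) even_regular_finite[OF assms(1)] by (auto simp: bipartition_def intro: finite_subset)
  show "card (verts G) = card X + card Y" "card X \<ge> 1" "card Y \<ge> 1"
    using assms(2) fin card_Un_disjoint[of X Y] by (auto simp: bipartition_def Suc_le_eq card_gt_0_iff)
qed

lemma closed_martin_small_cut:
  assumes "even_regular k G" "bipartition G X Y" "card (cut_edges G X) < 2 * k"
  shows "closed_martin k G = 0"
  using assms
proof (induction "card X" arbitrary: G X rule: less_induct)
  case less
  note G = less.prems(1) and B = less.prems(2) and P = even_regular_pregraph[OF less.prems(1)]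
  obtain v where vX: "v \<in> X" using B by (auto simp: bipartition_def)
  have vG: "v \<in> verts G" "v \<notin> Y" using vX B by (auto simp: bipartition_def)
  have two: "card (verts G) \<ge> 2" using bipartition_card[OF G B] by simp
  show ?case
  proof (cases "loopless_at G v")
    case False
    then show ?thesis using closed_martin_loop[OF G vG(1)] two by simp
  next
    case l: True
    \<comment> \<open>The cut around a loopless vertex has exactly \<open>2k\<close> edges, so the
      small cut excludes a single vertex on this side.\<close>
    have "X \<noteq> {v}" using card_cut_vertex(1)[OF G vG(1)] l less.prems(3) by auto
    have "closed_martin k (resolve G v \<tau>) = 0" if t: "\<tau> \<in> transitions G v" for \<tau>
    proof -
      interpret resolution G v \<tau> using P l t by unfold_locales (simp_all add: transitions_def)
      have R: "even_regular k (resolve G v \<tau>)" by (rule even_regular_resolve[OF less.prems(1) l two t])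
      have B': "bipartition (resolve G v \<tau>) (X - {v}) Y"
        using B vX \<open>X \<noteq> {v}\<close> by (auto simp: bipartition_def)
      \<comment> \<open>\<open>v\<close> lies outside \<open>Y\<close>, so the cuts are compared at
        \<open>Y\<close> and the bound then passes to the complement.\<close>
      have "card (cut_edges (resolve G v \<tau>) (X - {v})) < 2 * k"
        using card_cut_edges_eq_resolve[OF vG(2)] bipartition_cut_edges[OF R B']
          bipartition_cut_edges[OF less.prems(1) B] less.prems(3) by simp
      moreover have "card (X - {v}) < card X"
        using bipartition_card[OF less.prems(1) B] vX by (intro psubset_card_mono) auto
      ultimately show ?thesis using less.hyps R B' by blast
    qed
    then show ?thesis by (simp add: closed_martin_resolve[OF P l])
  qed
qed

text \<open>By expansion every value is a sum of zeros from loops and of positive bouquet values.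
  With this, a single positive summand makes a sum over transitions positive.\<close>

lemma closed_martin_nonneg:
  assumes "even_regular k G"
  shows "closed_martin k G \<ge> 0"
  using assms
proof (induction "card (verts G)" arbitrary: G rule: less_induct)
  case less
  note G = less.prems and P = even_regular_pregraph[OF less.prems]
  obtain v where v: "v \<in> verts G" using even_regular_nonempty[OF G] by auto
  have pos: "card (verts G) > 0" using v even_regular_finite[OF G] by (auto simp: card_gt_0_iff)
  show ?case
  proof (cases "card (verts G) = 1")
    case True
    then show ?thesis using closed_martin_bouquet[OF G] by simp
  next
    case False
    then have two: "card (verts G) \<ge> 2" using pos by simp
    show ?thesis
    proof (cases "loopless_at G v")
      case l: True
      show ?thesis
        unfolding closed_martin_resolve[OF P l]
        using v pos by (intro sum_nonneg less.hyps even_regular_resolve[OF G l two]) (simp_all add: card_Diff_singleton)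
    qed (use closed_martin_loop[OF G v _ two] in simp)
  qed
qed

lemma cut_avoiding_submodular:
  assumes P: "pregraph G"
  shows "card (cut_avoiding G v (X \<inter> Y)) + card (cut_avoiding G v (X \<union> Y)) \<le>
    card (cut_avoiding G v X) + card (cut_avoiding G v Y)"
proof -
  let ?E = "{e \<in> edges G. \<forall>h\<in>e. att G h \<noteq> v}"
  define c :: "_ \<Rightarrow> _ \<Rightarrow> nat" where "c Z e = (if (\<exists>h\<in>e. att G h \<in> Z) \<and> (\<exists>h\<in>e. att G h \<notin> Z) then 1 else 0)" for Z e
  have fin: "finite ?E" using P by (simp add: pregraph_def)
  have eq: "card (cut_avoiding G v Z) = (\<Sum>e\<in>?E. c Z e)" for Z
  proof -
    have "cut_avoiding G v Z = {e \<in> ?E. (\<exists>h\<in>e. att G h \<in> Z) \<and> (\<exists>h\<in>e. att G h \<notin> Z)}"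
      by (auto simp: cut_avoiding_def cut_edges_def)
    then show ?thesis unfolding c_def using fin by (simp flip: sum.inter_filter)
  qed
  have "c (X \<inter> Y) e + c (X \<union> Y) e \<le> c X e + c Y e" if "e \<in> ?E" for e
  proof -
    have "e \<in> edges G" using that by simp
    with P obtain h where "e = {h, mate G h}" by (rule edgeE)
    then show ?thesis by (auto simp: c_def)
  qed
  then show ?thesis unfolding eq sum.distrib[symmetric] by (rule sum_mono)
qed

text \<open>At each vertex one transition that preserves the cut condition suffices, and
  \<open>splitting_off\<close> provides it. A single vertex has no proper cut and a positive
  value.\<close>

lemma closed_martin_pos:
  assumes "even_regular k G"
    and "\<And>Z. Z \<subseteq> verts G \<Longrightarrow> Z \<noteq> {} \<Longrightarrow> Z \<noteq> verts G \<Longrightarrow> 2 * k \<le> card (cut_edges G Z)"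
  shows "closed_martin k G > 0"
  using assms
proof (induction "card (verts G)" arbitrary: G rule: less_induct)
  case less
  note G = less.prems(1) and P = even_regular_pregraph[OF less.prems(1)]
  obtain v where v: "v \<in> verts G" using even_regular_nonempty[OF G] by auto
  have pos: "card (verts G) > 0" using v even_regular_finite[OF G] by (auto simp: card_gt_0_iff)
  show ?case
  proof (cases "card (verts G) = 1")
    case True
    then show ?thesis using closed_martin_bouquet[OF G] by simp
  next
    case False
    then have two: "card (verts G) \<ge> 2" using pos by simp
    then have "verts G \<noteq> {v}" by auto
    \<comment> \<open>The cut around \<open>v\<close> alone has at least \<open>2k\<close> edges by
      hypothesis, which rules out loops at \<open>v\<close>.\<close>
    then have l: "loopless_at G v"
      using card_cut_vertex(2)[OF G v] less.prems(2)[of "{v}"] v by fastforce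
    let ?W = "verts G - {v}" and ?H = "halves_at G v"
    let ?f = "\<lambda>h. att G (mate G h)" and ?d = "\<lambda>Z. card (cut_avoiding G v Z)"
    have cut: "card (cut_edges G Z) = ?d Z + card {h \<in> ?H. ?f h \<in> Z}" if "Z \<subseteq> ?W" for Z
      using that by (intro card_cut_edges_avoiding[OF P l]) auto
    have "\<exists>\<tau>\<in>pairings ?H. \<forall>Z. Z \<subseteq> ?W \<and> Z \<noteq> {} \<and> Z \<noteq> ?W \<longrightarrow>
      2 * k \<le> ?d Z + card {p \<in> \<tau>. (\<exists>h\<in>p. ?f h \<in> Z) \<and> (\<exists>h\<in>p. ?f h \<notin> Z)}"
    proof (rule splitting_off)
      show "?f ` ?H \<subseteq> ?W"
        using l mate_halves[OF P] even_regular_att[OF G] by (auto simp: loopless_at_def halves_at_def)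
      \<comment> \<open>Complements are taken without \<open>v\<close>; an edge avoiding
        \<open>v\<close> has both ends in \<open>?W\<close>, so it crosses \<open>Z\<close> exactly
        if it crosses \<open>?W - Z\<close>.\<close>
      show "?d (?W - Z) = ?d Z" if "Z \<subseteq> ?W" for Z
      proof -
        have "att G h \<in> ?W" if "e \<in> edges G" "\<forall>h\<in>e. att G h \<noteq> v" "h \<in> e" for e h
          using that even_regular_att[OF G, of h] by (auto simp: halves_def)
        then have "cut_avoiding G v (?W - Z) = cut_avoiding G v Z"
          unfolding cut_avoiding_def cut_edges_def using \<open>Z \<subseteq> ?W\<close> by blast
        then show ?thesis by simp
      qed
      show "?d (X \<inter> Y) + ?d (X \<union> Y) \<le> ?d X + ?d Y" for X Y
        by (rule cut_avoiding_submodular[OF P])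
      show "even (?d Z + card {h \<in> ?H. ?f h \<in> Z})" if "Z \<subseteq> ?W" for Z
      proof -
        have "Z \<subseteq> verts G" using that by auto
        then have "even (card (cut_edges G Z) + 2 * card {e \<in> edges G. \<forall>h\<in>e. att G h \<in> Z})"
          unfolding card_cut_edges[OF G \<open>Z \<subseteq> verts G\<close>] by simp
        then have "even (card (cut_edges G Z))" by simp
        then show ?thesis using cut[OF that] by simp
      qed
      show "2 * k \<le> ?d Z + card {h \<in> ?H. ?f h \<in> Z}" if "Z \<subseteq> ?W" "Z \<noteq> {}" "Z \<noteq> ?W" for Z
      proof -
        have "Z \<subseteq> verts G" "Z \<noteq> verts G" using that(1) v by auto
        then show ?thesis using less.prems(2)[of Z] that(2) unfolding cut[OF that(1)] by simp
      qed
    qed (use finite_halves_at[OF P] even_regular_finite[OF G] in auto)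
    then obtain \<tau> where t: "\<tau> \<in> transitions G v" and ge: "\<And>Z. Z \<subseteq> ?W \<Longrightarrow> Z \<noteq> {} \<Longrightarrow> Z \<noteq> ?W \<Longrightarrow>
        2 * k \<le> ?d Z + card {p \<in> \<tau>. (\<exists>h\<in>p. ?f h \<in> Z) \<and> (\<exists>h\<in>p. ?f h \<notin> Z)}"
      unfolding transitions_def by blast
    interpret resolution G v \<tau> using P l t by unfold_locales (simp_all add: transitions_def)
    have "closed_martin k (resolve G v \<tau>) > 0"
    proof (rule less.hyps)
      show "card (verts (resolve G v \<tau>)) < card (verts G)"
        using two \<open>v \<in> verts G\<close> by (simp add: card_Diff_singleton)
      show "even_regular k (resolve G v \<tau>)" by (rule even_regular_resolve[OF less.prems(1) l two t])
      show "2 * k \<le> card (cut_edges (resolve G v \<tau>) Z)"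
        if "Z \<subseteq> verts (resolve G v \<tau>)" "Z \<noteq> {}" "Z \<noteq> verts (resolve G v \<tau>)" for Z
      proof -
        have "v \<notin> Z" "Z \<subseteq> ?W" "Z \<noteq> ?W" using that by auto
        then show ?thesis using ge[of Z] that(2) by (simp add: card_cut_edges_resolve)
      qed
    qed
    moreover have "finite (transitions G v)"
      unfolding transitions_def by (rule finite_pairings[OF finite_halves_at[OF P]])
    ultimately have "(\<Sum>\<tau>\<in>transitions G v. closed_martin k (resolve G v \<tau>)) > 0"
      using t by (intro sum_pos2[where i = \<tau>] closed_martin_nonneg even_regular_resolve[OF less.prems(1) l two])
    then show ?thesis by (simp only: closed_martin_resolve[OF P l])
  qed
qed

subsection \<open>Contraction along a cut\<close>

lemma contract_outside_simps [simp]: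
  "verts (contract_outside G X y) = insert y X"
  "edges (contract_outside G X y) = {e \<in> edges G. \<exists>h\<in>e. att G h \<in> X}"
  "att (contract_outside G X y) = (\<lambda>h. if att G h \<in> X then att G h else y)"
  by (simp_all add: contract_outside_def)

lemma mate_subgraph:
  assumes "pregraph G" "pregraph G'" "edges G' \<subseteq> edges G" "h \<in> halves G'"
  shows "mate G' h = mate G h"
  using mate_edge[OF assms(2,4)] assms(1,3)
    partner_eqI[of "edges G" "halves G" h "mate G' h"] by (auto simp: mate_eq_partner pregraph_def)

lemma pregraph_contract:
  assumes "pregraph G"
  shows "pregraph (contract_outside G X y)"
proof -
  have "edges (contract_outside G X y) \<subseteq> edges G" by auto
  then show ?thesis
    using pairings_subset[of "edges G" "halves G"] assms finite_subset
    unfolding pregraph_def halves_def by blast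
qed

lemma halves_contract_iff:
  assumes "pregraph G"
  shows "h \<in> halves (contract_outside G X y) \<longleftrightarrow>
    h \<in> halves G \<and> (att G h \<in> X \<or> att G (mate G h) \<in> X)"
proof
  assume "h \<in> halves (contract_outside G X y)"
  then obtain e g where e: "e \<in> edges G" "h \<in> e" "g \<in> e" "att G g \<in> X" by (auto simp: halves_def)
  then have h: "h \<in> halves G" by (auto simp: halves_def)
  have "e = {h, mate G h}" by (rule edge_mate[OF assms h e(1,2)])
  then show "h \<in> halves G \<and> (att G h \<in> X \<or> att G (mate G h) \<in> X)" using h e by auto
next
  assume h: "h \<in> halves G \<and> (att G h \<in> X \<or> att G (mate G h) \<in> X)"
  then have "{h, mate G h} \<in> edges (contract_outside G X y)" using mate_edge[OF assms] by auto
  then show "h \<in> halves (contract_outside G X y)" unfolding halves_def by blast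
qed

lemma halves_at_contract:
  assumes "pregraph G" "u \<in> X" "y \<notin> X"
  shows "halves_at (contract_outside G X y) u = halves_at G u"
  unfolding halves_at_def halves_contract_iff[OF assms(1)] using assms(2,3) by auto

text \<open>The half-edges attached to \<open>y\<close> are the outer ends of the cut edges, and no
  kept edge lies entirely at \<open>y\<close>; so its degree is the size of the cut.\<close>

lemma even_regular_contract:
  assumes G: "even_regular k G" and X: "X \<subseteq> verts G" "y \<notin> X" and cut: "card (cut_edges G X) = 2 * k"
  shows "even_regular k (contract_outside G X y)"
proof -
  let ?C = "contract_outside G X y"
  note P = even_regular_pregraph[OF G] and PC = pregraph_contract[OF even_regular_pregraph[OF G], of X y]
  show ?thesis
  proof (rule even_regularI)
    show "finite (verts ?C)" using finite_subset[OF X(1) even_regular_finite[OF G]] by simp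
    have at_y: "halves_at ?C y = {h \<in> halves ?C. att G h \<notin> X}" using X(2) by (auto simp: halves_at_def)
    have cut_eq: "{e \<in> edges ?C. (\<exists>h\<in>e. att G h \<notin> X) \<and> (\<exists>h\<in>e. \<not> att G h \<notin> X)} = cut_edges G X"
      by (auto simp: cut_edges_def)
    have none: "{e \<in> edges ?C. \<forall>h\<in>e. att G h \<notin> X} = {}" by auto
    have "edges ?C \<in> pairings (halves ?C)" using PC by (simp add: pregraph_def)
    from card_pairing_split[OF this finite_halves[OF PC], of "\<lambda>h. att G h \<notin> X"]
    have "card (halves_at ?C y) = 2 * k"
      unfolding at_y cut_eq none cut by simp
    then show "card (halves_at ?C u) = 2 * k" if "u \<in> verts ?C" for u
      using that even_regular_card[OF G, of u] X halves_at_contract[OF P, of u X y] by auto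
  qed (use even_regular_k[OF G] PC in auto)
qed

text \<open>The cut uses up the degree of \<open>v\<close>, so \<open>v\<close> has no loop and the
  contraction consists of two vertices joined by \<open>2k\<close> parallel edges.\<close>

lemma closed_martin_contract_singleton:
  assumes G: "even_regular k G" and v: "v \<in> verts G" "y \<noteq> v" and cut: "card (cut_edges G {v}) = 2 * k"
  shows "closed_martin k (contract_outside G {v} y) = 1 / fact k"
proof (rule closed_martin_two_vertices)
  show "even_regular k (contract_outside G {v} y)" using even_regular_contract[OF G _ _ cut] v by simp
  show "card (verts (contract_outside G {v} y)) = 2" using v(2) by simp
  have none: "{e \<in> edges G. \<forall>h\<in>e. att G h \<in> {v}} = {}"
    using card_cut_vertex(1)[OF G v(1)] cut loopless_at_iff[OF even_regular_pregraph[OF G]] by blast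
  show "\<not> has_loop (contract_outside G {v} y)"
  proof
    assume "has_loop (contract_outside G {v} y)"
    then obtain e g where e: "e \<in> edges G" "g \<in> e" "att G g = v"
      and const: "\<And>h. h \<in> e \<Longrightarrow> (if att G h = v then v else y) = v"
      unfolding has_loop_def by fastforce
    have "att G h = v" if "h \<in> e" for h using const[OF that] v(2) by (simp split: if_splits)
    then have "e \<in> {e \<in> edges G. \<forall>h\<in>e. att G h \<in> {v}}" using e(1) by simp
    then show False using none by blast
  qed
qed

lemma not_loopless_atI:
  assumes "pregraph G" "e \<in> edges G" "\<And>h. h \<in> e \<Longrightarrow> att G h = v"
  shows "\<not> loopless_at G v"
  unfolding loopless_at_iff[OF assms(1)] using assms(2,3) by blast

text \<open>For each transition at \<open>v\<close> in \<open>X\<close> that keeps the cut at size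
  \<open>2k\<close>, resolving commutes with the contraction of \<open>Y\<close> and leaves the
  contraction of \<open>X\<close> unchanged up to isomorphism. \<open>X\<close> shrinks in the
  induction while \<open>Y\<close>, \<open>y\<close> and \<open>z\<close> stay fixed.\<close>

lemma closed_martin_product:
  assumes "even_regular k G" "bipartition G X Y" "card (cut_edges G X) = 2 * k" "y \<notin> X" "z \<notin> Y"
  shows "closed_martin k G =
    fact k * closed_martin k (contract_outside G X y) * closed_martin k (contract_outside G Y z)"
  using assms(1-4)
proof (induction "card X" arbitrary: G X rule: less_induct)
  case less
  note GR = less.prems(1) and B = less.prems(2) and cut = less.prems(3) and yX = less.prems(4)
  note P = even_regular_pregraph[OF GR]
  have sub: "X \<subseteq> verts G" "Y \<subseteq> verts G" "X \<inter> Y = {}" "X \<union> Y = verts G" using B by (auto simp: bipartition_def)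
  have cutY: "card (cut_edges G Y) = 2 * k" using cut bipartition_cut_edges[OF GR B] by simp
  let ?C1 = "contract_outside G X y" and ?C2 = "contract_outside G Y z"
  have C1: "even_regular k ?C1" by (rule even_regular_contract[OF GR sub(1) yX cut])
  have P1: "pregraph ?C1" and P2: "pregraph ?C2" by (rule pregraph_contract[OF P])+
  have att_verts: "att G h \<in> X \<or> att G h \<in> Y" if "h \<in> halves G" for h
    using even_regular_att[OF GR that] sub by auto
  obtain v where vX: "v \<in> X" using B by (auto simp: bipartition_def)
  have vG: "v \<in> verts G" "v \<notin> Y" "v \<noteq> y" using vX sub yX by auto
  have two: "card (verts G) \<ge> 2" using bipartition_card[OF GR B] by simp
  show ?case
  proof (cases "X = {v}")
    case True
    \<comment> \<open>Contracting the single vertex \<open>v\<close> only renames it to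
      \<open>z\<close>, since every edge meets \<open>Y\<close>.\<close>
    have "closed_martin k ?C2 = closed_martin k G"
    proof (rule closed_martin_image[OF P, where \<phi> = id])
      have l: "loopless_at G v" using card_cut_vertex(1)[OF GR vG(1)] cut True by simp
      have "\<exists>h\<in>e. att G h \<in> Y" if e: "e \<in> edges G" for e
      proof (rule ccontr)
        assume none: "\<not> ?thesis"
        have "att G h = v" if "h \<in> e" for h
          using att_verts[of h] that e none True by (auto simp: halves_def)
        then show False using not_loopless_atI[OF P e] l by blast
      qed
      then show "edges ?C2 = (`) id ` edges G" by auto
      have "att G h = v \<longleftrightarrow> att G h \<notin> Y" if "h \<in> halves G" for h
        using att_verts[OF that] True vG(2) by auto
      then show "att ?C2 (id h) = att ?C2 (id h') \<longleftrightarrow> att G h = att G h'"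
        if "h \<in> halves G" "h' \<in> halves G" for h h'
        using that \<open>z \<notin> Y\<close> by (smt (verit) contract_outside_simps(3) id_apply)
    qed simp
    moreover have "closed_martin k ?C1 = 1 / fact k"
      unfolding True by (rule closed_martin_contract_singleton[OF GR]) (use vG cut True in auto)
    ultimately show ?thesis by simp
  next
    case big: False
    have two1: "card (insert y (X - {v})) \<ge> 2"
    proof -
      have "finite X" using bipartition_card(1)[OF GR B] .
      moreover have "X - {v} \<noteq> {}" using big vX by auto
      ultimately have "card (X - {v}) > 0" by (simp add: card_gt_0_iff)
      then show ?thesis using \<open>finite X\<close> yX by simp
    qed
    show ?thesis
    proof (cases "loopless_at G v")
      case False
      from P this obtain a a' where a: "{a, a'} \<in> edges G" "a \<noteq> a'" "att G a = v" "att G a' = v" by (rule loopE)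
      have "\<not> loopless_at ?C1 v"
        by (rule not_loopless_atI[OF P1, of "{a, a'}"]) (use a vX in auto)
      moreover have "card (verts ?C1) \<ge> 2"
        using two1 bipartition_card(1)[OF GR B] card_mono[of "insert y X" "insert y (X - {v})"] by fastforce
      ultimately have "closed_martin k ?C1 = 0" using closed_martin_loop[OF C1, of v] vX by simp
      then show ?thesis using closed_martin_loop[OF GR vG(1) False two] by simp
    next
      case l: True
      have at1: "halves_at ?C1 v = halves_at G v" by (rule halves_at_contract[OF P vX yX])
      have mate1: "mate ?C1 h = mate G h" if "h \<in> halves_at G v" for h
        using that at1 halves_at_subset[of ?C1 v] by (intro mate_subgraph[OF P P1]) auto
      have l1: "loopless_at ?C1 v"
        unfolding loopless_at_def at1 using l mate1 vG(3) vX by (auto simp: loopless_at_def)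
      \<comment> \<open>\<open>G\<close> and its first contraction have the same half-edges at
        \<open>v\<close>, so the two expansions are compared term by term, with the second
        contraction as a constant factor.\<close>
      have tr: "transitions ?C1 v = transitions G v" by (simp add: transitions_def at1)
      have summand: "closed_martin k (resolve G v \<tau>) =
        fact k * closed_martin k (resolve ?C1 v \<tau>) * closed_martin k ?C2" if t: "\<tau> \<in> transitions G v" for \<tau>
      proof -
        interpret resolution G v \<tau> using P l t by unfold_locales (simp_all add: transitions_def)
        let ?R = "resolve G v \<tau>" and ?R1 = "resolve ?C1 v \<tau>"
        let ?S = "{p \<in> \<tau>. \<forall>h\<in>p. att G (mate G h) \<in> Y}"
        have fin: "finite ?S" using finite_pairing[OF \<tau> finite_halves_at[OF P]] by simp
        have R: "even_regular k ?R" by (rule even_regular_resolve[OF GR l two t])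
        have R1: "even_regular k ?R1"
          using even_regular_resolve[OF C1 l1 _ t[folded tr]] two1 bipartition_card(1)[OF GR B]
            card_mono[of "insert y X" "insert y (X - {v})"] by fastforce
        have RB: "bipartition ?R (X - {v}) Y" using B vX big by (auto simp: bipartition_def)
        \<comment> \<open>Measured from \<open>Y\<close>, the cut loses two edges for each pair in
          \<open>?S\<close>; complementation transfers this to \<open>X - {v}\<close>.\<close>
        have cutR: "2 * k = card (cut_edges ?R (X - {v})) + 2 * card ?S"
          using card_cut_edges_eq_resolve[OF vG(2)] cutY bipartition_cut_edges[OF R RB] by simp
        have in_at: "h \<in> halves_at G v" if "p \<in> \<tau>" "h \<in> p" for p h
          using pairings_Union[OF \<tau>] that by auto
        show ?thesis
        proof (cases "?S = {}")
          case False
          then have "card ?S > 0" using fin by (simp add: card_gt_0_iff)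
          then have "closed_martin k ?R = 0" using closed_martin_small_cut[OF R RB] cutR by simp
          \<comment> \<open>A pair with both far ends in \<open>Y\<close> becomes a loop at the
            contracted vertex \<open>y\<close>.\<close>
          moreover have "closed_martin k ?R1 = 0"
          proof (rule closed_martin_loop[OF R1])
            obtain p where p: "p \<in> \<tau>" "\<And>h. h \<in> p \<Longrightarrow> att G (mate G h) \<in> Y" using False by auto
            show "\<not> loopless_at ?R1 y"
            proof (rule not_loopless_atI[OF even_regular_pregraph[OF R1]])
              show "mate ?C1 ` p \<in> edges ?R1" using p(1) by (simp add: resolve_def)
              show "att ?R1 g = y" if "g \<in> mate ?C1 ` p" for g
                using that mate1[OF in_at[OF p(1)]] p(2) sub(3) by auto
            qed
          qed (use two1 vG(3) in \<open>simp_all add: insert_Diff_if\<close>)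
          ultimately show ?thesis by simp
        next
          case True
          \<comment> \<open>Every edge from \<open>Y\<close> to \<open>v\<close> is now merged with
            an edge from \<open>v\<close> into \<open>X\<close>; this makes \<open>reroute\<close>
            injective on the second contraction.\<close>
          have split: "att G (mate G (partner \<tau> h)) \<notin> Y" if "h \<in> halves_at G v" "att G (mate G h) \<in> Y" for h
          proof
            assume "att G (mate G (partner \<tau> h)) \<in> Y"
            then have "{h, partner \<tau> h} \<in> ?S" using partner_at(4)[OF that(1)] that(2) by simp
            then show False using True by blast
          qed
          have "closed_martin k ?R = fact k * closed_martin k (contract_outside ?R (X - {v}) y) *
              closed_martin k (contract_outside ?R Y z)"
          proof (rule less.hyps[OF _ R RB])
            show "card (X - {v}) < card X"
              using bipartition_card(1)[OF GR B] vX by (intro psubset_card_mono) auto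
          qed (use cutR True yX in auto)
          also have "closed_martin k (contract_outside ?R (X - {v}) y) = closed_martin k ?R1"
          proof (rule closed_martin_image[OF even_regular_pregraph[OF R1], where \<phi> = id])
            have mates: "mate ?C1 ` p = mate G ` p" if "p \<in> \<tau>" for p
              by (rule image_cong[OF refl mate1[OF in_at[OF that]]])
            \<comment> \<open>As \<open>?S\<close> is empty, every pair has a far end in
              \<open>X - {v}\<close>, so its merged edge survives the contraction of
              \<open>Y\<close>.\<close>
            have meets: "\<exists>h\<in>mate G ` p. att G h \<in> X - {v}" if p: "p \<in> \<tau>" for p
            proof -
              obtain h where h: "h \<in> p" "att G (mate G h) \<notin> Y" using True p by blast
              have "mate G h \<in> halves G" "att G (mate G h) \<noteq> v"
                using mate_in[OF in_at[OF p h(1)]] mate_not_at[OF in_at[OF p h(1)]] by auto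
              then show ?thesis using att_verts[of "mate G h"] h by auto
            qed
            have "edges ?R1 = {e \<in> edges G. (\<exists>h\<in>e. att G h \<in> X) \<and> (\<forall>h\<in>e. att G h \<noteq> v)} \<union> (`) (mate G) ` \<tau>"
            proof -
              have "(`) (mate ?C1) ` \<tau> = (`) (mate G) ` \<tau>" by (rule image_cong[OF refl mates])
              moreover have "{e \<in> edges ?C1. \<forall>h\<in>e. att ?C1 h \<noteq> v} = {e \<in> edges G. (\<exists>h\<in>e. att G h \<in> X) \<and> (\<forall>h\<in>e. att G h \<noteq> v)}"
                using vX vG(3) by auto
              ultimately show ?thesis by (simp add: resolve_def)
            qed
            moreover have "edges (contract_outside ?R (X - {v}) y) = {e \<in> edges ?R. \<exists>h\<in>e. att G h \<in> X - {v}}" by simp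
            moreover have "\<dots> = {e \<in> edges G. (\<exists>h\<in>e. att G h \<in> X) \<and> (\<forall>h\<in>e. att G h \<noteq> v)} \<union> (`) (mate G) ` \<tau>"
              unfolding resolve_def mgraph.simps using meets by blast
            ultimately have E: "edges (contract_outside ?R (X - {v}) y) = edges ?R1" by simp
            then show "edges (contract_outside ?R (X - {v}) y) = (`) id ` edges ?R1" by simp
            have "att (contract_outside ?R (X - {v}) y) h = att ?R1 h" if h: "h \<in> halves ?R1" for h
            proof -
              have "h \<in> halves (contract_outside ?R (X - {v}) y)" using h E by (simp add: halves_def)
              then have "h \<in> halves ?R" by (simp add: halves_contract_iff[OF pregraph_resolve])
              then have "att G h \<noteq> v" by (simp add: halves_resolve halves_at_def)
              then show ?thesis by simp
            qed
            then show "att (contract_outside ?R (X - {v}) y) (id h) = att (contract_outside ?R (X - {v}) y) (id h') \<longleftrightarrow>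
                att ?R1 h = att ?R1 h'" if "h \<in> halves ?R1" "h' \<in> halves ?R1" for h h'
              using that by simp
          qed simp
          \<comment> \<open>A cut edge from \<open>Y\<close> to \<open>v\<close> becomes a longer
            one ending in \<open>X - {v}\<close>. \<open>reroute\<close> moves its half-edge at
            \<open>v\<close> to that new end, and both are attached to \<open>z\<close> after
            contraction.\<close>
          also have "closed_martin k (contract_outside ?R Y z) = closed_martin k ?C2"
          proof (rule closed_martin_image[OF P2, where \<phi> = "reroute G v \<tau>"])
            let ?r = "reroute G v \<tau>"
            have in_C2: "h \<in> halves_at G v" "att G (mate G h) \<in> Y" if "h \<in> halves ?C2" "att G h = v" for h
              using that vG(2) by (auto simp: halves_contract_iff[OF P] halves_at_def)
            have r_at: "?r h = mate G (partner \<tau> h)" if "att G h = v" for h using that by (simp add: reroute_def)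
            have r_off: "?r h = h" if "att G h \<noteq> v" for h using that by (simp add: reroute_def)
            \<comment> \<open>If a half-edge off \<open>v\<close> were the new end of
              \<open>g\<close>, its edge in \<open>G\<close> would lead to \<open>v\<close>, so
              lying in \<open>?C2\<close> would force it into \<open>Y\<close>, against
              \<open>split\<close>.\<close>
            have clash: False if g: "g \<in> halves ?C2" "att G g = v" and g': "g' \<in> halves ?C2" "att G g' \<noteq> v"
              and eq: "?r g = ?r g'" for g g'
            proof -
              note gv = in_C2[OF g]
              have g'_eq: "g' = mate G (partner \<tau> g)" using eq r_at[OF g(2)] r_off[OF g'(2)] by simp
              have "partner \<tau> g \<in> halves G" "att G (partner \<tau> g) = v" using partner_at(1)[OF gv(1)] by (auto simp: halves_at_def)
              then have "mate G g' = partner \<tau> g" unfolding g'_eq by (intro mate_mate[OF P])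
              then have "att G g' \<in> Y"
                using g'(1) \<open>att G (partner \<tau> g) = v\<close> vG(2) by (auto simp: halves_contract_iff[OF P])
              then show False using split[OF gv] g'_eq by simp
            qed
            show "inj_on ?r (halves ?C2)"
            proof (rule inj_onI)
              fix g g' assume g: "g \<in> halves ?C2" "g' \<in> halves ?C2" "?r g = ?r g'"
              show "g = g'"
              proof (cases "att G g = v")
                case True
                then have g'v: "att G g' = v" using clash[OF g(1) True g(2) _ g(3)] by blast
                note at = in_C2(1)[OF g(1) True] in_C2(1)[OF g(2) g'v]
                have "mate G (partner \<tau> g) = mate G (partner \<tau> g')" using g(3) r_at True g'v by simp
                then have "partner \<tau> g = partner \<tau> g'"
                  by (rule inj_onD[OF inj_on_mate[OF P]]) (use partner_at(1) at halves_at_subset in fast)+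
                then show ?thesis using partner_at(2) at by metis
              next
                case False
                then have "att G g' \<noteq> v" using clash[OF g(2) _ g(1) False] g(3) by auto
                then show ?thesis using g(3) r_off False by simp
              qed
            qed
            show "edges (contract_outside ?R Y z) = (`) ?r ` edges ?C2"
            proof (intro equalityI subsetI)
              fix e assume "e \<in> edges (contract_outside ?R Y z)"
              then obtain e' where e': "e' \<in> edges G" "e = ?r ` e'" and meets: "\<exists>h\<in>e. att G h \<in> Y"
                by (auto simp: edges_resolve)
              show "e \<in> (`) ?r ` edges ?C2"
              proof (cases "\<exists>h\<in>e'. att G h \<in> Y")
                case True
                then show ?thesis using e' by auto
              next
                case off: False
                from e'(1) show ?thesis
                proof (cases rule: edge_cases)
                  case untouched
                  then show ?thesis using off meets e'(2) reroute_untouched[of e'] by auto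
                next
                  case (touched h)
                  \<comment> \<open>Here \<open>e'\<close> has no end in \<open>Y\<close>, so the
                    end of \<open>e\<close> in \<open>Y\<close> comes from the edge merged with
                    \<open>e'\<close>; that edge serves as the preimage.\<close>
                  let ?g = "partner \<tau> h"
                  note g = partner_at[OF touched(1)]
                  have e: "e = mate G ` {h, ?g}" using e'(2) touched(2) reroute_edge[OF touched(1)] by simp
                  then have "att G (mate G ?g) \<in> Y" using meets off touched(2) by auto
                  moreover have "{?g, mate G ?g} \<in> edges G" using mate_edge[OF P] g(1) halves_at_subset by fast
                  ultimately have "{?g, mate G ?g} \<in> edges ?C2" by auto
                  moreover have "e = ?r ` {?g, mate G ?g}"
                    unfolding e reroute_edge[OF g(1)] g(2) by (simp add: insert_commute)
                  ultimately show ?thesis by blast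
                qed
              qed
            next
              fix e assume "e \<in> (`) ?r ` edges ?C2"
              then obtain e' h where e': "e' \<in> edges G" "e = ?r ` e'" and h: "h \<in> e'" "att G h \<in> Y" by auto
              have "?r h = h" using h(2) vG(2) by (intro r_off) auto
              then have "h \<in> e" using e'(2) h(1) by force
              moreover have "e \<in> edges ?R" using e' by (auto simp: edges_resolve)
              ultimately show "e \<in> edges (contract_outside ?R Y z)" using h(2) by auto
            qed
            have "att (contract_outside ?R Y z) (?r h) = att ?C2 h" if "h \<in> halves ?C2" for h
              using that in_C2[of h] split[of h] r_at[of h] r_off[of h] vG(2) by (cases "att G h = v") auto
            then show "att (contract_outside ?R Y z) (?r h) = att (contract_outside ?R Y z) (?r h') \<longleftrightarrow>
              att ?C2 h = att ?C2 h'" if "h \<in> halves ?C2" "h' \<in> halves ?C2" for h h'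
              using that by simp
          qed
          finally show ?thesis .
        qed
      qed
      have "closed_martin k G = (\<Sum>\<tau>\<in>transitions G v. fact k * closed_martin k (resolve ?C1 v \<tau>) * closed_martin k ?C2)"
        unfolding closed_martin_resolve[OF P l] by (rule sum.cong[OF refl summand])
      also have "\<dots> = fact k * closed_martin k ?C1 * closed_martin k ?C2"
        unfolding closed_martin_resolve[OF P1 l1] tr by (simp only: sum_distrib_left sum_distrib_right)
      finally show ?thesis .
    qed
  qed
qed

theorem theorem1p2:
  fixes G :: "('v, 'h) mgraph" and k :: nat
  assumes "k \<ge> 1" and "multigraph G" and "regular G (2 * k)"
  shows "((\<exists>C. edge_cut G C \<and> card C < 2 * k) \<longrightarrow> martin k G = 0)
    \<and> (\<not> (\<exists>C. edge_cut G C \<and> card C < 2 * k) \<longrightarrow> martin k G > 0)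
    \<and> (\<forall>X Y y z. bipartition G X Y \<and> card (edges_between G X Y) = 2 * k \<and> y \<notin> X \<and> z \<notin> Y \<longrightarrow>
           martin k G =
             fact k * martin k (contract_outside G X y) * martin k (contract_outside G Y z))"
proof (intro conjI impI allI)
  have G: "even_regular k G" using assms by (simp add: even_regular_def)
  show "martin k G = 0" if small: "\<exists>C. edge_cut G C \<and> card C < 2 * k"
  proof -
    obtain X Y where B: "bipartition G X Y" and "card (edges_between G X Y) < 2 * k"
      using small by (auto simp: edge_cut_def)
    then show ?thesis
      using closed_martin_small_cut[OF G B] edges_between_left[OF G B] martin_eq_closed_martin[OF G] by simp
  qed
  show "martin k G > 0" if none: "\<not> (\<exists>C. edge_cut G C \<and> card C < 2 * k)"
    unfolding martin_eq_closed_martin[OF G]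
  proof (rule closed_martin_pos[OF G])
    fix Z assume "Z \<subseteq> verts G" "Z \<noteq> {}" "Z \<noteq> verts G"
    then have B: "bipartition G Z (verts G - Z)" by (auto simp: bipartition_def)
    then have "edge_cut G (cut_edges G Z)" using edges_between_left[OF G B] unfolding edge_cut_def by metis
    then show "2 * k \<le> card (cut_edges G Z)" using none not_le by blast
  qed
  fix X Y y z
  assume *: "bipartition G X Y \<and> card (edges_between G X Y) = 2 * k \<and> y \<notin> X \<and> z \<notin> Y"
  then have B: "bipartition G X Y" by simp
  have cut: "card (cut_edges G X) = 2 * k" "card (cut_edges G Y) = 2 * k"
    using * edges_between_left[OF G B] edges_between_right[OF G B] by simp_all
  have "X \<subseteq> verts G" "Y \<subseteq> verts G" using B by (auto simp: bipartition_def)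
  \<comment> \<open>Both contractions are \<open>2k\<close>-regular because the cut has exactly
    \<open>2k\<close> edges, so \<open>martin\<close> agrees with \<open>closed_martin\<close> on
    them even when only two vertices remain.\<close>
  then have C: "even_regular k (contract_outside G X y)" "even_regular k (contract_outside G Y z)"
    using even_regular_contract[OF G] cut * by simp_all
  show "martin k G = fact k * martin k (contract_outside G X y) * martin k (contract_outside G Y z)"
    unfolding martin_eq_closed_martin[OF G] martin_eq_closed_martin[OF C(1)] martin_eq_closed_martin[OF C(2)]
    by (rule closed_martin_product[OF G B cut(1)]) (use * in simp_all)
qed

end
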